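(* Universal may testing is undecidable for tests with two maximal runs. That is, there is no algorithm which, given a finite safe labeled Petri net $\mathcal N_0$ and a test $\mathcal T$ (as defined in the context), decides whether $$\forall \rho, \rho'.\ \mathcal N \,\|\, \mathcal N' \text{ may pass } \mathcal T,$$ where $\rho,\rho'$ range over the maximal runs of $\mathcal N_0$, $\mathcal N$ is the causal net of $\rho$ (with the original action labels of $\mathcal N_0$) and $\mathcal N'$ is the causal net of $\rho'$ with every action $u$ relabeled to a fresh primed copy $u'$; and this remains undecidable when restricted to tests $\mathcal T$ with two maximal runs.
   Context: A (labeled) Petri net is $\mathcal N=(A,Pl,\to,M_0)$ with $A$ a finite communication alphabet, $\tau\notin A$ an internal action, $Pl$ a set of places, $\to\subseteq \mathcal P_{nf}(Pl)\times(A\cup\{\tau\})\times\mathcal P_{nf}(Pl)$ the transitions ($\mathcal P_{nf}$ = nonempty finite subsets), and $M_0\in\mathcal P_{nf}(Pl)$ the initial marking. For a transition $t=(I,u,O)$, $pre(t)=I$, $post(t)=O$, $act(t)=u$. A transition $t$ is enabled at marking $M$ if $pre(t)\subseteq M$; firing yields $M'=(M- pre(t))\cup post(t)$. Nets are assumed safe (every reachable marking is a set) and contact-free. For a place $p$, $pre(p)=\{t: p\in post(t)\}$, $post(p)=\{t: p\in pre(t)\}$; the flow relation is $p\,\mathcal F\,q$ iff some transition $t$ has $p\in pre(t)$, $q\in post(t)$. A causal net is a net in which every place has $|pre(p)|\le1$ and $|post(p)|\le 1$, $\mathcal F$ is well-founded, and $M_0=\{p: pre(p)=\emptyset\}$.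 A causal net $\mathcal N_1$ is a causal net of a safe net $\mathcal N_2$ (same alphabet) if there is a map $f:Pl_1\to Pl_2$ with $f(M_{01})=M_{02}$, $f$ injective on every reachable marking of $\mathcal N_1$, and $(f(pre(t)),act(t),f(post(t)))$ a transition of $\mathcal N_2$ for every transition $t$ of $\mathcal N_1$; the pair $(\mathcal N_1,f)$ is a run of $\mathcal N_2$. A run is maximal if for every place $p$ of $\mathcal N_1$, whenever $f(p)\,\mathcal F_{\mathcal N_2}\, q$ for some $q$, there is $p'$ with $p\,\mathcal F_{\mathcal N_1}\, p'$. Parallel composition of nets $\mathcal N_i=(A_i,Pl_i,\to_i,M_{0i})$ with disjoint places: $\mathcal N_1\|\mathcal N_2=(A_1\cup A_2,Pl_1\cup Pl_2,\to,M_{01}\cup M_{02})$ where $\to$ contains all transitions of $\to_1\cup\to_2$ whose action is not in $A_1\cap A_2$, plus $(I_1\cup I_2,a,O_1\cup O_2)$ for every $a\in A_1\cap A_2$ with $(I_1,a,O_1)\in\to_1$, $(I_2,a,O_2)\in\to_2$ ($\tau$ never synchronizes). A test is a net $\mathcal T=(A,Pl,\checkmark,\to,M_0)$ with a distinguished set $\checkmark\subseteq Pl$ of successful places. A run of $\mathcal N\|\mathcal T$ is deadlock free if it is infinite, and terminates successfully if it is finite and all places of $\mathcal T$ in it without causal successor are in $\checkmark$. $\mathcal N$ may pass $\mathcal T$ if some maximal run of $\mathcal N\|\mathcal T$ is deadlock free or terminates successfully. *)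

theory Defs
  imports "HOL-Library.Multiset" "HOL-Library.Nat_Bijection"
begin

section \<open>Labeled Petri nets\<close>

text \<open>The internal action \<open>\<tau>\<close> is \<^term>\<open>None\<close>; a communication \<open>a\<close> is \<^term>\<open>Some a\<close>.\<close>

type_synonym ('a, 'p) transition = "'p set \<times> 'a option \<times> 'p set"

record ('a, 'p) net =
  alphabet :: "'a set"
  places :: "'p set"
  transitions :: "('a, 'p) transition set"
  initial :: "'p set"

record ('a, 'p) test = "('a, 'p) net" +
  success :: "'p set"

fun pre :: "('a, 'p) transition \<Rightarrow> 'p set" where "pre (I, u, J) = I"
fun act :: "('a, 'p) transition \<Rightarrow> 'a option" where "act (I, u, J) = u"
fun post :: "('a, 'p) transition \<Rightarrow> 'p set" where "post (I, u, J) = J"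

definition nonempty_finite_subsets :: "'p set \<Rightarrow> 'p set set" where
  "nonempty_finite_subsets P = {M. M \<subseteq> P \<and> finite M \<and> M \<noteq> {}}"

definition petri_net :: "('a, 'p, 'z) net_scheme \<Rightarrow> bool" where
  "petri_net N \<longleftrightarrow>
     finite (alphabet N) \<and>
     transitions N \<subseteq> nonempty_finite_subsets (places N) \<times>
       insert None (Some ` alphabet N) \<times> nonempty_finite_subsets (places N) \<and>
     initial N \<in> nonempty_finite_subsets (places N)"

definition enabled :: "('a, 'p) transition \<Rightarrow> 'p set \<Rightarrow> bool" where
  "enabled t M \<longleftrightarrow> pre t \<subseteq> M"

definition fire :: "('a, 'p) transition \<Rightarrow> 'p set \<Rightarrow> 'p set" where
  "fire t M = (M - pre t) \<union> post t"

inductive reachable :: "('a, 'p, 'z) net_scheme \<Rightarrow> 'p set \<Rightarrow> bool"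
  for N :: "('a, 'p, 'z) net_scheme" where
  initial: "reachable N (initial N)"
| step: "reachable N M \<Longrightarrow> t \<in> transitions N \<Longrightarrow> enabled t M \<Longrightarrow> reachable N (fire t M)"

definition contact_free :: "('a, 'p, 'z) net_scheme \<Rightarrow> bool" where
  "contact_free N \<longleftrightarrow>
     (\<forall>M t. reachable N M \<longrightarrow> t \<in> transitions N \<longrightarrow> enabled t M \<longrightarrow> (M - pre t) \<inter> post t = {})"

text \<open>
  That every reachable marking is a set is a statement about the token game on multisets; in the
  game on sets above it would hold by typing.
\<close>

inductive token_reachable :: "('a, 'p, 'z) net_scheme \<Rightarrow> 'p multiset \<Rightarrow> bool"
  for N :: "('a, 'p, 'z) net_scheme" where
  initial: "token_reachable N (mset_set (initial N))"
| step: "token_reachable N M \<Longrightarrow> t \<in> transitions N \<Longrightarrow> mset_set (pre t) \<subseteq># M \<Longrightarrow>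
    token_reachable N (M - mset_set (pre t) + mset_set (post t))"

definition safe :: "('a, 'p, 'z) net_scheme \<Rightarrow> bool" where
  "safe N \<longleftrightarrow> (\<forall>M p. token_reachable N M \<longrightarrow> count M p \<le> 1)"

definition finite_safe_net :: "('a, 'p, 'z) net_scheme \<Rightarrow> bool" where
  "finite_safe_net N \<longleftrightarrow> petri_net N \<and> finite (places N) \<and> safe N \<and> contact_free N"

definition place_pre :: "('a, 'p, 'z) net_scheme \<Rightarrow> 'p \<Rightarrow> ('a, 'p) transition set" where
  "place_pre N p = {t \<in> transitions N. p \<in> post t}"

definition place_post :: "('a, 'p, 'z) net_scheme \<Rightarrow> 'p \<Rightarrow> ('a, 'p) transition set" where
  "place_post N p = {t \<in> transitions N. p \<in> pre t}"

definition flow :: "('a, 'p, 'z) net_scheme \<Rightarrow> ('p \<times> 'p) set" where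
  "flow N = {(p, q). \<exists>t \<in> transitions N. p \<in> pre t \<and> q \<in> post t}"


section \<open>Causal nets and runs\<close>

definition causal_net :: "('a, 'p) net \<Rightarrow> bool" where
  "causal_net K \<longleftrightarrow>
     petri_net K \<and>
     (\<forall>p \<in> places K. finite (place_pre K p) \<and> card (place_pre K p) \<le> 1 \<and>
                     finite (place_post K p) \<and> card (place_post K p) \<le> 1) \<and>
     wf (flow K) \<and>
     initial K = {p \<in> places K. place_pre K p = {}}"

definition is_run :: "('a, 'q, 'z) net_scheme \<Rightarrow> ('a, 'p) net \<Rightarrow> ('p \<Rightarrow> 'q) \<Rightarrow> bool" where
  "is_run N K f \<longleftrightarrow>
     causal_net K \<and>
     alphabet K = alphabet N \<and>
     f ` places K \<subseteq> places N \<and>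
     f ` initial K = initial N \<and>
     (\<forall>M. reachable K M \<longrightarrow> inj_on f M) \<and>
     (\<forall>t \<in> transitions K. (f ` pre t, act t, f ` post t) \<in> transitions N)"

definition maximal_run :: "('a, 'q, 'z) net_scheme \<Rightarrow> ('a, 'p) net \<Rightarrow> ('p \<Rightarrow> 'q) \<Rightarrow> bool" where
  "maximal_run N K f \<longleftrightarrow>
     is_run N K f \<and>
     (\<forall>p \<in> places K. (\<exists>q. (f p, q) \<in> flow N) \<longrightarrow> (\<exists>p'. (p, p') \<in> flow K))"

definition run_iso ::
  "('a, 'p) net \<Rightarrow> ('p \<Rightarrow> 'q) \<Rightarrow> ('a, 'r) net \<Rightarrow> ('r \<Rightarrow> 'q) \<Rightarrow> bool" where
  "run_iso K f L g \<longleftrightarrow>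
     alphabet K = alphabet L \<and>
     (\<exists>h. bij_betw h (places K) (places L) \<and>
          h ` initial K = initial L \<and>
          (\<lambda>(I, u, J). (h ` I, u, h ` J)) ` transitions K = transitions L \<and>
          (\<forall>p \<in> places K. g (h p) = f p))"

text \<open>
  A causal net has countably many places: the initial marking is finite, every transition has a
  nonempty finite preset and a finite postset, no place branches, and the flow is well-founded.
  Up to isomorphism, quantifying over the runs of a net is therefore quantifying over those whose
  places are natural numbers. This is used here and in the definitions below.
\<close>

definition two_maximal_runs :: "('a, 'q, 'z) net_scheme \<Rightarrow> bool" where
  "two_maximal_runs N \<longleftrightarrow>
     (\<exists>(K\<^sub>1 :: ('a, nat) net) f\<^sub>1 (K\<^sub>2 :: ('a, nat) net) f\<^sub>2.
        maximal_run N K\<^sub>1 f\<^sub>1 \<and> maximal_run N K\<^sub>2 f\<^sub>2 \<and> \<not> run_iso K\<^sub>1 f\<^sub>1 K\<^sub>2 f\<^sub>2 \<and>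
        (\<forall>(K :: ('a, nat) net) f. maximal_run N K f \<longrightarrow>
           run_iso K f K\<^sub>1 f\<^sub>1 \<or> run_iso K f K\<^sub>2 f\<^sub>2))"


section \<open>Parallel composition and testing\<close>

text \<open>Disjointness of the places is obtained by tagging them with \<^term>\<open>Inl\<close> and \<^term>\<open>Inr\<close>.\<close>

definition par ::
  "('a, 'p, 'y) net_scheme \<Rightarrow> ('a, 'q, 'z) net_scheme \<Rightarrow> ('a, 'p + 'q) net" (infixl "\<parallel>" 65) where
  "N\<^sub>1 \<parallel> N\<^sub>2 =
     \<lparr>alphabet = alphabet N\<^sub>1 \<union> alphabet N\<^sub>2,
      places = places N\<^sub>1 <+> places N\<^sub>2,
      transitions =
        {(Inl ` I, u, Inl ` J) | I u J.
           (I, u, J) \<in> transitions N\<^sub>1 \<and> u \<notin> Some ` (alphabet N\<^sub>1 \<inter> alphabet N\<^sub>2)} \<union>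
        {(Inr ` I, u, Inr ` J) | I u J.
           (I, u, J) \<in> transitions N\<^sub>2 \<and> u \<notin> Some ` (alphabet N\<^sub>1 \<inter> alphabet N\<^sub>2)} \<union>
        {(I\<^sub>1 <+> I\<^sub>2, Some a, J\<^sub>1 <+> J\<^sub>2) | I\<^sub>1 I\<^sub>2 a J\<^sub>1 J\<^sub>2.
           a \<in> alphabet N\<^sub>1 \<inter> alphabet N\<^sub>2 \<and>
           (I\<^sub>1, Some a, J\<^sub>1) \<in> transitions N\<^sub>1 \<and> (I\<^sub>2, Some a, J\<^sub>2) \<in> transitions N\<^sub>2},
      initial = initial N\<^sub>1 <+> initial N\<^sub>2\<rparr>"

definition is_test :: "('a, 'p) test \<Rightarrow> bool" where
  "is_test T \<longleftrightarrow> finite_safe_net T \<and> success T \<subseteq> places T"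

definition deadlock_free :: "('a, 'r) net \<Rightarrow> bool" where
  "deadlock_free K \<longleftrightarrow> infinite (places K)"

definition terminates_successfully ::
  "('a, 'q) test \<Rightarrow> ('a, 'r) net \<Rightarrow> ('r \<Rightarrow> 'p + 'q) \<Rightarrow> bool" where
  "terminates_successfully T K f \<longleftrightarrow>
     finite (places K) \<and>
     (\<forall>p \<in> places K. \<forall>q. f p = Inr q \<longrightarrow> (\<nexists>p'. (p, p') \<in> flow K) \<longrightarrow> q \<in> success T)"

definition may_pass :: "('a, 'p) net \<Rightarrow> ('a, 'q) test \<Rightarrow> bool" where
  "may_pass N T \<longleftrightarrow>
     (\<exists>(K :: ('a, nat) net) f. maximal_run (N \<parallel> T) K f \<and>
        (deadlock_free K \<or> terminates_successfully T K f))"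

definition relabel :: "('a \<Rightarrow> 'b) \<Rightarrow> ('a, 'p) net \<Rightarrow> ('b, 'p) net" where
  "relabel g N =
     \<lparr>alphabet = g ` alphabet N,
      places = places N,
      transitions = (\<lambda>(I, u, J). (I, map_option g u, J)) ` transitions N,
      initial = initial N\<rparr>"

text \<open>
  A test over pairs of runs has actions in \<^typ>\<open>'a + 'a\<close>: \<^term>\<open>Inl a\<close> is the original action
  \<open>a\<close> and \<^term>\<open>Inr a\<close> its primed copy. The internal action has no primed copy.
\<close>

definition universal_may :: "('a, 'p) net \<Rightarrow> ('a + 'a, 'q) test \<Rightarrow> bool" where
  "universal_may N\<^sub>0 T \<longleftrightarrow>
     (\<forall>(N :: ('a, nat) net) f (N' :: ('a, nat) net) f'.
        maximal_run N\<^sub>0 N f \<longrightarrow> maximal_run N\<^sub>0 N' f' \<longrightarrow>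
        may_pass (relabel Inl N \<parallel> relabel Inr N') T)"


section \<open>Decidability\<close>

text \<open>Partial recursive functions, with their graph as semantics.\<close>

datatype recf = Zero | Succ | Proj nat | Comp recf "recf list" | PrimRec recf recf | Mu recf

inductive computes :: "recf \<Rightarrow> nat list \<Rightarrow> nat \<Rightarrow> bool" where
  Zero: "computes Zero xs 0"
| Succ: "computes Succ [x] (Suc x)"
| Proj: "i < length xs \<Longrightarrow> computes (Proj i) xs (xs ! i)"
| Comp: "list_all2 (\<lambda>g y. computes g xs y) gs ys \<Longrightarrow> computes f ys z \<Longrightarrow> computes (Comp f gs) xs z"
| PrimRec_0: "computes f xs y \<Longrightarrow> computes (PrimRec f g) (0 # xs) y"
| PrimRec_Suc: "computes (PrimRec f g) (n # xs) y \<Longrightarrow> computes g (n # y # xs) z \<Longrightarrow>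
    computes (PrimRec f g) (Suc n # xs) z"
| Mu: "computes f (n # xs) 0 \<Longrightarrow> (\<forall>m<n. \<exists>k. computes f (m # xs) (Suc k)) \<Longrightarrow> computes (Mu f) xs n"

lemma computes_deterministic:
  "computes f xs y \<Longrightarrow> computes f xs z \<Longrightarrow> y = z"
proof (induction f xs y arbitrary: z rule: computes.induct)
  case (Comp xs gs ys f w)
  from Comp.prems obtain ys' where
    ys': "list_all2 (\<lambda>g y. computes g xs y) gs ys'" "computes f ys' z"
    by (auto elim: computes.cases)
  have "ys = ys'"
    using Comp.IH(1) ys'(1) by (auto simp: list_all2_conv_all_nth intro!: nth_equalityI)
  with Comp.IH(2) ys'(2) show ?case by simp
next
  case (Mu f n xs)
  from Mu.prems have z: "computes f (z # xs) 0" "\<forall>m<z. \<exists>k. computes f (m # xs) (Suc k)"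
    by (auto elim: computes.cases)
  have "\<not> n < z" using Mu.IH(1) z(2) by fastforce
  moreover have "\<not> z < n" using Mu.IH(2) z(1) by fastforce
  ultimately show ?case by simp
next
  case (PrimRec_0 f xs y g)
  from PrimRec_0.prems have "computes f xs z" by (auto elim: computes.cases)
  with PrimRec_0.IH show ?case by simp
next
  case (PrimRec_Suc f g n xs y w)
  from PrimRec_Suc.prems obtain y' where
    "computes (PrimRec f g) (n # xs) y'" "computes g (n # y' # xs) z"
    by (auto elim: computes.cases)
  with PrimRec_Suc.IH show ?case by blast
qed (auto elim: computes.cases)

text \<open>
  \<open>code\<close> presents the instances to the algorithm. The algorithm has to halt with the right answer
  on every instance in \<open>D\<close>; nothing is required of it on other inputs.
\<close>

definition decidable_on :: "('i \<Rightarrow> nat) \<Rightarrow> 'i set \<Rightarrow> ('i \<Rightarrow> bool) \<Rightarrow> bool" where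
  "decidable_on code D P \<longleftrightarrow> (\<exists>f. \<forall>x \<in> D. computes f [code x] (if P x then 1 else 0))"

text \<open>
  Finite nets are coded with the library bijections; up to renaming, their places and
  communications are natural numbers.
\<close>

fun encode_action :: "('a \<Rightarrow> nat) \<Rightarrow> 'a option \<Rightarrow> nat" where
  "encode_action c None = 0"
| "encode_action c (Some a) = Suc (c a)"

fun encode_transition :: "('a \<Rightarrow> nat) \<Rightarrow> ('a, nat) transition \<Rightarrow> nat" where
  "encode_transition c (I, u, J) =
     prod_encode (set_encode I, prod_encode (encode_action c u, set_encode J))"

definition encode_net :: "('a \<Rightarrow> nat) \<Rightarrow> ('a, nat, 'z) net_scheme \<Rightarrow> nat" where
  "encode_net c N =
     prod_encode (set_encode (c ` alphabet N),
       prod_encode (set_encode (places N),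
         prod_encode (set_encode (encode_transition c ` transitions N),
           set_encode (initial N))))"

fun encode_instance :: "(nat, nat) net \<times> (nat + nat, nat) test \<Rightarrow> nat" where
  "encode_instance (N\<^sub>0, T) =
     prod_encode (encode_net id N\<^sub>0,
       prod_encode (encode_net sum_encode T, set_encode (success T)))"

definition testing_instances :: "((nat, nat) net \<times> (nat + nat, nat) test) set" where
  "testing_instances = {(N\<^sub>0, T). finite_safe_net N\<^sub>0 \<and> is_test T}"

lemma finite_safe_netD:
  assumes "finite_safe_net N"
  shows "finite (alphabet N)" "finite (places N)" "finite (initial N)" "finite (transitions N)"
    and "\<And>I u J. (I, u, J) \<in> transitions N \<Longrightarrow> finite I \<and> finite J"
proof -
  let ?S = "nonempty_finite_subsets (places N)"
  from assms have *: "finite (alphabet N)" "finite (places N)" "initial N \<in> ?S"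
      "transitions N \<subseteq> ?S \<times> insert None (Some ` alphabet N) \<times> ?S"
    by (auto simp: finite_safe_net_def petri_net_def)
  have "finite ?S"
    by (rule finite_subset[of _ "Pow (places N)"]) (use *(2) in \<open>auto simp: nonempty_finite_subsets_def\<close>)
  then show "finite (transitions N)"
    by (intro finite_subset[OF *(4)] finite_cartesian_product) (use *(1) in auto)
  show "finite (alphabet N)" "finite (places N)" by fact+
  show "finite (initial N)" using *(3) by (simp add: nonempty_finite_subsets_def)
  show "finite I \<and> finite J" if "(I, u, J) \<in> transitions N" for I u J
    using subsetD[OF *(4) that] by (simp add: nonempty_finite_subsets_def)
qed

lemma encode_action_inject: "inj c \<Longrightarrow> encode_action c u = encode_action c v \<longleftrightarrow> u = v"
  by (cases u; cases v) (auto simp: inj_eq)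

lemma set_encode_inject: "finite A \<Longrightarrow> finite B \<Longrightarrow> set_encode A = set_encode B \<longleftrightarrow> A = B"
  using set_encode_inverse by metis

lemma encode_net_inject:
  assumes c: "inj c" and N: "finite_safe_net N" and M: "finite_safe_net M"
    and eq: "encode_net c N = encode_net c M"
  shows "alphabet N = alphabet M \<and> places N = places M \<and>
    transitions N = transitions M \<and> initial N = initial M"
proof -
  note fin = finite_safe_netD[OF N] finite_safe_netD[OF M]
  have "c ` alphabet N = c ` alphabet M" "places N = places M" "initial N = initial M"
    and t: "encode_transition c ` transitions N = encode_transition c ` transitions M"
    using eq fin by (auto simp: encode_net_def prod_encode_eq set_encode_inject)
  moreover have "inj_on (encode_transition c) (transitions N \<union> transitions M)"
    using fin(5,10)
    by (auto intro!: inj_onI simp: prod_encode_eq encode_action_inject[OF c])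
       (metis set_encode_inverse)+
  ultimately show ?thesis
    using c by (auto simp: inj_image_eq_iff inj_on_image_eq_iff[where C = "transitions N \<union> transitions M"])
qed

lemma inj_on_encode_instance: "inj_on encode_instance testing_instances"
proof (rule inj_onI)
  fix x y
  assume x: "x \<in> testing_instances" and y: "y \<in> testing_instances"
    and eq: "encode_instance x = encode_instance y"
  obtain N T M S where xy: "x = (N, T)" "y = (M, S)" by fastforce
  have wf: "finite_safe_net N" "finite_safe_net M" "finite_safe_net T" "finite_safe_net S"
      "success T \<subseteq> places T" "success S \<subseteq> places S"
    using x y xy by (auto simp: testing_instances_def is_test_def)
  have "finite (success T)" "finite (success S)"
    using wf finite_safe_netD(2) finite_subset by metis+
  with eq xy have "success T = success S"
      "encode_net id N = encode_net id M" "encode_net sum_encode T = encode_net sum_encode S"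
    by (auto simp: prod_encode_eq set_encode_inject)
  with encode_net_inject[OF inj_on_id wf(1,2)] encode_net_inject[OF inj_sum_encode wf(3,4)]
  have "N = M" "T = S" by simp_all
  with xy show "x = y" by simp
qed

end

theory Submission
  imports Defs "HOL-Library.Countable"
begin

text \<open>
  Suppose some recursive function decides the problem. A recursive function is compiled to a register
  program, and each register is turned into a queue of ones with a marker, on which increments,
  decrements and zero tests are pushes and pops. Because the marker never disappears, a sequence
  of queue letters is a correct computation iff, for every register, the pops never disagree with the
  pushes at the same position. The net of the instance generates the letter sequences of the program. The
  test reads two of them and passes if they differ, or if for some register a pop of the second disagrees
  with a push of the first; so all pairs pass iff the program has no accepting computation.

  A run only counts as maximal if every place with a successor in the net moves on. Hence a place
  of the test whose only transition carries an action of the alphabet that the tested nets never perform is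
  final in every composition, but blocks every run of the test on its own. This leaves the test with exactly
  two maximal runs, which are useless, although it is nondeterministic when composed.

  Program transitions and test enter the code of an instance in such a way that the code is a recursive
  function of the two numbers encoding them. The program that feeds this code to the supposed decision
  procedure, run on its own two numbers, contradicts it.
\<close>

section \<open>Register programs for partial recursive functions\<close>

text \<open>A test has finite control, so it cannot remember the contents of a queue. The second
  copy of the run removes that need. Words that differ at some position pass anyway, so up to
  prefixes the same word stands on both tapes, and one copy can be read as the producer of a queue
  while the other is read as its consumer, each at its own speed. Only one pending symbol has to be
  remembered. Counters become queues because two heads can compare the order of symbols, while a
  counter would have to be stored.

  Infinite runs are the second obstacle: a program with a loop also generates infinite words, and
  these say nothing about acceptance. They have to pass in every pairing, so the test needs a branch
  that reads arbitrary letters forever, and a fair order of reading has to make the resulting run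
  maximal.\<close>

datatype 'o cmd = Skip | Op 'o | Seq "'o cmd" "'o cmd" | Alt "'o cmd" "'o cmd" | Star "'o cmd"

text \<open>Programs have no guards: an operation that is not applicable simply has no successor
  store. The words of a program can therefore be generated by a finite automaton that ignores the
  store, and wrong guesses are left for the test to refute.\<close>

fun exec :: "('o \<Rightarrow> 's \<Rightarrow> 's \<Rightarrow> bool) \<Rightarrow> 'o cmd \<Rightarrow> 's \<Rightarrow> 's \<Rightarrow> bool" where
  "exec st Skip s s' \<longleftrightarrow> s' = s"
| "exec st (Op x) s s' \<longleftrightarrow> st x s s'"
| "exec st (Seq c d) s s' \<longleftrightarrow> (\<exists>u. exec st c s u \<and> exec st d u s')"
| "exec st (Alt c d) s s' \<longleftrightarrow> exec st c s s' \<or> exec st d s s'"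
| "exec st (Star c) s s' \<longleftrightarrow> (exec st c)\<^sup>*\<^sup>* s s'"

section \<open>Counter operations and counting loops\<close>

datatype cop = CInc nat | CDec nat | CZer nat

fun cstep :: "cop \<Rightarrow> (nat \<Rightarrow> nat) \<Rightarrow> (nat \<Rightarrow> nat) \<Rightarrow> bool" where
  "cstep (CInc r) s s' \<longleftrightarrow> s' = s(r := Suc (s r))"
| "cstep (CDec r) s s' \<longleftrightarrow> 0 < s r \<and> s' = s(r := s r - 1)"
| "cstep (CZer r) s s' \<longleftrightarrow> s r = 0 \<and> s' = s"

abbreviation "cexec \<equiv> exec cstep"

lemma ex_image_iff: "(\<exists>u. (\<exists>y. P y \<and> u = f y) \<and> Q u) \<longleftrightarrow> (\<exists>y. P y \<and> Q (f y))"
  by blast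

text \<open>A \<open>Star\<close> may be left after any number of rounds, but the zero test that
  follows discards every exit except the last one. Since each round lowers \<open>a\<close> by one,
  exactly \<open>s a\<close> rounds remain possible, and the nondeterministic loop is a
  function.\<close>

lemma countdown_loop:
  assumes B: "\<And>s s'. B s s' \<longleftrightarrow> 0 < s a \<and> s' = F s" and F: "\<And>s. F s a = s a - (1 :: nat)"
  shows "B\<^sup>*\<^sup>* s s' \<and> s' a = 0 \<longleftrightarrow> s' = (F ^^ s a) s"
proof (induction "s a" arbitrary: s)
  case 0
  then have "B\<^sup>*\<^sup>* s s' \<longleftrightarrow> s' = s"
    by (auto elim: converse_rtranclpE simp: B)
  with 0 show ?case by auto
next
  case (Suc n)
  have "B\<^sup>*\<^sup>* s s' \<and> s' a = 0 \<longleftrightarrow> B\<^sup>*\<^sup>* (F s) s' \<and> s' a = 0"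
    using Suc(2) by (auto elim: converse_rtranclpE intro: converse_rtranclp_into_rtranclp simp: B)
  also have "\<dots> \<longleftrightarrow> s' = (F ^^ F s a) (F s)"
    using Suc F[of s] by (metis diff_Suc_1)
  also have "(F ^^ F s a) (F s) = (F ^^ s a) s"
    using Suc(2) F[of s] by (metis diff_Suc_1 funpow_Suc_right comp_apply)
  finally show ?case .
qed

definition clear :: "nat \<Rightarrow> cop cmd" where
  "clear a = Seq (Star (Op (CDec a))) (Op (CZer a))"

definition move :: "nat \<Rightarrow> nat \<Rightarrow> cop cmd" where
  "move a r = Seq (Star (Seq (Op (CDec a)) (Op (CInc r)))) (Op (CZer a))"

text \<open>A register can only be read by counting it down. The value is therefore counted into
  \<open>r\<close> and the scratch register \<open>t\<close> at once and then restored from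
  \<open>t\<close>.\<close>

definition copy :: "nat \<Rightarrow> nat \<Rightarrow> nat \<Rightarrow> cop cmd" where
  "copy a r t =
     Seq (Seq (Star (Seq (Op (CDec a)) (Seq (Op (CInc r)) (Op (CInc t))))) (Op (CZer a))) (move t a)"

lemma exec_clear: "cexec (clear a) s s' \<longleftrightarrow> s' = s(a := 0)"
proof -
  have "((\<lambda>s. s(a := s a - 1)) ^^ n) s = s(a := s a - n)" for n s
    by (induction n) auto
  with countdown_loop[of "cexec (Op (CDec a))" a "\<lambda>s. s(a := s a - 1)" s s']
  show ?thesis by (auto simp: clear_def)
qed

lemma exec_move:
  assumes "a \<noteq> r"
  shows "cexec (move a r) s s' \<longleftrightarrow> s' = s(r := s r + s a, a := 0)"
proof -
  let ?F = "\<lambda>s. s(a := s a - 1, r := Suc (s r))"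
  have "(?F ^^ n) s = s(r := s r + n, a := s a - n)" for n s
    using assms by (induction n) auto
  with countdown_loop[of "cexec (Seq (Op (CDec a)) (Op (CInc r)))" a ?F s s'] assms
  show ?thesis by (auto simp: move_def)
qed

lemma exec_copy:
  assumes "a \<noteq> r" "a \<noteq> t" "r \<noteq> t" "s t = 0"
  shows "cexec (copy a r t) s s' \<longleftrightarrow> s' = s(r := s r + s a)"
proof -
  let ?F = "\<lambda>s. s(a := s a - 1, r := Suc (s r), t := Suc (s t))"
  have F: "(?F ^^ n) s = s(r := s r + n, t := s t + n, a := s a - n)" for n s
    using assms by (induction n) auto
  have B: "cexec (Seq (Op (CDec a)) (Seq (Op (CInc r)) (Op (CInc t)))) s s' \<longleftrightarrow> 0 < s a \<and> s' = ?F s"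
    for s s' using assms by auto
  have "cexec (Seq (Star (Seq (Op (CDec a)) (Seq (Op (CInc r)) (Op (CInc t))))) (Op (CZer a))) s u
      \<longleftrightarrow> u = s(r := s r + s a, t := s a, a := 0)" for u
  proof -
    have "(cexec (Seq (Op (CDec a)) (Seq (Op (CInc r)) (Op (CInc t)))))\<^sup>*\<^sup>* s u \<and> u a = 0 \<longleftrightarrow>
        u = (?F ^^ s a) s"
      by (rule countdown_loop[OF B]) (use assms in auto)
    then show ?thesis unfolding F using assms by auto
  qed
  then have "cexec (copy a r t) s s' \<longleftrightarrow> cexec (move t a) (s(r := s r + s a, t := s a, a := 0)) s'"
    unfolding copy_def exec.simps(3)[where d = "move t a"] by simp
  also have "\<dots> \<longleftrightarrow> s' = s(r := s r + s a)"
  proof -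
    have "(s(r := s r + s a, t := s a, a := 0))(a := 0 + s a, t := 0) = s(r := s r + s a)"
      using assms by (auto simp: fun_eq_iff)
    then show ?thesis using assms by (simp add: exec_move)
  qed
  finally show ?thesis .
qed

text \<open>Stands for calls with a wrong number of arguments. There \<open>computes\<close> yields
  no value, so a program without executions keeps the equivalence in \<open>correct\<close>
  exact.\<close>

definition fail :: "cop cmd" where
  "fail = Seq (Op (CInc 0)) (Op (CZer 0))"

lemma exec_fail [simp]: "\<not> cexec fail s s'"
  by (simp add: fail_def)

section \<open>Compilation of partial recursive functions\<close>

definition seqs :: "'o cmd list \<Rightarrow> 'o cmd" where
  "seqs cs = foldr Seq cs Skip"

lemma exec_clears:
  "cexec (seqs (map clear rs)) s s' \<longleftrightarrow> s' = (\<lambda>i. if i \<in> set rs then 0 else s i)"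
proof (induction rs arbitrary: s)
  case Nil
  show ?case by (simp add: seqs_def)
next
  case (Cons r rs)
  have eq: "(\<lambda>i. if i \<in> set rs then 0 else (s(r := 0)) i) = (\<lambda>i. if i \<in> set (r # rs) then 0 else s i)"
    by auto
  have "cexec (seqs (map clear (r # rs))) s s' \<longleftrightarrow> cexec (seqs (map clear rs)) (s(r := 0)) s'"
    by (simp add: seqs_def exec_clear)
  then show ?case unfolding Cons.IH eq .
qed

text \<open>
  \<open>compile f args r b\<close> adds the value of \<open>f\<close> at the contents of the registers \<open>args\<close> to register
  \<open>r\<close>; the registers from \<open>b\<close> onwards are scratch space, zero before and after.
\<close>

primrec compile :: "recf \<Rightarrow> nat list \<Rightarrow> nat \<Rightarrow> nat \<Rightarrow> cop cmd" where
  "compile Zero = (\<lambda>args r b. Skip)"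
| "compile Succ = (\<lambda>args r b. case args of [a] \<Rightarrow> Seq (copy a r b) (Op (CInc r)) | _ \<Rightarrow> fail)"
| "compile (Proj i) = (\<lambda>args r b. if i < length args then copy (args ! i) r b else fail)"
| "compile (Comp f gs) = (\<lambda>args r b.
     let n = length gs in
     Seq (seqs (map2 (\<lambda>c j. c args j (b + n)) (map compile gs) [b..<b + n]))
       (Seq (compile f [b..<b + n] r (b + n)) (seqs (map clear [b..<b + n]))))"
| "compile (PrimRec f g) = (\<lambda>args r b. case args of [] \<Rightarrow> fail | a # as \<Rightarrow>
     Seq (copy a (b + 2) (b + 3))
       (Seq (compile f as (b + 1) (b + 4))
         (Seq (Star (Seq (Op (CDec (b + 2)))
                 (Seq (compile g (b # (b + 1) # as) (b + 3) (b + 4))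
                   (Seq (clear (b + 1)) (Seq (move (b + 3) (b + 1)) (Op (CInc b)))))))
           (Seq (Op (CZer (b + 2))) (Seq (move (b + 1) r) (clear b))))))"
| "compile (Mu f) = (\<lambda>args r b.
     Seq (Star (Seq (compile f (b # args) (b + 1) (b + 2))
                 (Seq (Op (CDec (b + 1))) (Seq (clear (b + 1)) (Op (CInc b))))))
       (Seq (compile f (b # args) (b + 1) (b + 2)) (Seq (Op (CZer (b + 1))) (move b r))))"

lemma computes_iff:
  "computes Zero xs y \<longleftrightarrow> y = 0"
  "computes Succ xs y \<longleftrightarrow> (\<exists>x. xs = [x] \<and> y = Suc x)"
  "computes (Proj i) xs y \<longleftrightarrow> i < length xs \<and> y = xs ! i"
  "computes (Comp f gs) xs y \<longleftrightarrow> (\<exists>ys. list_all2 (\<lambda>g. computes g xs) gs ys \<and> computes f ys y)"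
  "computes (PrimRec f g) [] y \<longleftrightarrow> False"
  "computes (PrimRec f g) (0 # xs) y \<longleftrightarrow> computes f xs y"
  "computes (PrimRec f g) (Suc n # xs) y \<longleftrightarrow>
     (\<exists>z. computes (PrimRec f g) (n # xs) z \<and> computes g (n # z # xs) y)"
  "computes (Mu f) xs y \<longleftrightarrow> computes f (y # xs) 0 \<and> (\<forall>m<y. \<exists>k. computes f (m # xs) (Suc k))"
  by (auto elim: computes.cases intro: computes.intros)

text \<open>An equivalence is required because programs are nondeterministic: no execution may end
  in a wrong store, and where the function is undefined there must be no execution at all.\<close>

definition correct :: "recf \<Rightarrow> (nat list \<Rightarrow> nat \<Rightarrow> nat \<Rightarrow> cop cmd) \<Rightarrow> bool" where
  "correct f P \<longleftrightarrow> (\<forall>args r b s s'. set args \<subseteq> {..<b} \<longrightarrow> r < b \<longrightarrow> r \<notin> set args \<longrightarrow> s r = 0 \<longrightarrow>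
     (\<forall>i\<ge>b. s i = 0) \<longrightarrow>
     (cexec (P args r b) s s' \<longleftrightarrow> (\<exists>y. computes f (map s args) y \<and> s' = s(r := y))))"

lemma correctD:
  assumes "correct f P" "set args \<subseteq> {..<b}" "r < b" "r \<notin> set args" "s r = 0" "\<forall>i\<ge>b. s i = 0"
  shows "cexec (P args r b) s s' \<longleftrightarrow> (\<exists>y. computes f (map s args) y \<and> s' = s(r := y))"
  using assms unfolding correct_def by blast

definition store_list :: "(nat \<Rightarrow> nat) \<Rightarrow> nat \<Rightarrow> nat list \<Rightarrow> nat \<Rightarrow> nat" where
  "store_list s m ys i = (if m \<le> i \<and> i < m + length ys then ys ! (i - m) else s i)"

lemma store_list_simps [simp]:
  "store_list s m [] = s"
  "store_list s m (y # ys) = store_list (s(m := y)) (Suc m) ys"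
  by (auto simp: store_list_def fun_eq_iff nth_Cons' Suc_diff_le)

text \<open>All arguments lie below \<open>m\<close> and all results from \<open>m\<close> on, so a
  value already stored does not disturb the functions evaluated later. The scratch space from
  \<open>B\<close> on is shared, as every call leaves it zero.\<close>

lemma exec_compile_list:
  assumes "\<forall>g\<in>set gs. correct g (compile g)"
    and "set args \<subseteq> {..<m}" "m + length gs \<le> B" "\<forall>i\<ge>m. s i = 0"
  shows "cexec (seqs (map2 (\<lambda>c j. c args j B) (map compile gs) [m..<m + length gs])) s s' \<longleftrightarrow>
    (\<exists>ys. list_all2 (\<lambda>g. computes g (map s args)) gs ys \<and> s' = store_list s m ys)"
  using assms
proof (induction gs arbitrary: m s)
  case Nil
  then show ?case by (auto simp: seqs_def)
next
  case (Cons g gs)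
  have up: "[m..<m + length (g # gs)] = m # [Suc m..<Suc m + length gs]"
    by (simp add: upt_conv_Cons del: upt_Suc)
  have g: "cexec (compile g args m B) s u \<longleftrightarrow> (\<exists>y. computes g (map s args) y \<and> u = s(m := y))" for u
    by (rule correctD) (use Cons.prems in \<open>auto\<close>)
  have args: "map (s(m := y)) args = map s args" for y
    using Cons.prems(2) by auto
  have IH: "cexec (seqs (map2 (\<lambda>c j. c args j B) (map compile gs) [Suc m..<Suc m + length gs])) (s(m := y)) s'
     \<longleftrightarrow> (\<exists>ys. list_all2 (\<lambda>g. computes g (map s args)) gs ys \<and> s' = store_list (s(m := y)) (Suc m) ys)" for y
    using Cons.IH[of "Suc m" "s(m := y)"] Cons.prems unfolding args by fastforce
  have "cexec (seqs (map2 (\<lambda>c j. c args j B) (map compile (g # gs)) [m..<m + length (g # gs)])) s s'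
    \<longleftrightarrow> (\<exists>u. cexec (compile g args m B) s u \<and>
         cexec (seqs (map2 (\<lambda>c j. c args j B) (map compile gs) [Suc m..<Suc m + length gs])) u s')"
    unfolding up seqs_def by simp
  also have "\<dots> \<longleftrightarrow> (\<exists>y. computes g (map s args) y \<and>
      (\<exists>ys. list_all2 (\<lambda>g. computes g (map s args)) gs ys \<and> s' = store_list (s(m := y)) (Suc m) ys))"
    unfolding g using IH by blast
  also have "\<dots> \<longleftrightarrow> (\<exists>ys. list_all2 (\<lambda>g. computes g (map s args)) (g # gs) ys \<and> s' = store_list s m ys)"
    unfolding list_all2_Cons1 by (metis store_list_simps(2))
  finally show ?case .
qed

lemma correct_Comp:
  assumes f: "correct f (compile f)" and gs: "\<forall>g\<in>set gs. correct g (compile g)"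
  shows "correct (Comp f gs) (compile (Comp f gs))"
  unfolding correct_def
proof (intro allI impI)
  fix args r b and s s' :: "nat \<Rightarrow> nat"
  assume *: "set args \<subseteq> {..<b}" "r < b" "r \<notin> set args" "s r = 0" "\<forall>i\<ge>b. s i = 0"
  let ?n = "length gs"
  let ?rs = "[b..<b + ?n]"
  have 1: "cexec (seqs (map2 (\<lambda>c j. c args j (b + ?n)) (map compile gs) ?rs)) s u \<longleftrightarrow>
      (\<exists>ys. list_all2 (\<lambda>g. computes g (map s args)) gs ys \<and> u = store_list s b ys)" for u
    by (rule exec_compile_list) (use gs * in auto)
  have 2: "cexec (compile f ?rs r (b + ?n)) (store_list s b ys) u \<longleftrightarrow>
      (\<exists>y. computes f ys y \<and> u = (store_list s b ys)(r := y))" if "length ys = ?n" for ys u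
  proof -
    have "map (store_list s b ys) ?rs = ys"
      using that by (intro nth_equalityI) (auto simp: store_list_def)
    moreover have "cexec (compile f ?rs r (b + ?n)) (store_list s b ys) u \<longleftrightarrow>
        (\<exists>y. computes f (map (store_list s b ys) ?rs) y \<and> u = (store_list s b ys)(r := y))"
      by (rule correctD[OF f]) (use * that in \<open>auto simp: store_list_def\<close>)
    ultimately show ?thesis by simp
  qed
  have 3: "(\<lambda>i. if i \<in> set ?rs then 0 else ((store_list s b ys)(r := y)) i) = s(r := y)"
    if "length ys = ?n" for ys y
    using * that by (auto simp: store_list_def fun_eq_iff)
  have "cexec (compile (Comp f gs) args r b) s s' \<longleftrightarrow>
      (\<exists>ys. list_all2 (\<lambda>g. computes g (map s args)) gs ys \<and>
        cexec (Seq (compile f ?rs r (b + ?n)) (seqs (map clear ?rs))) (store_list s b ys) s')"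
    using 1 by (auto simp: Let_def)
  also have "\<dots> \<longleftrightarrow> (\<exists>ys. list_all2 (\<lambda>g. computes g (map s args)) gs ys \<and>
      (\<exists>y. computes f ys y \<and> s' = s(r := y)))"
  proof -
    have "cexec (Seq (compile f ?rs r (b + ?n)) (seqs (map clear ?rs))) (store_list s b ys) s' \<longleftrightarrow>
       (\<exists>y. computes f ys y \<and> s' = s(r := y))" if "length ys = ?n" for ys
      unfolding exec.simps(3) 2[OF that] exec_clears using 3[OF that] by auto
    then show ?thesis by (metis list_all2_lengthD)
  qed
  finally show "cexec (compile (Comp f gs) args r b) s s' \<longleftrightarrow>
      (\<exists>y. computes (Comp f gs) (map s args) y \<and> s' = s(r := y))"
    by (auto simp: computes_iff)
qed

lemma correct_PrimRec:
  assumes f: "correct f (compile f)" and g: "correct g (compile g)"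
  shows "correct (PrimRec f g) (compile (PrimRec f g))"
  unfolding correct_def
proof (intro allI impI)
  fix args r b and s s' :: "nat \<Rightarrow> nat"
  assume *: "set args \<subseteq> {..<b}" "r < b" "r \<notin> set args" "s r = 0" "\<forall>i\<ge>b. s i = 0"
  show "cexec (compile (PrimRec f g) args r b) s s' \<longleftrightarrow>
      (\<exists>y. computes (PrimRec f g) (map s args) y \<and> s' = s(r := y))"
  proof (cases args)
    case Nil
    then show ?thesis by (simp add: computes_iff)
  next
    case (Cons a as)
    define xs where "xs = map s as"
    \<comment> \<open>All stores between rounds have this form: \<open>b\<close> holds the recursion
      index, \<open>b + 1\<close> the value reached so far and \<open>b + 2\<close> the number of
      rounds left. Index and rounds left always add up to the recursion argument.\<close>
    define S where "S i acc n = s(b := i, Suc b := acc, Suc (Suc b) := n)" for i acc n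
    let ?body = "Seq (Op (CDec (b + 2)))
                 (Seq (compile g (b # (b + 1) # as) (b + 3) (b + 4))
                   (Seq (clear (b + 1)) (Seq (move (b + 3) (b + 1)) (Op (CInc b)))))"
    have as: "set as \<subseteq> {..<b}" "r \<notin> set as" "a < b" "a \<noteq> r" using * Cons by auto
    have xsS: "map (S i acc n) as = xs" for i acc n
      using as by (auto simp: S_def xs_def)
    have C: "cexec (copy a (b + 2) (b + 3)) s u \<longleftrightarrow> u = S 0 0 (s a)" for u
      by (subst exec_copy) (use as * in \<open>auto simp: S_def fun_eq_iff\<close>)
    have Cf: "cexec (compile f as (b + 1) (b + 4)) (S 0 0 n) u \<longleftrightarrow>
        (\<exists>y. computes f xs y \<and> u = S 0 y n)" for u n
    proof (subst correctD[OF f])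
      have "(S 0 0 n)(b + 1 := y) = S 0 y n" for y
        by (auto simp: S_def fun_eq_iff)
      then show "(\<exists>y. computes f (map (S 0 0 n) as) y \<and> u = (S 0 0 n)(b + 1 := y)) \<longleftrightarrow>
        (\<exists>y. computes f xs y \<and> u = S 0 y n)" by (simp add: xsS)
    qed (use as * in \<open>auto simp: S_def\<close>)
    have Cg: "cexec (compile g (b # (b + 1) # as) (b + 3) (b + 4)) (S i acc n) u \<longleftrightarrow>
        (\<exists>y. computes g (i # acc # xs) y \<and> u = (S i acc n)(b + 3 := y))" for u i acc n
    proof (subst correctD[OF g])
      have "map (S i acc n) (b # (b + 1) # as) = i # acc # xs"
        using xsS by (simp add: S_def)
      then show "(\<exists>y. computes g (map (S i acc n) (b # (b + 1) # as)) y \<and> u = (S i acc n)(b + 3 := y)) \<longleftrightarrow>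
        (\<exists>y. computes g (i # acc # xs) y \<and> u = (S i acc n)(b + 3 := y))" by simp
    qed (use as * in \<open>auto simp: S_def\<close>)
    have upd: "(S i acc n)(b + 2 := m) = S i acc m" for i acc n m
      by (simp add: S_def)
    have Sn: "S i acc n (b + 2) = n" for i acc n by (simp add: S_def)
    have tail: "cexec (Seq (clear (b + 1)) (Seq (move (b + 3) (b + 1)) (Op (CInc b))))
        ((S i acc n)(b + 3 := z)) u \<longleftrightarrow> u = S (Suc i) z n" for i acc n z u
    proof -
      have "(S i acc n)(b + 3 := z, b + 1 := 0, b + 1 := z, b + 3 := 0, b := Suc i) = S (Suc i) z n"
        using *(5) by (auto simp: S_def fun_eq_iff)
      moreover have "((S i acc n)(b + 3 := z, b + 1 := 0, b + 1 := z, b + 3 := 0)) b = i"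
        by (simp add: S_def)
      ultimately show ?thesis by (simp add: exec_clear exec_move)
    qed
    have body: "cexec ?body (S i acc n) u \<longleftrightarrow>
        (\<exists>z. 0 < n \<and> computes g (i # acc # xs) z \<and> u = S (Suc i) z (n - 1))" for i acc n u
    proof -
      have "cexec ?body (S i acc n) u \<longleftrightarrow> 0 < n \<and>
          (\<exists>v. cexec (compile g (b # (b + 1) # as) (b + 3) (b + 4)) (S i acc (n - 1)) v \<and>
            cexec (Seq (clear (b + 1)) (Seq (move (b + 3) (b + 1)) (Op (CInc b)))) v u)"
        unfolding exec.simps(3)[where c = "Op (CDec (b + 2))"] exec.simps(2) cstep.simps Sn upd
          exec.simps(3)[where c = "compile g (b # (b + 1) # as) (b + 3) (b + 4)"] by blast
      also have "\<dots> \<longleftrightarrow> (\<exists>z. 0 < n \<and> computes g (i # acc # xs) z \<and>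
          cexec (Seq (clear (b + 1)) (Seq (move (b + 3) (b + 1)) (Op (CInc b)))) ((S i acc (n - 1))(b + 3 := z)) u)"
        unfolding Cg by blast
      also have "\<dots> \<longleftrightarrow> (\<exists>z. 0 < n \<and> computes g (i # acc # xs) z \<and> u = S (Suc i) z (n - 1))"
        unfolding tail ..
      finally show ?thesis .
    qed
    have fwd: "\<exists>i acc. u = S i acc (n - i) \<and> i \<le> n \<and> computes (PrimRec f g) (i # xs) acc"
      if "(cexec ?body)\<^sup>*\<^sup>* (S 0 y n) u" "computes f xs y" for n u y
      using that(1)
    proof (induction rule: rtranclp_induct)
      case base
      then show ?case using that(2) by (intro exI[of _ 0] exI[of _ y]) (simp add: computes_iff)
    next
      case (step u v)
      then obtain i acc where i: "u = S i acc (n - i)" "i \<le> n" "computes (PrimRec f g) (i # xs) acc" by blast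
      from step(2)[unfolded i(1) body] obtain z where
        "0 < n - i" "computes g (i # acc # xs) z" "v = S (Suc i) z (n - i - 1)" by blast
      with i show ?case
        by (intro exI[of _ "Suc i"] exI[of _ z]) (auto simp: computes_iff)
    qed
    have bwd: "\<exists>y. computes f xs y \<and> (cexec ?body)\<^sup>*\<^sup>* (S 0 y n) (S i acc (n - i))"
      if "computes (PrimRec f g) (i # xs) acc" "i \<le> n" for i acc n
      using that
    proof (induction i arbitrary: acc)
      case 0
      then show ?case by (auto simp: computes_iff)
    next
      case (Suc i)
      then obtain z where z: "computes (PrimRec f g) (i # xs) z" "computes g (i # z # xs) acc"
        by (auto simp: computes_iff)
      from Suc.IH[OF z(1) Suc_leD[OF Suc.prems(2)]] obtain y where
        y: "computes f xs y" "(cexec ?body)\<^sup>*\<^sup>* (S 0 y n) (S i z (n - i))" by blast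
      moreover have "cexec ?body (S i z (n - i)) (S (Suc i) acc (n - Suc i))"
        unfolding body using z Suc by auto
      ultimately show ?case by (meson rtranclp.rtrancl_into_rtrancl)
    qed
    have last: "cexec (Seq (Op (CZer (b + 2))) (Seq (move (b + 1) r) (clear b))) (S i acc n) s' \<longleftrightarrow>
        n = 0 \<and> s' = s(r := acc)" for i acc n
    proof -
      have "(S i acc 0)(r := S i acc 0 r + S i acc 0 (b + 1), b + 1 := 0, b := 0) = s(r := acc)"
        using * by (auto simp: S_def fun_eq_iff)
      then show ?thesis
        using *(2) by (auto simp: exec_clear exec_move S_def simp del: One_nat_def)
    qed
    define B where "B = ?body"
    define D where "D = Seq (Op (CZer (b + 2))) (Seq (move (b + 1) r) (clear b))"
    note fwd = fwd[folded B_def] and bwd = bwd[folded B_def] and last = last[folded D_def]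
    have "compile (PrimRec f g) args r b =
        Seq (copy a (b + 2) (b + 3)) (Seq (compile f as (b + 1) (b + 4)) (Seq (Star B) D))"
      by (simp add: Cons B_def D_def)
    then have "cexec (compile (PrimRec f g) args r b) s s' \<longleftrightarrow>
         (\<exists>y u. computes f xs y \<and> (cexec B)\<^sup>*\<^sup>* (S 0 y (s a)) u \<and> cexec D u s')"
      by (simp only: exec.simps(3,5) C simp_thms Cf) blast
    also have "\<dots> \<longleftrightarrow> (\<exists>y. computes (PrimRec f g) (s a # xs) y \<and> s' = s(r := y))"
    proof
      assume "\<exists>y u. computes f xs y \<and> (cexec B)\<^sup>*\<^sup>* (S 0 y (s a)) u \<and> cexec D u s'"
      then obtain y u where y: "computes f xs y" "(cexec B)\<^sup>*\<^sup>* (S 0 y (s a)) u" "cexec D u s'" by blast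
      from fwd[OF y(2,1)] obtain i acc where i: "u = S i acc (s a - i)" "i \<le> s a"
        "computes (PrimRec f g) (i # xs) acc" by blast
      from y(3)[unfolded i(1) last] have "s a - i = 0" "s' = s(r := acc)" by blast+
      with i(2,3) show "\<exists>y. computes (PrimRec f g) (s a # xs) y \<and> s' = s(r := y)" by auto
    next
      assume "\<exists>y. computes (PrimRec f g) (s a # xs) y \<and> s' = s(r := y)"
      then obtain acc where acc: "computes (PrimRec f g) (s a # xs) acc" "s' = s(r := acc)" by blast
      from bwd[OF acc(1) order_refl] obtain y where
        "computes f xs y" "(cexec B)\<^sup>*\<^sup>* (S 0 y (s a)) (S (s a) acc 0)"
        unfolding diff_self_eq_0 by blast
      moreover have "cexec D (S (s a) acc 0) s'"
        unfolding last using acc by simp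
      ultimately show "\<exists>y u. computes f xs y \<and> (cexec B)\<^sup>*\<^sup>* (S 0 y (s a)) u \<and> cexec D u s'" by blast
    qed
    finally show ?thesis by (simp add: Cons xs_def)
  qed
qed

text \<open>A round is completed only if the value at the current index is positive, because of the
  decrement, and the exit is possible only if it is zero. A wrong guess of the number of rounds
  blocks, so an execution finds the least zero or does not exist.\<close>

lemma correct_Mu:
  assumes f: "correct f (compile f)"
  shows "correct (Mu f) (compile (Mu f))"
  unfolding correct_def
proof (intro allI impI)
  fix args r b and s s' :: "nat \<Rightarrow> nat"
  assume *: "set args \<subseteq> {..<b}" "r < b" "r \<notin> set args" "s r = 0" "\<forall>i\<ge>b. s i = 0"
  define xs where "xs = map s args"
  define S where "S n = s(b := n)" for n
  let ?body = "Seq (compile f (b # args) (b + 1) (b + 2))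
                 (Seq (Op (CDec (b + 1))) (Seq (clear (b + 1)) (Op (CInc b))))"
  have Cf: "cexec (compile f (b # args) (b + 1) (b + 2)) (S n) u \<longleftrightarrow>
      (\<exists>y. computes f (n # xs) y \<and> u = (S n)(b + 1 := y))" for u n
  proof (subst correctD[OF f])
    have "map (S n) (b # args) = n # xs"
      using *(1) by (auto simp: S_def xs_def)
    then show "(\<exists>y. computes f (map (S n) (b # args)) y \<and> u = (S n)(b + 1 := y)) \<longleftrightarrow>
      (\<exists>y. computes f (n # xs) y \<and> u = (S n)(b + 1 := y))" by simp
  qed (use * in \<open>auto simp: S_def\<close>)
  have upd: "s(b := Suc n, Suc b := 0) = S (Suc n)" "s(b := n, Suc b := 0) = S n" for n
    using * by (auto simp: S_def fun_eq_iff)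
  have body: "cexec ?body (S n) u \<longleftrightarrow> (\<exists>k. computes f (n # xs) (Suc k)) \<and> u = S (Suc n)" for n u
  proof -
    have "cexec ?body (S n) u \<longleftrightarrow> (\<exists>y. computes f (n # xs) y \<and> 0 < y \<and> u = S (Suc n))"
      unfolding exec.simps(3)[where c = "compile f (b # args) (b + 1) (b + 2)"] Cf
      using upd(1)[of n]
      by (auto simp: exec_clear S_def fun_upd_twist)
    then show ?thesis by (metis gr0_conv_Suc)
  qed
  have star: "(cexec ?body)\<^sup>*\<^sup>* (S 0) u \<longleftrightarrow> (\<exists>n. u = S n \<and> (\<forall>m<n. \<exists>k. computes f (m # xs) (Suc k)))" for u
  proof
    assume "(cexec ?body)\<^sup>*\<^sup>* (S 0) u"
    then show "\<exists>n. u = S n \<and> (\<forall>m<n. \<exists>k. computes f (m # xs) (Suc k))"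
    proof (induction rule: rtranclp_induct)
      case (step u v)
      then obtain n where n: "u = S n" "\<forall>m<n. \<exists>k. computes f (m # xs) (Suc k)" by blast
      from step(2)[unfolded n(1) body] n(2) show ?case
        by (intro exI[of _ "Suc n"]) (auto simp: less_Suc_eq)
    qed auto
  next
    assume "\<exists>n. u = S n \<and> (\<forall>m<n. \<exists>k. computes f (m # xs) (Suc k))"
    then obtain n where n: "u = S n" "\<forall>m<n. \<exists>k. computes f (m # xs) (Suc k)" by blast
    then show "(cexec ?body)\<^sup>*\<^sup>* (S 0) u"
    proof (induction n arbitrary: u)
      case (Suc n)
      have "(cexec ?body)\<^sup>*\<^sup>* (S 0) (S n)"
        by (rule Suc.IH) (use Suc.prems in auto)
      moreover have "cexec ?body (S n) u"
        unfolding body using Suc.prems by blast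
      ultimately show ?case by (meson rtranclp.rtrancl_into_rtrancl)
    qed auto
  qed
  have last: "cexec (Seq (compile f (b # args) (b + 1) (b + 2)) (Seq (Op (CZer (b + 1))) (move b r))) (S n) s'
     \<longleftrightarrow> computes f (n # xs) 0 \<and> s' = s(r := n)" for n
  proof -
    have eq: "(S n)(r := S n r + S n b, b := 0) = s(r := n)" "(S n)(b + 1 := 0) = S n"
      using * by (auto simp: S_def fun_eq_iff)
    have "cexec (Seq (Op (CZer (b + 1))) (move b r)) ((S n)(b + 1 := y)) s' \<longleftrightarrow> y = 0 \<and> s' = s(r := n)" for y
    proof (cases "y = 0")
      case True
      then show ?thesis
        unfolding True eq(2) exec.simps cstep.simps using *(2) eq
        by (simp add: exec_move) (simp add: S_def *)
    qed simp
    then show ?thesis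
      unfolding exec.simps(3)[where c = "compile f (b # args) (b + 1) (b + 2)"] Cf ex_image_iff by auto
  qed
  have S0: "s = S 0" using * by (auto simp: S_def fun_eq_iff)
  define B where "B = ?body"
  define D where "D = Seq (compile f (b # args) (b + 1) (b + 2)) (Seq (Op (CZer (b + 1))) (move b r))"
  note star = star[folded B_def] and last = last[folded D_def]
  have "compile (Mu f) args r b = Seq (Star B) D"
    by (simp add: B_def D_def)
  then have "cexec (compile (Mu f) args r b) (S 0) s' \<longleftrightarrow> (\<exists>u. (cexec B)\<^sup>*\<^sup>* (S 0) u \<and> cexec D u s')"
    by simp
  also have "\<dots> \<longleftrightarrow> (\<exists>n. (\<forall>m<n. \<exists>k. computes f (m # xs) (Suc k)) \<and> cexec D (S n) s')"
    unfolding star by blast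
  also have "\<dots> \<longleftrightarrow> (\<exists>n. (\<forall>m<n. \<exists>k. computes f (m # xs) (Suc k)) \<and> computes f (n # xs) 0 \<and> s' = s(r := n))"
    unfolding last ..
  also have "\<dots> \<longleftrightarrow> (\<exists>y. computes (Mu f) (map s args) y \<and> s' = s(r := y))"
    unfolding computes_iff xs_def by blast
  finally show "cexec (compile (Mu f) args r b) s s' \<longleftrightarrow>
      (\<exists>y. computes (Mu f) (map s args) y \<and> s' = s(r := y))"
    by (simp only: S0[symmetric])
qed

theorem correct_compile: "correct f (compile f)"
proof (induction f)
  case Zero
  show ?case by (auto simp: correct_def computes_iff)
next
  case Succ
  have "cexec (compile Succ args r b) s s' \<longleftrightarrow> (\<exists>y. computes Succ (map s args) y \<and> s' = s(r := y))"
    if *: "set args \<subseteq> {..<b}" "r < b" "r \<notin> set args" "s r = 0" "\<forall>i\<ge>b. s i = 0" for args r b s s'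
  proof (cases "\<exists>a. args = [a]")
    case True
    with * show ?thesis by (auto simp: exec_copy computes_iff)
  next
    case False
    then show ?thesis by (auto simp: computes_iff split: list.split)
  qed
  then show ?case by (simp add: correct_def)
next
  case (Proj i)
  have "cexec (compile (Proj i) args r b) s s' \<longleftrightarrow> (\<exists>y. computes (Proj i) (map s args) y \<and> s' = s(r := y))"
    if *: "set args \<subseteq> {..<b}" "r < b" "r \<notin> set args" "s r = 0" "\<forall>i\<ge>b. s i = 0" for args r b s s'
  proof (cases "i < length args")
    case True
    then have "args ! i < b" "args ! i \<noteq> r" using * by auto (meson lessThan_iff nth_mem subsetD)
    with True * show ?thesis by (auto simp: exec_copy computes_iff)
  qed (simp add: computes_iff)
  then show ?case by (simp add: correct_def)
qed (blast intro: correct_Comp correct_PrimRec correct_Mu)+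

text \<open>The final decrement and zero test let only the result 1 through, which is the answer yes
  of a decision procedure.\<close>

definition acceptor :: "recf \<Rightarrow> cop cmd" where
  "acceptor f = Seq (compile f [0, 1] 2 3) (Seq (Op (CDec 2)) (Op (CZer 2)))"

lemma exec_acceptor:
  "(\<exists>s'. cexec (acceptor f) ((\<lambda>_. 0)(0 := x, 1 := y)) s') \<longleftrightarrow> computes f [x, y] 1"
proof -
  define s :: "nat \<Rightarrow> nat" where "s = (\<lambda>_. 0)(0 := x, 1 := y)"
  have s: "s 2 = 0" "\<forall>i\<ge>3. s i = 0" "map s [0, 1] = [x, y]"
    by (simp_all add: s_def)
  have "cexec (compile f [0, 1] 2 3) s u \<longleftrightarrow> (\<exists>z. computes f [x, y] z \<and> u = s(2 := z))" for u
    unfolding s(3)[symmetric] by (rule correctD[OF correct_compile]) (use s in auto)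
  then have acc: "cexec (acceptor f) s s' \<longleftrightarrow>
      (\<exists>z. computes f [x, y] z \<and> cexec (Seq (Op (CDec 2)) (Op (CZer 2))) (s(2 := z)) s')" for s'
    unfolding acceptor_def exec.simps(3)[where c = "compile f [0, 1] 2 3"] by (simp only: ex_image_iff)
  have one: "(\<exists>s'. cexec (Seq (Op (CDec 2)) (Op (CZer 2))) (s(2 := z)) s') \<longleftrightarrow> z = 1" for z
    by auto
  have "(\<exists>s'. cexec (acceptor f) s s') \<longleftrightarrow>
      (\<exists>z. computes f [x, y] z \<and> (\<exists>s'. cexec (Seq (Op (CDec 2)) (Op (CZer 2))) (s(2 := z)) s'))"
    unfolding acc by blast
  then show ?thesis unfolding one by (simp add: s_def)
qed

section \<open>Queue programs and their automata\<close>

text \<open>\<open>Eps\<close> labels pure control moves, so that every edge of an automaton carries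
  a letter and no net of a program needs internal actions. \<open>Dead\<close> occurs in no
  translated program; it becomes the action on which the test blocks.\<close>

datatype letter = Eps | Inc nat | Dec nat | Rot nat | Dead

instance letter :: countable by countable_datatype

fun qstep :: "letter \<Rightarrow> (nat \<Rightarrow> bool list) \<Rightarrow> (nat \<Rightarrow> bool list) \<Rightarrow> bool" where
  "qstep Eps Q Q' \<longleftrightarrow> Q' = Q"
| "qstep (Inc r) Q Q' \<longleftrightarrow> Q' = Q(r := Q r @ [True])"
| "qstep (Dec r) Q Q' \<longleftrightarrow> (\<exists>q. Q r = True # q \<and> Q' = Q(r := q))"
| "qstep (Rot r) Q Q' \<longleftrightarrow> (\<exists>q. Q r = False # q \<and> Q' = Q(r := q @ [False]))"
| "qstep Dead Q Q' \<longleftrightarrow> False"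

abbreviation "qexec \<equiv> exec qstep"

text \<open>A decrement pops a one; if the marker stands in front, it is rotated to the back first.
  Two rotations in a row are possible only if nothing but the marker is in the queue: after the
  first one the marker is last, and it is in front again only if there are no ones.\<close>

fun to_queue :: "cop cmd \<Rightarrow> letter cmd" where
  "to_queue Skip = Skip"
| "to_queue (Op (CInc r)) = Op (Inc r)"
| "to_queue (Op (CDec r)) = Alt (Op (Dec r)) (Seq (Op (Rot r)) (Op (Dec r)))"
| "to_queue (Op (CZer r)) = Seq (Op (Rot r)) (Op (Rot r))"
| "to_queue (Seq c d) = Seq (to_queue c) (to_queue d)"
| "to_queue (Alt c d) = Alt (to_queue c) (to_queue d)"
| "to_queue (Star c) = Star (to_queue c)"

text \<open>Only the number of ones matters, not the position of the marker. A store thus has many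
  representations, and a decrement is free to move the marker.\<close>

definition represents :: "(nat \<Rightarrow> bool list) \<Rightarrow> (nat \<Rightarrow> nat) \<Rightarrow> bool" where
  "represents Q s \<longleftrightarrow> (\<forall>r. \<exists>i j. Q r = replicate i True @ False # replicate j True \<and> s r = i + j)"

lemma represents_upd:
  "represents Q s \<Longrightarrow> q = replicate i True @ False # replicate j True \<Longrightarrow> n = i + j \<Longrightarrow>
    represents (Q(r := q)) (s(r := n))"
  unfolding represents_def by auto

lemma to_queue_sound:
  "qexec (to_queue c) Q Q' \<Longrightarrow> represents Q s \<Longrightarrow> \<exists>s'. cexec c s s' \<and> represents Q' s'"
proof (induction c arbitrary: Q Q' s rule: to_queue.induct)
  case (2 r)
  then obtain i j where ij: "Q r = replicate i True @ False # replicate j True" "s r = i + j"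
    unfolding represents_def by blast
  have "represents (Q(r := Q r @ [True])) (s(r := Suc (s r)))"
    by (rule represents_upd[OF 2(2), where i = i and j = "Suc j"])
      (use ij in \<open>auto simp: replicate_append_same\<close>)
  with 2(1) show ?case by (simp only: to_queue.simps exec.simps qstep.simps cstep.simps) blast
next
  case (3 r)
  then obtain i j where ij: "Q r = replicate i True @ False # replicate j True" "s r = i + j"
    unfolding represents_def by blast
  show ?case
  proof (cases i)
    case 0
    with 3(1) ij obtain j' where "j = Suc j'" "Q' = Q(r := replicate j' True @ [False])"
      by (cases j) auto
    with ij 0 represents_upd[OF 3(2), of _ j' 0 "s r - 1" r] show ?thesis
      by (simp del: fun_upd_apply)
  next
    case (Suc i')
    with 3(1) ij have "Q' = Q(r := replicate i' True @ False # replicate j True)" by auto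
    with ij Suc represents_upd[OF 3(2), of _ i' j "s r - 1" r] show ?thesis
      by (simp del: fun_upd_apply)
  qed
next
  case (4 r)
  then obtain i j where ij: "Q r = replicate i True @ False # replicate j True" "s r = i + j"
    unfolding represents_def by blast
  have "i = 0" using 4(1) ij by (cases i) auto
  moreover from this have "j = 0" using 4(1) ij by (cases j) auto
  ultimately have "Q' = Q" "s r = 0" using 4(1) ij by (auto simp: fun_eq_iff)
  with 4(2) show ?case by auto
next
  case (7 c)
  from 7(2) have "(qexec (to_queue c))\<^sup>*\<^sup>* Q Q'" by simp
  then show ?case
  proof (induction rule: rtranclp_induct)
    case base
    with 7(3) show ?case by auto
  next
    case (step Q' Q'')
    then obtain s' where "(cexec c)\<^sup>*\<^sup>* s s'" "represents Q' s'" by auto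
    with 7(1)[OF step(2)] show ?case by (auto intro: rtranclp.rtrancl_into_rtrancl)
  qed
qed fastforce+

lemma to_queue_complete:
  "cexec c s s' \<Longrightarrow> represents Q s \<Longrightarrow> \<exists>Q'. qexec (to_queue c) Q Q' \<and> represents Q' s'"
proof (induction c arbitrary: Q s s' rule: to_queue.induct)
  case (2 r)
  then obtain i j where ij: "Q r = replicate i True @ False # replicate j True" "s r = i + j"
    unfolding represents_def by blast
  have "represents (Q(r := Q r @ [True])) (s(r := Suc (s r)))"
    by (rule represents_upd[OF 2(2), where i = i and j = "Suc j"])
      (use ij in \<open>auto simp: replicate_append_same\<close>)
  with 2(1) show ?case by (simp only: to_queue.simps exec.simps qstep.simps cstep.simps) blast
next
  case (3 r)
  then obtain i j where ij: "Q r = replicate i True @ False # replicate j True" "s r = i + j"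
    unfolding represents_def by blast
  show ?case
  proof (cases i)
    case 0
    with 3(1) ij obtain j' where j': "j = Suc j'" by (cases j) auto
    with ij 0 have "qexec (to_queue (Op (CDec r))) Q (Q(r := replicate j' True @ [False]))" by simp
    with ij 0 j' represents_upd[OF 3(2), of _ j' 0 "s r - 1" r] 3(1) show ?thesis
      by (auto simp del: fun_upd_apply)
  next
    case (Suc i')
    with ij have "qexec (to_queue (Op (CDec r))) Q (Q(r := replicate i' True @ False # replicate j True))" by simp
    with ij Suc represents_upd[OF 3(2), of _ i' j "s r - 1" r] 3(1) show ?thesis
      by (auto simp del: fun_upd_apply)
  qed
next
  case (4 r)
  then obtain i j where ij: "Q r = replicate i True @ False # replicate j True" "s r = i + j"
    unfolding represents_def by blast
  with 4(1) have "Q r = [False]" by simp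
  then have "qexec (to_queue (Op (CZer r))) Q Q" by (auto simp: fun_eq_iff)
  with 4 show ?case by auto
next
  case (7 c)
  from 7(2) have "(cexec c)\<^sup>*\<^sup>* s s'" by simp
  then show ?case
  proof (induction rule: rtranclp_induct)
    case base
    with 7(3) show ?case by auto
  next
    case (step s' s'')
    then obtain Q' where "(qexec (to_queue c))\<^sup>*\<^sup>* Q Q'" "represents Q' s'" by auto
    with 7(1)[OF step(2)] show ?case by (auto intro: rtranclp.rtrancl_into_rtrancl)
  qed
qed fastforce+

section \<open>The automaton of a program\<close>

datatype node = Node bool "nat list"

instance node :: countable by countable_datatype

abbreviation "In \<equiv> Node False []"
abbreviation "Out \<equiv> Node True []"

fun sub :: "nat \<Rightarrow> node \<Rightarrow> node" where
  "sub k (Node b p) = Node b (k # p)"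

definition lift :: "nat \<Rightarrow> (node \<times> letter \<times> node) set \<Rightarrow> (node \<times> letter \<times> node) set" where
  "lift k E = (\<lambda>(u, a, v). (sub k u, a, sub k v)) ` E"

text \<open>
  The automaton of a program: its nodes are the entry (\<open>False\<close>) and exit (\<open>True\<close>) points of the
  subprograms, addressed by their paths in the syntax tree.
\<close>

fun graph :: "letter cmd \<Rightarrow> (node \<times> letter \<times> node) set" where
  "graph Skip = {(In, Eps, Out)}"
| "graph (Op a) = {(In, a, Out)}"
| "graph (Seq c d) = {(In, Eps, sub 0 In), (sub 0 Out, Eps, sub 1 In), (sub 1 Out, Eps, Out)} \<union>
     lift 0 (graph c) \<union> lift 1 (graph d)"
| "graph (Alt c d) = {(In, Eps, sub 0 In), (In, Eps, sub 1 In), (sub 0 Out, Eps, Out), (sub 1 Out, Eps, Out)} \<union>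
     lift 0 (graph c) \<union> lift 1 (graph d)"
| "graph (Star c) = {(In, Eps, sub 0 In), (sub 0 Out, Eps, In), (In, Eps, Out)} \<union> lift 0 (graph c)"

lemma finite_graph: "finite (graph c)"
  by (induction c) (auto simp: lift_def)

lemma sub_eq_iff [simp]: "sub k u = sub l v \<longleftrightarrow> k = l \<and> u = v"
  by (cases u; cases v) auto

lemma sub_neq [simp]: "sub k u \<noteq> Node b []" "Node b [] \<noteq> sub k u"
  by (cases u; auto)+

declare sub.simps [simp del]

lemma lift_iff: "(u, a, v) \<in> lift k E \<longleftrightarrow> (\<exists>u' v'. u = sub k u' \<and> v = sub k v' \<and> (u', a, v') \<in> E)"
  by (force simp: lift_def)

lemma graph_letters: "(u, a, v) \<in> graph c \<Longrightarrow> a = Eps \<or> a \<in> set_cmd c"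
proof (induction c arbitrary: u v)
  case (Seq c d)
  then show ?case by (simp add: lift_iff) metis
next
  case (Alt c d)
  then show ?case by (simp add: lift_iff) metis
next
  case (Star c)
  then show ?case by (simp add: lift_iff) metis
qed simp_all

lemma graph_Out: "(Out, a, v) \<notin> graph c"
  by (cases c) (auto simp: lift_iff)

lemma graph_In_progress: "\<exists>a v. (In, a, v) \<in> graph c"
  by (cases c) force+

text \<open>\<open>Out\<close> is the only node where control can get stuck. Hence a finite maximal
  run of the net spells a word of the whole program and never stops halfway.\<close>

lemma graph_progress: "(u, a, v) \<in> graph c \<Longrightarrow> v = Out \<or> (\<exists>b w. (v, b, w) \<in> graph c)"
proof (induction c arbitrary: u a v)
  case (Seq c d)
  have 0: "\<exists>b w. (sub 0 x, b, w) \<in> graph (Seq c d)" if "x = In \<or> x = Out \<or> (u', a', x) \<in> graph c" for x u' a'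
    using that Seq.IH(1)[of u' a' x] graph_In_progress[of c] by (simp add: lift_iff) metis
  have 1: "\<exists>b w. (sub 1 x, b, w) \<in> graph (Seq c d)" if "x = In \<or> x = Out \<or> (u', a', x) \<in> graph d" for x u' a'
    using that Seq.IH(2)[of u' a' x] graph_In_progress[of d] by (simp add: lift_iff) metis
  from Seq.prems have "v = Out \<or> (\<exists>x u'. v = sub 0 x \<and> (x = In \<or> x = Out \<or> (u', a, x) \<in> graph c)) \<or>
      (\<exists>x u'. v = sub 1 x \<and> (x = In \<or> x = Out \<or> (u', a, x) \<in> graph d))"
    by (auto simp: lift_iff)
  with 0 1 show ?case by blast
next
  case (Alt c d)
  have 0: "\<exists>b w. (sub 0 x, b, w) \<in> graph (Alt c d)" if "x = In \<or> x = Out \<or> (u', a', x) \<in> graph c" for x u' a'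
    using that Alt.IH(1)[of u' a' x] graph_In_progress[of c] by (simp add: lift_iff) metis
  have 1: "\<exists>b w. (sub 1 x, b, w) \<in> graph (Alt c d)" if "x = In \<or> x = Out \<or> (u', a', x) \<in> graph d" for x u' a'
    using that Alt.IH(2)[of u' a' x] graph_In_progress[of d] by (simp add: lift_iff) metis
  from Alt.prems have "v = Out \<or> (\<exists>x u'. v = sub 0 x \<and> (x = In \<or> x = Out \<or> (u', a, x) \<in> graph c)) \<or>
      (\<exists>x u'. v = sub 1 x \<and> (x = In \<or> x = Out \<or> (u', a, x) \<in> graph d))"
    by (auto simp: lift_iff)
  with 0 1 show ?case by blast
next
  case (Star c)
  have 0: "\<exists>b w. (sub 0 x, b, w) \<in> graph (Star c)" if "x = In \<or> x = Out \<or> (u', a', x) \<in> graph c" for x u' a'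
    using that Star.IH[of u' a' x] graph_In_progress[of c] by (simp add: lift_iff) metis
  have "(In, Eps, Out) \<in> graph (Star c)" by simp
  moreover from Star.prems have "v = Out \<or> v = In \<or>
      (\<exists>x u'. v = sub 0 x \<and> (x = In \<or> x = Out \<or> (u', a, x) \<in> graph c))"
    by (auto simp: lift_iff)
  ultimately show ?case using 0 by blast
qed simp_all

section \<open>Words read along paths\<close>

inductive path :: "('v \<times> 'l \<times> 'v) set \<Rightarrow> 'v \<Rightarrow> 'l list \<Rightarrow> 'v \<Rightarrow> bool" for E where
  path_Nil: "path E u [] u"
| path_Cons: "(u, a, v) \<in> E \<Longrightarrow> path E v w x \<Longrightarrow> path E u (a # w) x"

lemma path_append: "path E u w v \<Longrightarrow> path E v w' x \<Longrightarrow> path E u (w @ w') x"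
  by (induction rule: path.induct) (auto intro: path.intros)

lemma path_mono: "path E u w v \<Longrightarrow> E \<subseteq> F \<Longrightarrow> path F u w v"
  by (induction rule: path.induct) (auto intro: path.intros)

lemma path_single: "(u, a, v) \<in> E \<Longrightarrow> path E u [a] v"
  by (blast intro: path.intros)

lemma path_lift: "path E u w v \<Longrightarrow> path (lift k E) (sub k u) w (sub k v)"
  by (induction rule: path.induct) (auto intro!: path.intros(1) path.intros(2)[rotated] simp: lift_iff)

fun runs :: "('o \<Rightarrow> 's \<Rightarrow> 's \<Rightarrow> bool) \<Rightarrow> 'o list \<Rightarrow> 's \<Rightarrow> 's \<Rightarrow> bool" where
  "runs st [] s s' \<longleftrightarrow> s' = s"
| "runs st (a # w) s s' \<longleftrightarrow> (\<exists>u. st a s u \<and> runs st w u s')"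

lemma runs_append: "runs st (w @ w') s s' \<longleftrightarrow> (\<exists>u. runs st w s u \<and> runs st w' u s')"
  by (induction w arbitrary: s) auto

lemma graph_complete:
  "qexec c Q Q' \<Longrightarrow> \<exists>w. path (graph c) In w Out \<and> runs qstep w Q Q'"
proof (induction c arbitrary: Q Q')
  case Skip
  then show ?case by (intro exI[of _ "[Eps]"]) (auto intro: path_single)
next
  case (Op a)
  then show ?case by (intro exI[of _ "[a]"]) (auto intro: path_single)
next
  case (Seq c d)
  then obtain R w w' where w: "path (graph c) In w Out" "runs qstep w Q R"
    and w': "path (graph d) In w' Out" "runs qstep w' R Q'" by fastforce
  let ?G = "graph (Seq c d)"
  have "path ?G (sub 0 In) w (sub 0 Out)" "path ?G (sub 1 In) w' (sub 1 Out)"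
    by (rule path_mono[OF path_lift[OF w(1)]], force, rule path_mono[OF path_lift[OF w'(1)]], force)
  moreover have "path ?G In [Eps] (sub 0 In)" "path ?G (sub 0 Out) [Eps] (sub 1 In)" "path ?G (sub 1 Out) [Eps] Out"
    by (auto intro!: path_single)
  ultimately have "path ?G In ([Eps] @ w @ [Eps] @ w' @ [Eps]) Out"
    by (meson path_append)
  moreover have "runs qstep ([Eps] @ w @ [Eps] @ w' @ [Eps]) Q Q'"
    using w(2) w'(2) by (auto simp: runs_append)
  ultimately show ?case by blast
next
  case (Alt c d)
  let ?G = "graph (Alt c d)"
  from Alt.prems consider "qexec c Q Q'" | "qexec d Q Q'" by auto
  then show ?case
  proof cases
    case 1
    with Alt.IH(1) obtain w where w: "path (graph c) In w Out" "runs qstep w Q Q'" by blast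
    have "path ?G (sub 0 In) w (sub 0 Out)"
      by (rule path_mono[OF path_lift[OF w(1)]]) force
    moreover have "path ?G In [Eps] (sub 0 In)" "path ?G (sub 0 Out) [Eps] Out"
      by (auto intro!: path_single)
    ultimately have "path ?G In ([Eps] @ w @ [Eps]) Out"
      by (meson path_append)
    moreover have "runs qstep ([Eps] @ w @ [Eps]) Q Q'"
      using w(2) by (auto simp: runs_append)
    ultimately show ?thesis by blast
  next
    case 2
    with Alt.IH(2) obtain w where w: "path (graph d) In w Out" "runs qstep w Q Q'" by blast
    have "path ?G (sub 1 In) w (sub 1 Out)"
      by (rule path_mono[OF path_lift[OF w(1)]]) force
    moreover have "path ?G In [Eps] (sub 1 In)" "path ?G (sub 1 Out) [Eps] Out"
      by (auto intro!: path_single)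
    ultimately have "path ?G In ([Eps] @ w @ [Eps]) Out"
      by (meson path_append)
    moreover have "runs qstep ([Eps] @ w @ [Eps]) Q Q'"
      using w(2) by (auto simp: runs_append)
    ultimately show ?thesis by blast
  qed
next
  case (Star c)
  let ?G = "graph (Star c)"
  have "(qexec c)\<^sup>*\<^sup>* Q Q'" using Star.prems by simp
  then have "\<exists>w. path ?G In w In \<and> runs qstep w Q Q'"
  proof (induction rule: rtranclp_induct)
    case base
    then show ?case by (intro exI[of _ "[]"]) (auto intro: path_Nil)
  next
    case (step R R')
    then obtain v where v: "path ?G In v In" "runs qstep v Q R" by blast
    from Star.IH[OF step(2)] obtain w where w: "path (graph c) In w Out" "runs qstep w R R'" by blast
    have "path ?G (sub 0 In) w (sub 0 Out)"
      by (rule path_mono[OF path_lift[OF w(1)]]) force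
    moreover have "path ?G In [Eps] (sub 0 In)" "path ?G (sub 0 Out) [Eps] In"
      by (auto intro!: path_single)
    ultimately have "path ?G In (v @ [Eps] @ w @ [Eps]) In"
      using v(1) by (meson path_append)
    moreover have "runs qstep (v @ [Eps] @ w @ [Eps]) Q R'"
      using v(2) w(2) by (auto simp: runs_append)
    ultimately show ?case by blast
  qed
  then obtain w where "path ?G In w In" "runs qstep w Q Q'" by blast
  moreover have "path ?G In [Eps] Out" by (auto intro!: path_single)
  ultimately have "path ?G In (w @ [Eps]) Out" "runs qstep (w @ [Eps]) Q Q'"
    by (auto intro: path_append simp: runs_append)
  then show ?case by blast
qed

text \<open>
  The stores with which control can reach a node, as an inductive assertion at each node: soundness
  of the automaton then needs no decomposition of its paths.
\<close>

fun reaches :: "letter cmd \<Rightarrow> node \<Rightarrow> (nat \<Rightarrow> bool list) \<Rightarrow> (nat \<Rightarrow> bool list) \<Rightarrow> bool" where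
  "reaches c (Node False []) = (case c of Star d \<Rightarrow> (qexec d)\<^sup>*\<^sup>* | _ \<Rightarrow> (=))"
| "reaches c (Node True []) = qexec c"
| "reaches (Seq c d) (Node b (k # p)) =
     (if k = 0 then reaches c (Node b p) else qexec c OO reaches d (Node b p))"
| "reaches (Alt c d) (Node b (k # p)) = (if k = 0 then reaches c (Node b p) else reaches d (Node b p))"
| "reaches (Star c) (Node b (k # p)) = (qexec c)\<^sup>*\<^sup>* OO reaches c (Node b p)"
| "reaches _ _ = (\<lambda>_ _. False)"

lemma reaches_sub [simp]:
  "reaches (Seq c d) (sub k u) = (if k = 0 then reaches c u else qexec c OO reaches d u)"
  "reaches (Alt c d) (sub k u) = (if k = 0 then reaches c u else reaches d u)"
  "reaches (Star c) (sub k u) = (qexec c)\<^sup>*\<^sup>* OO reaches c u"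
  by (cases u; simp add: sub.simps)+

lemma reaches_In [intro]: "reaches c In Q Q"
  by (cases c) auto

lemma reaches_In_iff [simp]:
  "reaches Skip In Q R \<longleftrightarrow> Q = R" "reaches (Op a) In Q R \<longleftrightarrow> Q = R"
  "reaches (Seq c d) In Q R \<longleftrightarrow> Q = R" "reaches (Alt c d) In Q R \<longleftrightarrow> Q = R"
  "reaches (Star c) In Q R \<longleftrightarrow> (qexec c)\<^sup>*\<^sup>* Q R"
  by auto

declare reaches.simps(1) [simp del]

lemma graph_sound_step:
  "(u, a, v) \<in> graph c \<Longrightarrow> reaches c u Q R \<Longrightarrow> qstep a R R' \<Longrightarrow> reaches c v Q R'"
proof (induction c arbitrary: u v Q)
  case (Seq c d)
  from Seq.prems Seq.IH show ?case by (auto simp: lift_iff relcompp_apply) blast+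
next
  case (Alt c d)
  then show ?case by (auto simp: lift_iff)
next
  case (Star c)
  from Star.prems Star.IH show ?case
    by (auto simp: lift_iff relcompp_apply intro: rtranclp.rtrancl_into_rtrancl) blast+
qed auto

lemma graph_sound:
  assumes "path (graph c) u w v" "reaches c u Q R" "runs qstep w R R'"
  shows "reaches c v Q R'"
  using assms by (induction arbitrary: R rule: path.induct) (auto intro: graph_sound_step)

theorem graph_correct:
  "qexec c Q Q' \<longleftrightarrow> (\<exists>w. path (graph c) In w Out \<and> runs qstep w Q Q')"
  using graph_complete graph_sound[of c In _ Out Q Q Q'] reaches_In[of c Q] by fastforce

section \<open>The test as a two-tape automaton\<close>

inductive accepts :: "('q \<times> ('l + 'l) option \<times> 'q) set \<Rightarrow> 'q \<Rightarrow> 'q \<Rightarrow> 'l list \<Rightarrow> 'l list \<Rightarrow> bool"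
  for E fin where
  accepts_fin: "accepts E fin fin [] []"
| accepts_tau: "(q, None, q') \<in> E \<Longrightarrow> accepts E fin q' w w' \<Longrightarrow> accepts E fin q w w'"
| accepts_left: "(q, Some (Inl a), q') \<in> E \<Longrightarrow> accepts E fin q' w w' \<Longrightarrow> accepts E fin q (a # w) w'"
| accepts_right: "(q, Some (Inr a), q') \<in> E \<Longrightarrow> accepts E fin q' w w' \<Longrightarrow> accepts E fin q w (a # w')"

text \<open>\<open>Init\<close>, \<open>Idle\<close>, \<open>Never\<close>, \<open>Junk1\<close> and
  \<open>Junk2\<close> have no edges in \<open>test_edges\<close>. They form the frame that
  determines the maximal runs of the test alone.\<close>

datatype state = Init | Start | Idle | Never | Junk1 | Junk2 | Fin | Loop | Flush
  | Cmp "nat option" | Pend "nat option" letter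

instance state :: countable by countable_datatype

text \<open>The check \<open>None\<close> compares the tapes themselves, the check
  \<open>Some r\<close> the history of the queue of register \<open>r\<close>. Symbols are named
  after the letters that push them: a one is \<open>Inc r\<close>, also when \<open>Dec r\<close>
  pops it, and the marker is \<open>Rot r\<close>, a letter that both pops and pushes.\<close>

fun push :: "nat option \<Rightarrow> letter \<Rightarrow> letter option" where
  "push None a = Some a"
| "push (Some r) a = (if a = Inc r \<or> a = Rot r then Some a else None)"

fun pop :: "nat option \<Rightarrow> letter \<Rightarrow> letter option" where
  "pop None a = Some a"
| "pop (Some r) a = (if a = Dec r then Some (Inc r) else if a = Rot r then Some (Rot r) else None)"

abbreviation "stream f w \<equiv> List.map_filter f w"

definition letters :: "nat \<Rightarrow> letter set" where
  "letters k = insert Eps (Inc ` {..<k} \<union> Dec ` {..<k} \<union> Rot ` {..<k})"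

definition checks :: "nat \<Rightarrow> nat option set" where
  "checks k = insert None (Some ` {..<k})"

text \<open>
  The test reads its two tapes asynchronously. For a check \<open>c\<close> it alternately reads the next symbol
  that the left tape pushes and the next symbol that the right tape pops, and passes if they differ;
  the queue of a register initially holds the marker. \<^term>\<open>Loop\<close> lets infinite tapes pass.
\<close>

definition test_edges :: "nat \<Rightarrow> (state \<times> (letter + letter) option \<times> state) set" where
  "test_edges k =
     {(Start, None, Loop), (Start, None, Cmp None), (Flush, None, Fin)} \<union>
     (\<lambda>r. (Start, None, Pend (Some r) (Rot r))) ` {..<k} \<union>
     (\<lambda>(q, a). (q, Some (Inl a), q)) ` ({Loop, Flush} \<times> letters k) \<union>
     (\<lambda>(q, a). (q, Some (Inr a), q)) ` ({Loop, Flush} \<times> letters k) \<union>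
     (\<lambda>(c, a). (Cmp c, Some (Inl a), case push c a of None \<Rightarrow> Cmp c | Some s \<Rightarrow> Pend c s)) `
       (checks k \<times> letters k) \<union>
     (\<lambda>(c, s, a). (Pend c s, Some (Inr a),
        case pop c a of None \<Rightarrow> Pend c s | Some s' \<Rightarrow> if s' = s then Cmp c else Flush)) `
       (checks k \<times> letters k \<times> letters k)"

text \<open>Lists of which one is a prefix of the other do not clash: a queue may end nonempty, so
  pushed symbols need not all be popped.\<close>

fun clash :: "'a list \<Rightarrow> 'a list \<Rightarrow> bool" where
  "clash (x # xs) (y # ys) \<longleftrightarrow> x \<noteq> y \<or> clash xs ys"
| "clash _ _ \<longleftrightarrow> False"

lemma clash_Nil2 [simp]: "\<not> clash xs []"
  by (cases xs) auto

lemma clash_append: "clash xs ys \<Longrightarrow> clash (xs @ xs') (ys @ ys')"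
  by (induction xs ys rule: clash.induct) auto

lemma not_clash_prefix: "\<not> clash xs ys \<Longrightarrow> (\<exists>zs. ys = xs @ zs) \<or> (\<exists>zs. xs = ys @ zs)"
  by (induction xs ys rule: clash.induct) auto

lemma clash_irrefl [simp]: "\<not> clash xs xs"
  by (induction xs) auto

lemma stream_Cons: "stream f (a # w) = (case f a of None \<Rightarrow> stream f w | Some s \<Rightarrow> s # stream f w)"
  by (simp add: map_filter_def split: option.split)

lemma stream_Nil [simp]: "stream f [] = []"
  by (simp add: map_filter_def)

lemma stream_append: "stream f (w @ w') = stream f w @ stream f w'"
  by (simp add: map_filter_def)

lemma stream_None [simp]: "stream (push None) w = w" "stream (pop None) w = w"
  by (induction w) (auto simp: stream_Cons)

text \<open>Each state is assigned what the unread rest of the tapes must satisfy, and every edge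
  preserves this backwards from \<open>Fin\<close>. \<open>Loop\<close> is assigned
  \<open>False\<close>, as it has no way to \<open>Fin\<close>.\<close>

lemma test_edges_sound:
  "accepts (test_edges k) Fin q w w' \<Longrightarrow>
    (case q of
       Start \<Rightarrow> clash w w' \<or> (\<exists>r<k. clash (Rot r # stream (push (Some r)) w) (stream (pop (Some r)) w'))
     | Cmp c \<Rightarrow> clash (stream (push c) w) (stream (pop c) w')
     | Pend c s \<Rightarrow> clash (s # stream (push c) w) (stream (pop c) w')
     | Flush \<Rightarrow> True | Fin \<Rightarrow> True | _ \<Rightarrow> False)"
proof (induction rule: accepts.induct)
  case accepts_fin
  show ?case by simp
next
  case (accepts_tau q q' w w')
  then show ?case by (auto simp: test_edges_def)
next
  case (accepts_left q a q' w w')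
  then show ?case by (auto simp: test_edges_def stream_Cons split: option.splits)
next
  case (accepts_right q a q' w w')
  then show ?case by (auto simp: test_edges_def stream_Cons split: option.splits if_splits)
qed

lemma accepts_Flush:
  "w \<in> lists (letters k) \<Longrightarrow> w' \<in> lists (letters k) \<Longrightarrow> accepts (test_edges k) Fin Flush w w'"
proof (induction w)
  case Nil
  have Flush: "(Flush, None, Fin) \<in> test_edges k" by (simp add: test_edges_def)
  from Nil show ?case
  proof (induction w')
    case Nil
    with Flush show ?case by (blast intro: accepts.intros)
  next
    case (Cons a w')
    have "(Flush, Some (Inr a), Flush) \<in> test_edges k"
      using Cons by (auto simp: test_edges_def)
    with Cons show ?case by (auto intro: accepts.intros)
  qed
next
  case (Cons a w)
  have "(Flush, Some (Inl a), Flush) \<in> test_edges k"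
    using Cons by (auto simp: test_edges_def)
  with Cons show ?case by (auto intro: accepts.intros)
qed

lemma push_letters: "push c a = Some s \<Longrightarrow> a \<in> letters k \<Longrightarrow> s \<in> letters k"
  by (cases c) (auto split: if_splits)

text \<open>Both states are treated in one induction on the number of unread letters: a push leads
  from \<open>Cmp\<close> to \<open>Pend\<close>, a matching pop leads back, and letters that the
  check ignores leave the state unchanged.\<close>

lemma test_edges_complete:
  assumes "w \<in> lists (letters k)" "w' \<in> lists (letters k)" "c \<in> checks k"
  shows "clash (stream (push c) w) (stream (pop c) w') \<Longrightarrow> accepts (test_edges k) Fin (Cmp c) w w'"
    and "s \<in> letters k \<Longrightarrow> clash (s # stream (push c) w) (stream (pop c) w') \<Longrightarrow>
      accepts (test_edges k) Fin (Pend c s) w w'"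
  using assms
proof (induction "length w + length w'" arbitrary: w w' s rule: less_induct)
  case less
  {
    case 1
    then obtain a v where w: "w = a # v" by (cases w) auto
    let ?q = "case push c a of None \<Rightarrow> Cmp c | Some s \<Rightarrow> Pend c s"
    have "(Cmp c, Some (Inl a), ?q) \<in> test_edges k"
      unfolding test_edges_def using 1 w by (auto intro!: rev_image_eqI[of "(c, a)"])
    moreover have "accepts (test_edges k) Fin ?q v w'"
      using less(1)[of v w'] less(2)[of v w'] 1 w
      by (auto simp: stream_Cons push_letters split: option.splits)
    ultimately show ?case unfolding w by (rule accepts_left)
  next
    case 2
    then obtain a v where w: "w' = a # v" by (cases w') auto
    let ?q = "case pop c a of None \<Rightarrow> Pend c s | Some s' \<Rightarrow> if s' = s then Cmp c else Flush"
    have "(Pend c s, Some (Inr a), ?q) \<in> test_edges k"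
      unfolding test_edges_def using 2 w by (auto intro!: rev_image_eqI[of "(c, s, a)"])
    moreover have "accepts (test_edges k) Fin ?q w v"
      using less(1)[of w v] less(2)[of w v s] 2 w
      by (auto simp: stream_Cons accepts_Flush split: option.splits)
    ultimately show ?case unfolding w by (rule accepts_right)
  }
qed

theorem accepts_Start_iff:
  assumes w: "w \<in> lists (letters k)" "w' \<in> lists (letters k)"
  shows "accepts (test_edges k) Fin Start w w' \<longleftrightarrow>
    clash w w' \<or> (\<exists>r<k. clash (Rot r # stream (push (Some r)) w) (stream (pop (Some r)) w'))"
proof
  assume "accepts (test_edges k) Fin Start w w'"
  from test_edges_sound[OF this] show "clash w w' \<or>
      (\<exists>r<k. clash (Rot r # stream (push (Some r)) w) (stream (pop (Some r)) w'))" by simp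
next
  assume "clash w w' \<or> (\<exists>r<k. clash (Rot r # stream (push (Some r)) w) (stream (pop (Some r)) w'))"
  then show "accepts (test_edges k) Fin Start w w'"
  proof (elim disjE exE conjE)
    assume "clash w w'"
    then have "accepts (test_edges k) Fin (Cmp None) w w'"
      using test_edges_complete(1)[OF w, of None] by (auto simp: checks_def)
    moreover have "(Start, None, Cmp None) \<in> test_edges k" by (simp add: test_edges_def)
    ultimately show ?thesis by (rule accepts_tau[rotated])
  next
    fix r assume r: "r < k" and "clash (Rot r # stream (push (Some r)) w) (stream (pop (Some r)) w')"
    then have "accepts (test_edges k) Fin (Pend (Some r) (Rot r)) w w'"
      using test_edges_complete(2)[OF w, of "Some r" "Rot r"] by (auto simp: checks_def letters_def)
    moreover have "(Start, None, Pend (Some r) (Rot r)) \<in> test_edges k"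
      using r by (simp add: test_edges_def)
    ultimately show ?thesis by (rule accepts_tau[rotated])
  qed
qed

section \<open>From clashes to queue executions\<close>

definition sym :: "nat \<Rightarrow> bool \<Rightarrow> letter" where
  "sym r b = (if b then Inc r else Rot r)"

text \<open>During an execution the queue always contains exactly the pushed symbols that have not
  been popped yet, so a pop removes the same symbol from the front of both lists.\<close>

lemma runs_no_clash:
  "runs qstep v Q Q' \<Longrightarrow> \<not> clash (map (sym r) (Q r) @ stream (push (Some r)) v) (stream (pop (Some r)) v)"
proof (induction v arbitrary: Q)
  case (Cons a v)
  then obtain R where R: "qstep a Q R" "runs qstep v R Q'" by auto
  from Cons.IH[OF R(2)] R(1) show ?case
    by (cases a) (auto simp: stream_Cons sym_def split: if_splits)
qed simp

text \<open>
  No letter removes the marker \<^term>\<open>False\<close> from a queue, so a symbol is never popped before it is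
  pushed.
\<close>

lemma no_clash_runs:
  assumes "v \<in> lists (letters k)" "\<And>r. False \<in> set (Q r)"
    and "\<And>r. r < k \<Longrightarrow> \<not> clash (map (sym r) (Q r) @ stream (push (Some r)) v) (stream (pop (Some r)) v)"
  shows "\<exists>Q'. runs qstep v Q Q'"
  using assms
proof (induction v arbitrary: Q rule: list.induct)
  case (Cons a v)
  have "\<exists>R. qstep a Q R \<and> (\<forall>r. False \<in> set (R r)) \<and> (\<forall>r<k.
      clash (map (sym r) (R r) @ stream (push (Some r)) v) (stream (pop (Some r)) v) \<longrightarrow>
      clash (map (sym r) (Q r) @ stream (push (Some r)) (a # v)) (stream (pop (Some r)) (a # v)))"
  proof (cases a)
    case (Dec r)
    with Cons.prems(1) have "r < k" by (auto simp: letters_def)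
    from Cons.prems(2)[of r] obtain b q where Q: "Q r = b # q" by (cases "Q r") auto
    from Cons.prems(3)[OF \<open>r < k\<close>] Q Dec have b by (cases b) (auto simp: stream_Cons sym_def)
    with Q Cons.prems(2) have "False \<in> set q" by (metis set_ConsD)
    with Q Dec \<open>b\<close> Cons.prems(2) show ?thesis
      by (intro exI[of _ "Q(r := q)"]) (auto simp: stream_Cons sym_def)
  next
    case (Rot r)
    with Cons.prems(1) have "r < k" by (auto simp: letters_def)
    from Cons.prems(2)[of r] obtain b q where Q: "Q r = b # q" by (cases "Q r") auto
    from Cons.prems(3)[OF \<open>r < k\<close>] Q Rot have "\<not> b" by (cases b) (auto simp: stream_Cons sym_def)
    with Q Rot Cons.prems(2) show ?thesis
      by (intro exI[of _ "Q(r := q @ [False])"]) (auto simp: stream_Cons sym_def)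
  qed (use Cons.prems in \<open>auto simp: stream_Cons sym_def letters_def\<close>)
  then obtain R where "qstep a Q R" "\<exists>Q'. runs qstep v R Q'"
    using Cons.IH Cons.prems by (metis Cons_in_lists_iff)
  then show ?case by auto
qed (metis runs.simps(1))

text \<open>A correct word is rejected when paired with itself, as no check finds a clash.
  Conversely, the words of a rejected pair do not clash, so the shorter one is a prefix of the
  other. It belongs to \<open>L\<close>, and its histories do not clash because a clash would
  survive in the longer words; hence it is correct.\<close>

theorem all_accepted_iff:
  assumes L: "L \<subseteq> lists (letters k)"
  shows "(\<forall>w\<in>L. \<forall>w'\<in>L. accepts (test_edges k) Fin Start w w') \<longleftrightarrow>
    \<not> (\<exists>v\<in>L. \<exists>Q. runs qstep v (\<lambda>_. [False]) Q)"
proof -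
  have 1: "\<not> accepts (test_edges k) Fin Start v v" if "v \<in> L" "runs qstep v (\<lambda>_. [False]) Q" for v Q
  proof -
    have "v \<in> lists (letters k)" using that L by blast
    with runs_no_clash[OF that(2)] show ?thesis
      by (auto simp: accepts_Start_iff sym_def)
  qed
  have 2: "\<exists>v\<in>L. \<exists>Q. runs qstep v (\<lambda>_. [False]) Q"
    if w: "w \<in> L" "w' \<in> L" and na: "\<not> accepts (test_edges k) Fin Start w w'" for w w'
  proof -
    have lists: "w \<in> lists (letters k)" "w' \<in> lists (letters k)" using w L by auto
    with na have nc: "\<not> clash w w'"
      "\<And>r. r < k \<Longrightarrow> \<not> clash (Rot r # stream (push (Some r)) w) (stream (pop (Some r)) w')"
      by (auto simp: accepts_Start_iff)
    obtain v u u' where v: "v \<in> L" "w = v @ u" "w' = v @ u'"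
      using not_clash_prefix[OF nc(1)] w by (metis append_Nil2)
    have "\<not> clash (Rot r # stream (push (Some r)) v) (stream (pop (Some r)) v)" if "r < k" for r
      using nc(2)[OF that] clash_append[of "Rot r # stream (push (Some r)) v" "stream (pop (Some r)) v"]
      unfolding v stream_append by auto
    with no_clash_runs[of v k "\<lambda>_. [False]"] v lists show ?thesis
      by (auto simp: sym_def)
  qed
  from 1 2 show ?thesis by blast
qed

section \<open>Renaming letters and states\<close>

lemma map_option_map_sum_eq:
  assumes "inj g"
  shows "Some (Inl (g a)) = map_option (map_sum g g) u \<longleftrightarrow> u = Some (Inl a)"
    and "Some (Inr (g a)) = map_option (map_sum g g) u \<longleftrightarrow> u = Some (Inr a)"
  using assms by (cases u; cases "the u"; auto simp: inj_eq)+

lemma accepts_image: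
  assumes h: "inj h" and g: "inj g"
  shows "accepts ((\<lambda>(q, u, q'). (h q, map_option (map_sum g g) u, h q')) ` E) (h fin) (h q) (map g w) (map g w') \<longleftrightarrow>
    accepts E fin q w w'" (is "accepts ?F _ _ _ _ \<longleftrightarrow> _")
proof
  assume "accepts E fin q w w'"
  then show "accepts ?F (h fin) (h q) (map g w) (map g w')"
    by (induction rule: accepts.induct) (force intro: accepts.intros)+
next
  have "accepts ?F (h fin) x y z \<Longrightarrow> x = h q \<Longrightarrow> y = map g w \<Longrightarrow> z = map g w' \<Longrightarrow> accepts E fin q w w'" for x y z
  proof (induction arbitrary: q w w' rule: accepts.induct)
    case accepts_fin
    then show ?case using h by (auto simp: inj_eq intro: accepts.intros)
  next
    case (accepts_tau x x' y z)
    then obtain q' where "(q, None, q') \<in> E" "x' = h q'" using h by (auto simp: inj_eq)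
    with accepts_tau show ?case by (blast intro: accepts.intros)
  next
    case (accepts_left x b x' y z)
    then obtain a v where w: "w = a # v" "b = g a" "y = map g v" by (cases w) auto
    with accepts_left obtain q' where "(q, Some (Inl a), q') \<in> E" "x' = h q'" 
      using h g by (auto simp: inj_eq map_option_map_sum_eq)
    with accepts_left w show ?case by (blast intro: accepts.intros)
  next
    case (accepts_right x b x' y z)
    then obtain a v where w: "w' = a # v" "b = g a" "z = map g v" by (cases w') auto
    with accepts_right obtain q' where "(q, Some (Inr a), q') \<in> E" "x' = h q'" 
      using h g by (auto simp: inj_eq map_option_map_sum_eq)
    with accepts_right w show ?case by (blast intro: accepts.intros)
  qed
  then show "accepts ?F (h fin) (h q) (map g w) (map g w') \<Longrightarrow> accepts E fin q w w'" by blast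
qed

section \<open>Causal nets and processes\<close>

lemma at_most_one:
  assumes "\<And>s t. s \<in> S \<Longrightarrow> t \<in> S \<Longrightarrow> s = t"
  shows "finite S \<and> card S \<le> 1"
proof (cases "S = {}")
  case False
  then obtain x where "S = {x}" using assms by blast
  then show ?thesis by simp
qed simp

lemma causal_netD:
  assumes "causal_net K"
  shows "petri_net K" "wf (flow K)" "initial K = {p \<in> places K. place_pre K p = {}}"
    and "\<And>p s t. s \<in> transitions K \<Longrightarrow> t \<in> transitions K \<Longrightarrow> p \<in> post s \<Longrightarrow> p \<in> post t \<Longrightarrow> s = t"
    and "\<And>p s t. s \<in> transitions K \<Longrightarrow> t \<in> transitions K \<Longrightarrow> p \<in> pre s \<Longrightarrow> p \<in> pre t \<Longrightarrow> s = t"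
proof -
  show P: "petri_net K" and "wf (flow K)" "initial K = {p \<in> places K. place_pre K p = {}}"
    using assms by (auto simp: causal_net_def)
  have card: "finite (place_pre K p)" "card (place_pre K p) \<le> 1" "finite (place_post K p)" "card (place_post K p) \<le> 1"
    if "p \<in> places K" for p
    using assms that by (auto simp: causal_net_def)
  have pl: "pre t \<subseteq> places K" "post t \<subseteq> places K" if "t \<in> transitions K" for t
    using P that by (cases t; auto simp: petri_net_def nonempty_finite_subsets_def)+
  show "s = t" if "s \<in> transitions K" "t \<in> transitions K" "p \<in> post s" "p \<in> post t" for p s t
  proof -
    have "s \<in> place_pre K p" "t \<in> place_pre K p" "p \<in> places K"
      using that pl(2)[OF that(1)] unfolding place_pre_def by blast+
    with card(1,2)[of p] show ?thesis by (metis One_nat_def card_le_Suc0_iff_eq)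
  qed
  show "s = t" if "s \<in> transitions K" "t \<in> transitions K" "p \<in> pre s" "p \<in> pre t" for p s t
  proof -
    have "s \<in> place_post K p" "t \<in> place_post K p" "p \<in> places K"
      using that pl(1)[OF that(1)] unfolding place_post_def by blast+
    with card(3,4)[of p] show ?thesis by (metis One_nat_def card_le_Suc0_iff_eq)
  qed
qed

lemma petri_netD:
  assumes "petri_net N" "t \<in> transitions N"
  shows "pre t \<subseteq> places N" "post t \<subseteq> places N" "finite (pre t)" "finite (post t)"
    "pre t \<noteq> {}" "post t \<noteq> {}"
  using assms by (cases t; auto simp: petri_net_def nonempty_finite_subsets_def)+

lemma petri_net_initial:
  assumes "petri_net N"
  shows "initial N \<subseteq> places N" "finite (initial N)" "initial N \<noteq> {}"
  using assms by (auto simp: petri_net_def nonempty_finite_subsets_def)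

text \<open>
  The set \<open>U\<close> collects the places that have carried a token; in a causal net the consumed places
  \<open>U - M\<close> determine which transitions have fired.
\<close>

lemma reachable_history:
  assumes K: "causal_net K" and "reachable K M"
  shows "\<exists>U. finite U \<and> M \<subseteq> U \<and> initial K \<subseteq> U \<and>
    (\<forall>t\<in>transitions K. pre t \<inter> (U - M) \<noteq> {} \<longrightarrow> pre t \<subseteq> U - M \<and> post t \<subseteq> U) \<and>
    (\<forall>p\<in>U. p \<in> initial K \<or> (\<exists>t\<in>transitions K. p \<in> post t \<and> pre t \<subseteq> U - M))"
  using assms(2)
proof (induction rule: reachable.induct)
  case initial
  show ?case
    by (rule exI[of _ "initial K"]) (use petri_net_initial[OF causal_netD(1)[OF K]] in auto)
next
  case (step M t)
  from step.IH obtain U where U: "finite U" "M \<subseteq> U" "initial K \<subseteq> U"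
    "\<And>t. t \<in> transitions K \<Longrightarrow> pre t \<inter> (U - M) \<noteq> {} \<Longrightarrow> pre t \<subseteq> U - M \<and> post t \<subseteq> U"
    "\<And>p. p \<in> U \<Longrightarrow> p \<in> initial K \<or> (\<exists>t\<in>transitions K. p \<in> post t \<and> pre t \<subseteq> U - M)"
    by metis
  note t = petri_netD[OF causal_netD(1)[OF K] step(2)]
  have pre: "pre t \<subseteq> M" using step(3) by (simp add: enabled_def)
  have new: "post t \<inter> U = {}"
  proof (rule ccontr)
    assume "post t \<inter> U \<noteq> {}"
    then obtain p where p: "p \<in> post t" "p \<in> U" by blast
    have "p \<notin> initial K"
      using p(1) step(2) unfolding causal_netD(3)[OF K] place_pre_def by blast
    with U(5)[OF p(2)] causal_netD(4)[OF K step(2) _ p(1)] have "pre t \<subseteq> U - M" by blast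
    with pre t(5) show False by blast
  qed
  let ?U = "U \<union> post t" and ?M = "fire t M"
  have diff: "?U - ?M = (U - M) \<union> pre t"
    using new pre U(2) by (auto simp: fire_def)
  have "pre s \<subseteq> ?U - ?M \<and> post s \<subseteq> ?U" if s: "s \<in> transitions K" "pre s \<inter> (?U - ?M) \<noteq> {}" for s
  proof (cases "pre s \<inter> (U - M) \<noteq> {}")
    case True
    with U(4)[OF s(1)] show ?thesis unfolding diff by blast
  next
    case False
    with s(2) obtain x where "x \<in> pre s" "x \<in> pre t" unfolding diff by blast
    with causal_netD(5)[OF K s(1) step(2)] have "s = t" by blast
    then show ?thesis unfolding diff by blast
  qed
  moreover have "p \<in> initial K \<or> (\<exists>t\<in>transitions K. p \<in> post t \<and> pre t \<subseteq> ?U - ?M)" if "p \<in> ?U" for p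
  proof (cases "p \<in> U")
    case True
    with U(5)[OF True] show ?thesis unfolding diff by blast
  next
    case False
    with that step(2) show ?thesis unfolding diff by blast
  qed
  moreover have "finite ?U" "?M \<subseteq> ?U" "initial K \<subseteq> ?U"
    using U(1-3) t(4) by (auto simp: fire_def)
  ultimately show ?case by (intro exI[of _ ?U]) blast
qed

text \<open>When one firing sequence of a causal net gets stuck, the whole net has been executed. By
  induction along the flow every place has carried a token: the preset of its producer has been
  marked, and since the producer is not enabled, some of that preset has been consumed. Places do
  not branch, so it was the producer that consumed it. This reduces questions about a run to a
  single firing sequence.\<close>

lemma causal_deadlock:
  assumes K: "causal_net K" and M: "reachable K M" and dead: "\<And>t. t \<in> transitions K \<Longrightarrow> \<not> enabled t M"
  shows "finite (places K)" and "p \<in> M \<Longrightarrow> (p, p') \<notin> flow K"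
proof -
  obtain U where U: "finite U" "M \<subseteq> U" "initial K \<subseteq> U"
    "\<And>t. t \<in> transitions K \<Longrightarrow> pre t \<inter> (U - M) \<noteq> {} \<Longrightarrow> pre t \<subseteq> U - M \<and> post t \<subseteq> U"
    using reachable_history[OF K M] by metis
  note P = petri_netD[OF causal_netD(1)[OF K]]
  have "p \<in> places K \<longrightarrow> p \<in> U" for p
    using causal_netD(2)[OF K]
  proof (induction p rule: wf_induct_rule)
    case (less p)
    show ?case
    proof
      assume p: "p \<in> places K"
      show "p \<in> U"
      proof (cases "p \<in> initial K")
        case False
        with p obtain t where t: "t \<in> transitions K" "p \<in> post t"
          unfolding causal_netD(3)[OF K] place_pre_def by blast
        then have "\<forall>q\<in>pre t. (q, p) \<in> flow K" by (auto simp: flow_def)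
        with less P(1)[OF t(1)] have "pre t \<subseteq> U" by blast
        with dead[OF t(1)] U(4)[OF t(1)] t(2) show ?thesis unfolding enabled_def by blast
      qed (use U in blast)
    qed
  qed
  then have pU: "places K \<subseteq> U" by blast
  with U(1) show "finite (places K)" using finite_subset by blast
  assume "p \<in> M"
  show "(p, p') \<notin> flow K"
  proof
    assume "(p, p') \<in> flow K"
    then obtain t where t: "t \<in> transitions K" "p \<in> pre t" by (auto simp: flow_def)
    with P(1)[OF t(1)] pU dead[OF t(1)] U(4)[OF t(1)] \<open>p \<in> M\<close> show False
      unfolding enabled_def by blast
  qed
qed

lemma fire_image:
  assumes "inj_on f M" "pre t \<subseteq> M"
  shows "f ` fire t M = fire (f ` pre t, act t, f ` post t) (f ` M)"
proof -
  have "f ` (M - pre t) = f ` M - f ` pre t"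
    using assms by (simp add: inj_on_image_set_diff[OF assms(1)])
  then show ?thesis by (simp add: fire_def image_Un)
qed

lemma run_reachable:
  assumes "is_run N K f" "reachable K M"
  shows "reachable N (f ` M)"
  using assms(2)
proof (induction rule: reachable.induct)
  case initial
  from assms(1) have "f ` initial K = initial N" by (simp add: is_run_def)
  with reachable.initial[of N] show ?case by simp
next
  case (step M t)
  have "inj_on f M" using step assms(1) by (auto simp: is_run_def)
  with step have "f ` fire t M = fire (f ` pre t, act t, f ` post t) (f ` M)"
    by (simp add: fire_image enabled_def)
  moreover have "(f ` pre t, act t, f ` post t) \<in> transitions N" using assms(1) step by (auto simp: is_run_def)
  moreover have "enabled (f ` pre t, act t, f ` post t) (f ` M)"
    using step(3) by (auto simp: enabled_def)
  ultimately show ?case using step.IH by (simp add: reachable.step)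
qed

section \<open>The process of a firing sequence\<close>

fun firing_step :: "('a, 'p, 'z) net_scheme \<Rightarrow> 'p set \<Rightarrow> ('a, 'p) transition option \<Rightarrow> 'p set \<Rightarrow> bool" where
  "firing_step N M None M' \<longleftrightarrow> M' = M"
| "firing_step N M (Some t) M' \<longleftrightarrow> t \<in> transitions N \<and> enabled t M \<and> M' = fire t M"

text \<open>The steps \<open>None\<close> are pauses. With them a finite firing sequence is also a
  function on all of \<open>nat\<close>, and a schedule may give a turn to a component that has
  nothing left to do.\<close>

locale firing_sequence =
  fixes N :: "('a, 'p :: countable, 'z) net_scheme"
    and M :: "nat \<Rightarrow> 'p set" and ts :: "nat \<Rightarrow> ('a, 'p) transition option"
  assumes petri: "petri_net N" and contact_free: "contact_free N"
    and start: "M 0 = initial N" and step: "\<And>k. firing_step N (M k) (ts k) (M (Suc k))"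
begin

text \<open>A token on \<open>p\<close> at time \<open>k\<close> is identified by \<open>p\<close> and the time at which it was produced.\<close>

primrec birth :: "nat \<Rightarrow> 'p \<Rightarrow> nat" where
  "birth 0 p = 0"
| "birth (Suc k) p = (case ts k of Some t \<Rightarrow> if p \<in> post t then Suc k else birth k p | None \<Rightarrow> birth k p)"

definition token :: "nat \<Rightarrow> 'p \<Rightarrow> nat" where
  "token k p = to_nat (birth k p, p)"

definition place_of :: "nat \<Rightarrow> 'p" where
  "place_of x = snd (from_nat x :: nat \<times> 'p)"

definition time_of :: "nat \<Rightarrow> nat" where
  "time_of x = fst (from_nat x :: nat \<times> 'p)"

definition event :: "nat \<Rightarrow> ('a, 'p) transition \<Rightarrow> ('a, nat) transition" where
  "event k t = (token k ` pre t, act t, token (Suc k) ` post t)"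

definition process :: "('a, nat) net" where
  "process = \<lparr>alphabet = alphabet N, places = (\<Union>k. token k ` M k),
     transitions = {event k t | k t. ts k = Some t}, initial = token 0 ` M 0\<rparr>"

lemma place_of_token [simp]: "place_of (token k p) = p"
  by (simp add: place_of_def token_def)

lemma time_of_token [simp]: "time_of (token k p) = birth k p"
  by (simp add: time_of_def token_def)

lemma token_eq_iff: "token k p = token l q \<longleftrightarrow> p = q \<and> birth k p = birth l p"
  by (auto simp: token_def)

lemma stepD:
  assumes "ts k = Some t"
  shows "t \<in> transitions N" "pre t \<subseteq> M k" "M (Suc k) = (M k - pre t) \<union> post t"
  using step[of k] assms by (auto simp: enabled_def fire_def)

lemma step_None: "ts k = None \<Longrightarrow> M (Suc k) = M k"
  using step[of k] by simp

lemma birth_le: "birth k p \<le> k"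
  by (induction k) (auto split: option.split)

lemma birth_post: "ts k = Some t \<Longrightarrow> p \<in> post t \<Longrightarrow> birth (Suc k) p = Suc k"
  by simp

text \<open>A place that is marked after one of its tokens was consumed must have been refilled in
  the meantime, so its token is a younger one. Therefore no token is consumed twice, which is the
  absence of forward branching in the process.\<close>

lemma birth_consumed:
  assumes "ts k = Some t" "p \<in> pre t" "k < l" "p \<in> M l"
  shows "Suc k \<le> birth l p"
proof -
  have "p \<in> M l \<Longrightarrow> Suc k \<le> birth l p" if "Suc k \<le> l" for l
    using that
  proof (induction l rule: dec_induct)
    case base
    then show ?case using stepD[OF assms(1)] assms(1,2) by auto
  next
    case (step l)
    then show ?case
      using stepD[of l] step_None[of l] by (cases "ts l") (auto split: if_splits)
  qed
  with assms show ?thesis by simp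
qed

lemma birth_0: "p \<in> M k \<Longrightarrow> birth k p = 0 \<Longrightarrow> p \<in> M 0"
proof (induction k)
  case (Suc k)
  then show ?case
    using stepD[of k] step_None[of k] by (cases "ts k") (auto split: if_splits)
qed simp

lemma birth_Suc: "birth k p = Suc j \<Longrightarrow> \<exists>t. ts j = Some t \<and> p \<in> post t"
  by (induction k) (auto split: option.splits if_splits)

lemma persist:
  assumes "p \<in> M k" "\<And>l t. k \<le> l \<Longrightarrow> ts l = Some t \<Longrightarrow> p \<notin> pre t" "k \<le> l"
  shows "p \<in> M l"
  using assms(3)
proof (induction l rule: dec_induct)
  case (step l)
  then show ?case using stepD[of l] step_None[of l] assms(2)[of l] by (cases "ts l") auto
qed (use assms in simp)

lemma process_simps [simp]:
  "alphabet process = alphabet N" "places process = (\<Union>k. token k ` M k)"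
  "transitions process = {event k t | k t. ts k = Some t}" "initial process = token 0 ` initial N"
  by (simp_all add: process_def start)

lemma event_simps [simp]:
  "pre (event k t) = token k ` pre t" "act (event k t) = act t" "post (event k t) = token (Suc k) ` post t"
  by (simp_all add: event_def)

lemma post_time: "ts k = Some t \<Longrightarrow> x \<in> token (Suc k) ` post t \<Longrightarrow> time_of x = Suc k"
  by auto

lemma consumed_unique:
  assumes "ts k = Some s" "p \<in> pre s" "ts l = Some t" "q \<in> pre t" "token k p = token l q"
  shows "k = l"
proof -
  have eq: "p = q" "birth k p = birth l p" using assms(5) by (auto simp: token_eq_iff)
  have "Suc k \<le> birth l p" if "k < l"
    using birth_consumed[OF assms(1,2) that] stepD(2)[OF assms(3)] assms(4) eq by blast
  moreover have "Suc l \<le> birth k p" if "l < k"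
    using birth_consumed[OF assms(3), of p k] that stepD(2)[OF assms(1)] assms(2,4) eq by blast
  ultimately show ?thesis
    using eq birth_le[of k p] birth_le[of l p] by (metis Suc_n_not_le_n le_trans linorder_neqE_nat)
qed

lemma causal_process: "causal_net process"
  unfolding causal_net_def
proof (intro conjI ballI)
  have P: "t \<in> transitions N" "pre t \<subseteq> M k" "finite (pre t)" "pre t \<noteq> {}" "finite (post t)" "post t \<noteq> {}"
    "act t \<in> insert None (Some ` alphabet N)" "post t \<subseteq> M (Suc k)" if "ts k = Some t" for k t
    using stepD[OF that] petri petri_netD[OF petri stepD(1)[OF that]]
    by (cases t; auto simp: petri_net_def)+
  show "petri_net process"
    unfolding petri_net_def
  proof (intro conjI subsetI)
    fix x assume "x \<in> transitions process"
    then obtain k t where x: "x = event k t" "ts k = Some t" by auto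
    have "token k ` pre t \<subseteq> places process" "token (Suc k) ` post t \<subseteq> places process"
      using P(2,8)[OF x(2)] by fastforce+
    with P[OF x(2)] show "x \<in> nonempty_finite_subsets (places process) \<times>
        insert None (Some ` alphabet process) \<times> nonempty_finite_subsets (places process)"
      unfolding x(1) event_def nonempty_finite_subsets_def by auto
  next
    show "initial process \<in> nonempty_finite_subsets (places process)"
      using petri_net_initial[OF petri] start by (auto simp: nonempty_finite_subsets_def)
  qed (use petri in \<open>simp add: petri_net_def\<close>)
next
  have pre: "finite (place_pre process x) \<and> card (place_pre process x) \<le> 1" for x
  proof (rule at_most_one)
    fix s t assume "s \<in> place_pre process x" "t \<in> place_pre process x"
    then obtain k l s' t' where *: "s = event k s'" "t = event l t'" "ts k = Some s'" "ts l = Some t'"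
      "x \<in> token (Suc k) ` post s'" "x \<in> token (Suc l) ` post t'"
      by (auto simp: place_pre_def simp del: birth.simps)
    from post_time[OF *(3,5)] post_time[OF *(4,6)] have "k = l" by simp
    with * show "s = t" by simp
  qed
  then show "finite (place_pre process x)" "card (place_pre process x) \<le> 1" for x by blast+
  have post: "finite (place_post process x) \<and> card (place_post process x) \<le> 1" for x
  proof (rule at_most_one)
    fix s t assume "s \<in> place_post process x" "t \<in> place_post process x"
    then obtain k l s' t' where st: "s = event k s'" "t = event l t'" "ts k = Some s'" "ts l = Some t'"
      "x \<in> token k ` pre s'" "x \<in> token l ` pre t'"
      unfolding place_post_def process_simps by auto
    then obtain p q where *: "s = event k s'" "t = event l t'" "ts k = Some s'" "ts l = Some t'"
      "x = token k p" "p \<in> pre s'" "x = token l q" "q \<in> pre t'" by blast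
    have "k = l" by (rule consumed_unique[OF *(3,6,4,8)]) (use * in simp)
    with * show "s = t" by simp
  qed
  then show "finite (place_post process x)" "card (place_post process x) \<le> 1" for x by blast+
next
  \<comment> \<open>An event at time \<open>k\<close> takes tokens born at time \<open>k\<close> or
    before and yields tokens born at time \<open>Suc k\<close>.\<close>
  show "wf (flow process)"
  proof (rule wf_subset[OF wf_measure[of time_of]])
    have "time_of x < time_of y" if xy: "(x, y) \<in> flow process" for x y
    proof -
      from xy obtain s where s: "s \<in> transitions process" "x \<in> pre s" "y \<in> post s"
        unfolding flow_def by blast
      then obtain k t where kt: "ts k = Some t" "s = event k t" unfolding process_simps by blast
      with s obtain p where "x = token k p" "y \<in> token (Suc k) ` post t" by auto
      with post_time[OF kt(1)] birth_le[of k p] show ?thesis by (simp add: le_imp_less_Suc)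
    qed
    then show "flow process \<subseteq> measure time_of" by auto
  qed
next
  show "initial process = {x \<in> places process. place_pre process x = {}}"
  proof (intro set_eqI iffI)
    fix x assume "x \<in> initial process"
    then have x: "x \<in> token 0 ` M 0" by (simp add: start)
    then have "time_of x = 0" by auto
    then have "x \<notin> token (Suc k) ` post t" if "ts k = Some t" for k t
      using post_time[OF that] by fastforce
    then have new: "x \<notin> post (event k t)" if "ts k = Some t" for k t
      using that unfolding event_simps by blast
    then have "x \<notin> post s" if "s \<in> transitions process" for s
    proof -
      from that obtain k t where "s = event k t" "ts k = Some t" unfolding process_simps by blast
      with new show ?thesis by simp
    qed
    then have "place_pre process x = {}" unfolding place_pre_def by blast
    with x show "x \<in> {x \<in> places process. place_pre process x = {}}" by auto
  next
    fix x assume "x \<in> {x \<in> places process. place_pre process x = {}}"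
    then obtain k p where x: "x = token k p" "p \<in> M k" and empty: "place_pre process x = {}" by auto
    show "x \<in> initial process"
    proof (cases "birth k p")
      case 0
      with birth_0[OF x(2)] have "p \<in> M 0" "x = token 0 p" by (auto simp: x(1) token_def)
      then show ?thesis by (simp add: start)
    next
      case (Suc j)
      then obtain t where t: "ts j = Some t" "p \<in> post t" using birth_Suc by blast
      then have "x = token (Suc j) p" using Suc birth_post[OF t] by (simp add: x(1) token_def)
      with t have "x \<in> post (event j t)" unfolding event_simps by blast
      with t have "event j t \<in> place_pre process x" unfolding place_pre_def process_simps by blast
      with empty show ?thesis by blast
    qed
  qed
qed

lemma event_image: "(place_of ` pre (event k t), act (event k t), place_of ` post (event k t)) = t"
  by (cases t) (simp add: image_image)

text \<open>The process may fire its events in another order than the given sequence, so injectivity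
  has to be shown for all its markings. It follows from contact-freeness of \<open>N\<close>: new
  tokens never fall on a place that stays occupied.\<close>

lemma process_reachable:
  "reachable process X \<Longrightarrow> inj_on place_of X \<and> reachable N (place_of ` X)"
proof (induction rule: reachable.induct)
  case initial
  have "place_of ` initial process = initial N" by (simp add: image_image)
  moreover have "inj_on place_of (initial process)" by (auto intro!: inj_onI)
  ultimately show ?case by (metis reachable.initial)
next
  case (step X x)
  then obtain k t where x: "x = event k t" and t: "ts k = Some t" by auto
  have inj: "inj_on place_of X" and pre: "pre x \<subseteq> X" using step by (auto simp: enabled_def)
  have im: "place_of ` pre x = pre t" "place_of ` post x = post t"
    unfolding x by (simp_all add: image_image)
  have en: "enabled t (place_of ` X)" unfolding enabled_def im(1)[symmetric] using pre by (rule image_mono)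
  have "place_of ` fire x X = fire t (place_of ` X)"
    using fire_image[OF inj pre] im by (simp add: fire_def)
  with reachable.step[OF _ stepD(1)[OF t] en] step.IH have "reachable N (place_of ` fire x X)" by simp
  moreover have "(place_of ` X - pre t) \<inter> post t = {}"
    using contact_free step.IH en stepD(1)[OF t] unfolding contact_free_def by blast
  then have "place_of ` (X - pre x) \<inter> place_of ` post x = {}"
    unfolding inj_on_image_set_diff[OF inj Diff_subset pre] im[symmetric] using im by blast
  moreover have "inj_on place_of (post x)" unfolding x by (auto intro!: inj_onI)
  ultimately show ?case
    using inj unfolding fire_def by (auto simp: inj_on_Un intro: inj_on_subset)
qed

lemma process_run: "is_run N process place_of"
  unfolding is_run_def
proof (intro conjI allI impI ballI)
  have "M k \<subseteq> places N" for k
  proof (induction k)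
    case 0
    then show ?case using petri_net_initial[OF petri] start by simp
  next
    case (Suc k)
    then show ?case
      using stepD[of k] step_None[of k] petri_netD(2)[OF petri] by (cases "ts k") auto
  qed
  then show "place_of ` places process \<subseteq> places N" by (fastforce simp: subset_iff)
  show "place_of ` initial process = initial N" by (simp add: image_image)
  show "inj_on place_of X" if "reachable process X" for X using process_reachable[OF that] by blast
  show "(place_of ` pre x, act x, place_of ` post x) \<in> transitions N" if "x \<in> transitions process" for x
    using that stepD(1) event_image by auto
qed (simp_all add: causal_process)

text \<open>The first consumption of \<open>p\<close> from time \<open>k\<close> on takes the very
  token that is there at time \<open>k\<close>. By contact-freeness the place cannot be refilled
  while it is occupied, so the birth time is still the same.\<close>

lemma consumed_flow:
  assumes "p \<in> M k" "k \<le> l" "ts l = Some t" "p \<in> pre t"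
  shows "\<exists>x. (token k p, x) \<in> flow process"
proof -
  define l where "l = (LEAST l. k \<le> l \<and> (\<exists>t. ts l = Some t \<and> p \<in> pre t))"
  have l: "k \<le> l \<and> (\<exists>t. ts l = Some t \<and> p \<in> pre t)"
    unfolding l_def by (rule LeastI_ex) (use assms in blast)
  then obtain t where t: "ts l = Some t" "p \<in> pre t" by blast
  have min: "p \<notin> pre s" if "k \<le> j" "j < l" "ts j = Some s" for j s
    using not_less_Least[of j "\<lambda>l. k \<le> l \<and> (\<exists>t. ts l = Some t \<and> p \<in> pre t)"] that
    unfolding l_def by blast
  have "p \<in> M j \<and> birth j p = birth k p" if "k \<le> j" "j \<le> l" for j
    using that
  proof (induction j rule: dec_induct)
    case (step j)
    then have IH: "p \<in> M j" "birth j p = birth k p" by auto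
    show ?case
    proof (cases "ts j")
      case None
      then show ?thesis using IH step_None[of j] by simp
    next
      case (Some s)
      have "p \<notin> pre s" using min[of j s] step Some by simp
      moreover have "(M j - pre s) \<inter> post s = {}"
      proof -
        have "reachable N (M i)" for i
        proof (induction i)
          case 0
          show ?case using start reachable.initial[of N] by simp
        next
          case (Suc i)
          then show ?case
            using firing_sequence.step[OF firing_sequence_axioms, of i] by (cases "ts i") (auto intro: reachable.step)
        qed
        with contact_free stepD[OF Some] show ?thesis unfolding contact_free_def enabled_def by blast
      qed
      ultimately show ?thesis using IH Some stepD(3)[OF Some] by auto
    qed
  qed (use assms in simp)
  from this[of l] l have "token l p = token k p" by (simp add: token_def)
  with t have "token k p \<in> pre (event l t)" by (metis event_simps(1) image_eqI)
  moreover have "post (event l t) \<noteq> {}"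
    using petri_netD(6)[OF petri stepD(1)[OF t(1)]] by simp
  moreover have "event l t \<in> transitions process" using t(1) unfolding process_simps by blast
  ultimately show ?thesis unfolding flow_def by blast
qed

text \<open>Maximality becomes a fairness condition on the firing sequence: a token must not wait
  forever on a place from which the flow of \<open>N\<close> continues.\<close>

lemma process_maximal:
  assumes "\<And>k p q. p \<in> M k \<Longrightarrow> (p, q) \<in> flow N \<Longrightarrow> \<exists>l\<ge>k. \<exists>t. ts l = Some t \<and> p \<in> pre t"
  shows "maximal_run N process place_of"
  unfolding maximal_run_def
proof (intro conjI ballI impI process_run)
  fix x assume "x \<in> places process" "\<exists>q. (place_of x, q) \<in> flow N"
  then obtain k p q where x: "x = token k p" "p \<in> M k" "(p, q) \<in> flow N" by auto
  from assms[OF x(2,3)] obtain l t where "k \<le> l" "ts l = Some t" "p \<in> pre t" by blast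
  from consumed_flow[OF x(2) this] show "\<exists>y. (x, y) \<in> flow process" unfolding x(1) .
qed

lemma process_end:
  assumes "x \<in> places process" "\<nexists>y. (x, y) \<in> flow process"
  shows "\<exists>k. \<forall>l\<ge>k. place_of x \<in> M l"
proof -
  obtain k p where x: "x = token k p" "p \<in> M k" using assms(1) by auto
  have "p \<in> M l" if "k \<le> l" for l
    by (rule persist[OF x(2) _ that]) (use assms(2) consumed_flow[OF x(2)] x(1) in blast)
  then show ?thesis unfolding x(1) by auto
qed

lemma process_finite:
  assumes "\<And>l. n \<le> l \<Longrightarrow> ts l = None"
  shows "finite (places process)"
proof -
  have fin: "finite (M k)" for k
  proof (induction k)
    case 0
    then show ?case using petri_net_initial[OF petri] start by simp
  next
    case (Suc k)
    then show ?case
      using stepD[of k] step_None[of k] petri_netD(4)[OF petri] by (cases "ts k") auto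
  qed
  have same: "token l ` M l = token n ` M n" if "n \<le> l" for l
    using that
  proof (induction l rule: dec_induct)
    case (step l)
    then show ?case using assms[of l] step_None[of l] by (simp add: token_def cong: image_cong)
  qed simp
  have sub: "token l ` M l \<subseteq> (\<Union>k\<le>n. token k ` M k)" for l
  proof (cases "n \<le> l")
    case True
    then have "token l ` M l = token n ` M n" by (rule same)
    then show ?thesis by blast
  next
    case False
    then show ?thesis by (intro UN_upper) simp
  qed
  have "finite (\<Union>k\<le>n. token k ` M k)" using fin by blast
  moreover have "places process \<subseteq> (\<Union>k\<le>n. token k ` M k)" using sub by auto
  ultimately show ?thesis by (rule rev_finite_subset)
qed

lemma process_infinite:
  assumes "\<And>k. \<exists>l\<ge>k. ts l \<noteq> None"
  shows "infinite (places process)"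
proof
  assume "finite (places process)"
  then have "finite (time_of ` places process)" by simp
  then obtain n where n: "\<And>x. x \<in> places process \<Longrightarrow> time_of x \<le> n"
    by (metis finite_nat_set_iff_bounded_le imageI)
  obtain l t where l: "n \<le> l" "ts l = Some t" using assms[of n] by auto
  obtain p where p: "p \<in> post t" using petri_netD(6)[OF petri stepD(1)[OF l(2)]] by blast
  then have "p \<in> M (Suc l)" using stepD(3)[OF l(2)] by blast
  then have "token (Suc l) p \<in> places process" by auto
  from n[OF this] p l show False by simp
qed

end

section \<open>State machine nets\<close>

definition state_net :: "'a set \<Rightarrow> 'p set \<Rightarrow> ('p \<times> 'a \<times> 'p) set \<Rightarrow> 'p \<Rightarrow> ('a, 'p) net" where
  "state_net A P E p = \<lparr>alphabet = A, places = P,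
     transitions = (\<lambda>(x, a, y). ({x}, Some a, {y})) ` E, initial = {p}\<rparr>"

lemma state_net_simps [simp]:
  "alphabet (state_net A P E p) = A" "places (state_net A P E p) = P"
  "transitions (state_net A P E p) = (\<lambda>(x, a, y). ({x}, Some a, {y})) ` E" "initial (state_net A P E p) = {p}"
  by (simp_all add: state_net_def)

lemma flow_state_net: "(x, y) \<in> flow (state_net A P E p) \<longleftrightarrow> (\<exists>a. (x, a, y) \<in> E)"
  by (force simp: flow_def)

lemma petri_state_net:
  assumes "finite A" "p \<in> P" "E \<subseteq> P \<times> A \<times> P"
  shows "petri_net (state_net A P E p)"
  using assms by (auto simp: petri_net_def nonempty_finite_subsets_def)

lemma reachable_state_net: "reachable (state_net A P E p) M \<Longrightarrow> \<exists>x. M = {x}"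
proof (induction rule: reachable.induct)
  case (step M t)
  then show ?case by (auto simp: enabled_def fire_def)
qed simp

lemma safe_state_net: "finite_safe_net (state_net A P E p)"
  if "finite A" "finite P" "p \<in> P" "E \<subseteq> P \<times> A \<times> P"
  unfolding finite_safe_net_def
proof (intro conjI)
  let ?N = "state_net A P E p"
  have "\<exists>x. M = {#x#}" if "token_reachable ?N M" for M
    using that
  proof (induction rule: token_reachable.induct)
    case (step M t)
    then show ?case by (auto simp: mset_subset_eq_single)
  qed simp
  then show "safe ?N" by (force simp: safe_def)
  show "contact_free ?N"
    unfolding contact_free_def
  proof (intro allI impI)
    fix M t assume "reachable ?N M" "t \<in> transitions ?N" "enabled t M"
    with reachable_state_net show "(M - pre t) \<inter> post t = {}" by (force simp: enabled_def)
  qed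
qed (use that petri_state_net in auto)

section \<open>Runs of state machines are chains\<close>

definition dead_end :: "('p \<times> 'a \<times> 'p) set \<Rightarrow> 'p \<Rightarrow> bool" where
  "dead_end E x \<longleftrightarrow> (\<forall>a y. (x, a, y) \<notin> E)"

text \<open>The length of a possibly infinite chain is \<^term>\<open>None\<close> if it is infinite.\<close>

fun within :: "nat option \<Rightarrow> nat \<Rightarrow> bool" where
  "within None i \<longleftrightarrow> True"
| "within (Some n) i \<longleftrightarrow> i < n"

definition chain :: "nat option \<Rightarrow> (nat \<Rightarrow> 'p) \<Rightarrow> (nat \<Rightarrow> 'a) \<Rightarrow> ('p \<times> 'a \<times> 'p) set" where
  "chain n e a = {(e i, a i, e (Suc i)) | i. within n i}"

text \<open>A state machine has a single token, and the map of a run is injective on reachable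
  markings, so these are singletons and the token traces one path. \<open>n\<close> is the first
  position without an outgoing transition, if there is one.\<close>

theorem maximal_run_chain:
  assumes run: "maximal_run (state_net A P E p) K f"
  shows "\<exists>n e a. K = state_net A (places K) (chain n e a) (e 0) \<and> f (e 0) = p \<and>
    (\<forall>i. within n i \<longrightarrow> (f (e i), a i, f (e (Suc i))) \<in> E) \<and>
    (\<forall>m. n = Some m \<longrightarrow> dead_end E (f (e m)))"
proof -
  let ?N = "state_net A P E p"
  have is_run: "is_run ?N K f" using run by (simp add: maximal_run_def)
  then have K: "causal_net K" and alph: "alphabet K = A" and ini: "f ` initial K = {p}"
    and inj: "\<And>M. reachable K M \<Longrightarrow> inj_on f M"
    and trans: "\<And>t. t \<in> transitions K \<Longrightarrow> (f ` pre t, act t, f ` post t) \<in> transitions ?N"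
    by (auto simp: is_run_def)
  have singleton: "\<exists>x. M = {x}" if "reachable K M" for M
  proof -
    from reachable_state_net[OF run_reachable[OF is_run that]] obtain y where y: "f ` M = {y}" by blast
    then obtain x where "x \<in> M" by blast
    moreover from this y inj[OF that] have "x' = x" if "x' \<in> M" for x'
      using that by (metis imageI inj_onD singletonD)
    ultimately show ?thesis by blast
  qed
  have edge: "\<exists>a y. t = ({x}, Some a, {y}) \<and> (f x, a, f y) \<in> E \<and> reachable K {y}"
    if x: "reachable K {x}" and t: "t \<in> transitions K" "enabled t {x}" for x t
  proof -
    have pre: "pre t = {x}"
      using t petri_netD(5)[OF causal_netD(1)[OF K] t(1)] by (auto simp: enabled_def)
    then have "reachable K (post t)" using reachable.step[OF x t] by (simp add: fire_def)
    moreover from this obtain y where y: "post t = {y}" using singleton by blast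
    ultimately have "reachable K {y}" by simp
    moreover from trans[OF t(1)] pre y have "\<exists>a. act t = Some a \<and> (f x, a, f y) \<in> E" by auto
    moreover have "t = (pre t, act t, post t)" by (cases t) simp
    ultimately show ?thesis using pre y by metis
  qed
  define out where "out x \<longleftrightarrow> (\<exists>a y. ({x}, Some a, {y}) \<in> transitions K)" for x
  define nxt where "nxt x = (SOME ay. ({x}, Some (fst ay), {snd ay}) \<in> transitions K)" for x
  obtain e0 where e0: "initial K = {e0}" using singleton reachable.initial by blast
  \<comment> \<open>Past the end of the chain \<open>nxt\<close> returns arbitrary values; the uses
    of \<open>e\<close> are guarded by \<open>within n\<close> or refer to the end itself.\<close>
  define e where "e = rec_nat e0 (\<lambda>_ x. snd (nxt x))"
  define a where "a i = fst (nxt (e i))" for i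
  have e: "e 0 = e0" "\<And>i. e (Suc i) = snd (nxt (e i))" by (simp_all add: e_def)
  have ch: "({e i}, Some (a i), {e (Suc i)}) \<in> transitions K" if "out (e i)" for i
    unfolding a_def e(2) nxt_def by (rule someI_ex) (use that in \<open>auto simp: out_def\<close>)
  obtain n where n: "\<And>i. within n i \<Longrightarrow> out (e i)" "\<And>m. n = Some m \<Longrightarrow> \<not> out (e m)"
  proof (cases "\<forall>i. out (e i)")
    case True
    then show ?thesis using that[of None] by simp
  next
    case False
    then obtain i where i: "\<not> out (e i)" by blast
    define m where "m = (LEAST i. \<not> out (e i))"
    have "\<not> out (e m)" unfolding m_def by (rule LeastI[of _ i]) (rule i)
    moreover have "out (e i)" if "i < m" for i
      using not_less_Least[of i "\<lambda>i. \<not> out (e i)"] that unfolding m_def by blast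
    ultimately show ?thesis using that[of "Some m"] by simp
  qed
  have within_Suc: "within n (Suc i) \<Longrightarrow> within n i" for i by (cases n) auto
  have reach: "reachable K {e i}" if "i = 0 \<or> within n (i - 1)" for i
    using that
  proof (induction i)
    case 0
    then show ?case using e0 e(1) reachable.initial[of K] by simp
  next
    case (Suc i)
    then have w: "within n i" by simp
    then have "i = 0 \<or> within n (i - 1)" using within_Suc by (cases i) auto
    then have "reachable K {e i}" by (rule Suc.IH)
    from edge[OF this ch[OF n(1)[OF w]]] show ?case by (auto simp: enabled_def)
  qed
  have ends: "dead_end E (f (e m)) \<and> (\<forall>y. (e m, y) \<notin> flow K)" if m: "n = Some m" for m
  proof -
    have r: "reachable K {e m}" by (rule reach) (use m in \<open>cases m; simp\<close>)
    have "\<not> enabled t {e m}" if "t \<in> transitions K" for t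
      using edge[OF r that] n(2)[OF m] that by (auto simp: out_def)
    then have fl: "\<forall>y. (e m, y) \<notin> flow K" using causal_deadlock(2)[OF K r] by blast
    have "reachable K {e m} \<Longrightarrow> e m \<in> places K"
    proof -
      have "M \<subseteq> places K" if "reachable K M" for M
        using that
      proof (induction rule: reachable.induct)
        case initial
        then show ?case using petri_net_initial(1)[OF causal_netD(1)[OF K]] .
      next
        case (step M t)
        then show ?case using petri_netD(2)[OF causal_netD(1)[OF K] step(2)] by (auto simp: fire_def)
      qed
      then show "reachable K {e m} \<Longrightarrow> e m \<in> places K" by blast
    qed
    with r run fl have "\<nexists>q. (f (e m), q) \<in> flow ?N" unfolding maximal_run_def by blast
    with fl show ?thesis unfolding dead_end_def flow_state_net by blast
  qed
  have out_of: "t = ({e i}, Some (a i), {e (Suc i)})" if "t \<in> transitions K" "e i \<in> pre t" "within n i" for t i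
    using causal_netD(5)[OF K that(1) ch[OF n(1)[OF that(3)]] that(2)] by simp
  \<comment> \<open>Nothing lies beside the path: by induction along the flow a place has a
    predecessor on the chain, and the only transition that leaves this predecessor is the one of the
    chain.\<close>
  have all: "q \<in> places K \<longrightarrow> (\<exists>i. q = e i \<and> (within n i \<or> n = Some i))" for q
    using causal_netD(2)[OF K]
  proof (induction q rule: wf_induct_rule)
    case (less q)
    show ?case
    proof
      assume q: "q \<in> places K"
      show "\<exists>i. q = e i \<and> (within n i \<or> n = Some i)"
      proof (cases "q \<in> initial K")
        case True
        then have "q = e 0" using e0 e(1) by simp
        then show ?thesis by (cases n) auto
      next
        case False
        with q obtain t where t: "t \<in> transitions K" "q \<in> post t"
          unfolding causal_netD(3)[OF K] place_pre_def by blast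
        note tP = petri_netD[OF causal_netD(1)[OF K] t(1)]
        obtain x where x: "x \<in> pre t" using tP(5) by blast
        then have fl: "(x, q) \<in> flow K" using t by (auto simp: flow_def)
        with less x tP(1) obtain i where i: "x = e i" "within n i \<or> n = Some i" by blast
        with ends fl have w: "within n i" by blast
        from out_of[OF t(1) _ w] x i(1) t(2) have "q = e (Suc i)" by simp
        moreover have "within n (Suc i) \<or> n = Some (Suc i)" using w by (cases n) auto
        ultimately show ?thesis by blast
      qed
    qed
  qed
  have "transitions K = (\<lambda>(x, a, y). ({x}, Some a, {y})) ` chain n e a"
  proof (intro equalityI subsetI)
    fix t assume t: "t \<in> transitions K"
    note tP = petri_netD[OF causal_netD(1)[OF K] t]
    obtain x where x: "x \<in> pre t" "x \<in> places K" using tP(1,5) by blast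
    obtain y where "y \<in> post t" using tP(6) by blast
    with x t have fl: "(x, y) \<in> flow K" by (auto simp: flow_def)
    obtain i where i: "x = e i" "within n i \<or> n = Some i" using all x(2) by blast
    with ends fl have w: "within n i" by blast
    from out_of[OF t _ w] x i have "t = ({e i}, Some (a i), {e (Suc i)})" by simp
    with w show "t \<in> (\<lambda>(x, a, y). ({x}, Some a, {y})) ` chain n e a"
      by (force simp: chain_def)
  next
    fix t assume "t \<in> (\<lambda>(x, a, y). ({x}, Some a, {y})) ` chain n e a"
    then show "t \<in> transitions K" using ch n(1) by (auto simp: chain_def)
  qed
  then have "K = state_net A (places K) (chain n e a) (e 0)"
    using alph e0 e(1) by (simp add: state_net_def)
  moreover have "f (e 0) = p" using ini e0 e(1) by simp
  moreover have "(f (e i), a i, f (e (Suc i))) \<in> E" if "within n i" for i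
    using trans[OF ch[OF n(1)[OF that]]] by auto
  ultimately show ?thesis using ends by blast
qed

section \<open>Words as runs of a state machine\<close>

lemma path_states:
  "path E p w x \<Longrightarrow> \<exists>s. s 0 = p \<and> s (length w) = x \<and> (\<forall>i<length w. (s i, w ! i, s (Suc i)) \<in> E)"
proof (induction rule: path.induct)
  case (path_Nil u)
  then show ?case by (intro exI[of _ "\<lambda>_. u"]) simp
next
  case (path_Cons u a v w x)
  then obtain s where "s 0 = v" "s (length w) = x" "\<forall>i<length w. (s i, w ! i, s (Suc i)) \<in> E" by blast
  with path_Cons(1) show ?case
    by (intro exI[of _ "case_nat u s"]) (auto simp: nth_Cons split: nat.split)
qed

lemma states_path:
  "(\<And>i. i < n \<Longrightarrow> (s i, a i, s (Suc i)) \<in> E) \<Longrightarrow> path E (s 0) (map a [0..<n]) (s n)"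
  by (induction n) (auto intro: path.intros path_append path_single)

abbreviation word_edges :: "'a list \<Rightarrow> (nat \<times> 'a \<times> nat) set" where
  "word_edges w \<equiv> {(i, w ! i, Suc i) | i. i < length w}"

abbreviation word_net :: "'a set \<Rightarrow> 'a list \<Rightarrow> ('a, nat) net" where
  "word_net A w \<equiv> state_net A {..length w} (word_edges w) 0"

lemma word_net_causal:
  assumes "finite A" "set w \<subseteq> A"
  shows "causal_net (word_net A w)"
  unfolding causal_net_def
proof (intro conjI ballI)
  let ?K = "word_net A w"
  show "petri_net ?K"
    by (rule petri_state_net) (use assms in auto)
  have pre: "finite (place_pre ?K p) \<and> card (place_pre ?K p) \<le> 1" for p
    by (rule at_most_one) (auto simp: place_pre_def)
  have post: "finite (place_post ?K p) \<and> card (place_post ?K p) \<le> 1" for p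
    by (rule at_most_one) (auto simp: place_post_def)
  show "finite (place_pre ?K p)" "card (place_pre ?K p) \<le> 1"
    "finite (place_post ?K p)" "card (place_post ?K p) \<le> 1" for p
    using pre post by blast+
  show "wf (flow ?K)"
    by (rule wf_subset[OF wf_measure[of id]]) (auto simp: flow_state_net)
  show "initial ?K = {p \<in> places ?K. place_pre ?K p = {}}"
  proof (intro set_eqI iffI)
    fix p assume "p \<in> initial ?K"
    then show "p \<in> {p \<in> places ?K. place_pre ?K p = {}}" by (auto simp: place_pre_def)
  next
    fix p assume p: "p \<in> {p \<in> places ?K. place_pre ?K p = {}}"
    show "p \<in> initial ?K"
    proof (cases p)
      case (Suc i)
      with p have "({i}, Some (w ! i), {p}) \<in> place_pre ?K p" by (force simp: place_pre_def)
      with p show ?thesis by blast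
    qed simp
  qed
qed

theorem word_net_maximal_run:
  assumes "finite A" "E \<subseteq> P \<times> A \<times> P" "p \<in> P" "path E p w x" "dead_end E x"
  shows "\<exists>f. maximal_run (state_net A P E p) (word_net A w) f"
proof -
  obtain s where s: "s 0 = p" "s (length w) = x" "\<And>i. i < length w \<Longrightarrow> (s i, w ! i, s (Suc i)) \<in> E"
    using path_states[OF assms(4)] by blast
  have w: "set w \<subseteq> A" using s(3) assms(2) by (fastforce simp: set_conv_nth)
  have P: "s i \<in> P" if "i \<le> length w" for i
  proof (cases i)
    case (Suc j)
    with that s(3)[of j] assms(2) show ?thesis by auto
  qed (use s assms in simp)
  have "is_run (state_net A P E p) (word_net A w) s"
    unfolding is_run_def
  proof (intro conjI allI impI ballI)
    show "inj_on s M" if "reachable (word_net A w) M" for M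
      using reachable_state_net[OF that] by auto
    show "(s ` pre t, act t, s ` post t) \<in> transitions (state_net A P E p)"
      if "t \<in> transitions (word_net A w)" for t
      using that s(3) by force
  qed (use assms w P s word_net_causal in auto)
  moreover have "\<exists>j. (i, j) \<in> flow (word_net A w)" if "i \<le> length w" "(s i, q) \<in> flow (state_net A P E p)" for i q
  proof (cases "i = length w")
    case True
    then show ?thesis using that(2) s(2) assms(5) by (auto simp: flow_state_net dead_end_def)
  next
    case False
    with that(1) show ?thesis by (auto simp: flow_state_net)
  qed
  ultimately show ?thesis unfolding maximal_run_def by force
qed

section \<open>The test net and its two maximal runs\<close>

text \<open>Original and primed letters are disjoint, so the two nets have nothing to synchronize on
  and their transitions are merely put side by side.\<close>

lemma par_state_nets:
  fixes E :: "('p \<times> 'a \<times> 'p) set" and E' :: "('q \<times> 'a \<times> 'q) set"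
  shows "relabel Inl (state_net A P E p) \<parallel> relabel Inr (state_net A P' E' p') =
    \<lparr>alphabet = Inl ` A \<union> Inr ` A, places = P <+> P',
     transitions = (\<lambda>(x, a, y). ({Inl x}, Some (Inl a), {Inl y})) ` E \<union>
       (\<lambda>(x, a, y). ({Inr x}, Some (Inr a), {Inr y})) ` E',
     initial = {Inl p, Inr p'}\<rparr>"
proof -
  have disj: "(Inl ` A :: ('a + 'a) set) \<inter> Inr ` A = {}" by auto
  have ini: "{p} <+> {p'} = {Inl p, Inr p'}" by auto
  have left: "{((Inl :: 'p \<Rightarrow> 'p + 'q) ` I, u, (Inl :: 'p \<Rightarrow> 'p + 'q) ` J) | I u J.
        (I, u, J) \<in> (\<lambda>(x, a, y). ({x}, Some (Inl a :: 'a + 'a), {y})) ` E} =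
      (\<lambda>(x, a, y). ({Inl x}, Some (Inl a), {Inl y})) ` E"
    by (force simp: image_iff)
  have right: "{((Inr :: 'q \<Rightarrow> 'p + 'q) ` I, u, (Inr :: 'q \<Rightarrow> 'p + 'q) ` J) | I u J.
        (I, u, J) \<in> (\<lambda>(x, a, y). ({x}, Some (Inr a :: 'a + 'a), {y})) ` E'} =
      (\<lambda>(x, a, y). ({Inr x}, Some (Inr a), {Inr y})) ` E'"
    by (force simp: image_iff)
  show ?thesis
    unfolding par_def relabel_def state_net_def
    using left right by (simp add: disj ini image_image split_beta)
qed

text \<open>\<open>rank\<close> bounds the internal steps: they lower it and letters never raise it,
  so on finite tapes every firing sequence past the initial choice stops. The edges avoid the frame
  states, and none leaves \<open>fin\<close>.\<close>

locale tester =
  fixes B :: "'a set" and Q :: "nat set" and E :: "(nat \<times> ('a + 'a) option \<times> nat) set"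
    and init start idle never junk1 junk2 fin loop :: nat and z :: 'a and rank :: "nat \<Rightarrow> nat"
  assumes finite: "finite B" "finite Q" and z: "z \<in> B"
    and distinct: "distinct [init, start, idle, never, junk1, junk2, fin, loop]"
    and states: "{init, start, idle, never, junk1, junk2, fin, loop} \<subseteq> Q"
    and edge: "\<And>q u q'. (q, u, q') \<in> E \<Longrightarrow> q \<in> Q \<and> q' \<in> Q \<and> q \<notin> {init, idle, never, junk1, junk2, fin} \<and>
      q' \<notin> {init, idle, never, junk1, junk2}"
    and label: "\<And>q u q'. (q, Some u, q') \<in> E \<Longrightarrow> u \<in> Inl ` (B - {z}) \<union> Inr ` (B - {z})"
    and rank_tau: "\<And>q q'. (q, None, q') \<in> E \<Longrightarrow> rank q' < rank q"
    and rank_label: "\<And>q u q'. (q, Some u, q') \<in> E \<Longrightarrow> rank q' \<le> rank q"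
    and start_loop: "(start, None, loop) \<in> E"
    and loop: "\<And>a. a \<in> B - {z} \<Longrightarrow> (loop, Some (Inl a), loop) \<in> E \<and> (loop, Some (Inr a), loop) \<in> E"
begin

text \<open>
  The action \<open>z\<close> belongs to the alphabet of the tested nets but labels none of their transitions, so
  that \<open>idle\<close> is a final place of every composition. In the test alone \<open>idle\<close> would have to move but
  never can, so that its only maximal runs are the two junk transitions.
\<close>

definition test :: "('a + 'a, nat) test" where
  "test = \<lparr>alphabet = Inl ` B \<union> Inr ` B, places = Q,
     transitions = (\<lambda>(q, u, q'). ({q}, u, {q'})) ` E \<union>
       {({init}, None, {start, idle}), ({init}, None, {junk1}), ({init}, None, {junk2}),
        ({idle, never}, Some (Inl z), {never})},
     initial = {init}, success = {fin, idle}\<rparr>"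

lemma test_simps [simp]:
  "alphabet test = Inl ` B \<union> Inr ` B" "places test = Q" "initial test = {init}" "success test = {fin, idle}"
  by (simp_all add: test_def)

lemma test_transition_cases:
  assumes "t \<in> transitions test"
  obtains (edge) q u q' where "(q, u, q') \<in> E" "t = ({q}, u, {q'})"
    | (split) "t = ({init}, None, {start, idle})"
    | (junk) j where "j \<in> {junk1, junk2}" "t = ({init}, None, {j})"
    | (dead) "t = ({idle, never}, Some (Inl z), {never})"
  using assms by (auto simp: test_def)

lemma neq: "init \<noteq> start" "init \<noteq> idle" "init \<noteq> never" "init \<noteq> junk1" "init \<noteq> junk2" "init \<noteq> fin" "init \<noteq> loop"
  "start \<noteq> idle" "start \<noteq> never" "start \<noteq> junk1" "start \<noteq> junk2" "idle \<noteq> never" "idle \<noteq> junk1" "idle \<noteq> junk2"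
  "never \<noteq> junk1" "never \<noteq> junk2" "junk1 \<noteq> junk2" "fin \<noteq> idle" "fin \<noteq> junk1" "fin \<noteq> junk2" "fin \<noteq> never"
  "loop \<noteq> idle" "loop \<noteq> never" "loop \<noteq> junk1" "loop \<noteq> junk2" "loop \<noteq> start" "start \<noteq> fin"
  using distinct by auto

definition live :: "nat \<Rightarrow> bool" where
  "live q \<longleftrightarrow> q \<notin> {init, idle, never, junk1, junk2}"

lemma live_simps [simp]: "live start" "live loop" "live fin"
  using neq by (auto simp: live_def)

lemma edge_live: "(q, u, q') \<in> E \<Longrightarrow> live q \<and> live q'"
  using edge[of q u q'] by (auto simp: live_def)

lemma petri_test: "petri_net test"
  unfolding petri_net_def
proof (intro conjI subsetI)
  fix t assume "t \<in> transitions test"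
  then show "t \<in> nonempty_finite_subsets (places test) \<times> insert None (Some ` alphabet test) \<times>
      nonempty_finite_subsets (places test)"
  proof (cases rule: test_transition_cases)
    case (edge q u q')
    moreover have "u \<in> insert None (Some ` alphabet test)"
      using edge(1) label[of q "the u" q'] by (cases u) auto
    ultimately show ?thesis
      using tester.edge[OF tester_axioms edge(1)] by (simp add: nonempty_finite_subsets_def)
  qed (use states z in \<open>auto simp: nonempty_finite_subsets_def\<close>)
qed (use finite states in \<open>auto simp: nonempty_finite_subsets_def\<close>)

lemma test_reachable:
  "reachable test M \<Longrightarrow> M = {init} \<or> (\<exists>q. live q \<and> M = {q, idle}) \<or> M = {junk1} \<or> M = {junk2}"
proof (induction rule: reachable.induct)
  case initial
  show ?case by simp
next
  case (step M t)
  from step(2) show ?case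
  proof (cases rule: test_transition_cases)
    case (edge q u q')
    with step edge_live[OF edge(1)] show ?thesis by (auto simp: enabled_def fire_def live_def)
  next
    case split
    with step neq show ?thesis by (auto simp: enabled_def fire_def live_def)
  next
    case (junk j)
    with step neq show ?thesis by (auto simp: enabled_def fire_def live_def)
  next
    case dead
    with step neq show ?thesis by (auto simp: enabled_def fire_def live_def)
  qed
qed

lemma test_contact_free: "contact_free test"
  unfolding contact_free_def
proof (intro allI impI)
  fix M t assume M: "reachable test M" and t: "t \<in> transitions test" "enabled t M"
  from t(1) test_reachable[OF M] t(2) show "(M - pre t) \<inter> post t = {}"
  proof (cases rule: test_transition_cases)
    case (edge q u q')
    with test_reachable[OF M] t(2) edge_live[OF edge(1)] show ?thesis by (auto simp: enabled_def live_def)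
  next
    case split
    with test_reachable[OF M] t(2) neq show ?thesis by (auto simp: enabled_def live_def)
  next
    case (junk j)
    with test_reachable[OF M] t(2) neq show ?thesis by (auto simp: enabled_def live_def)
  next
    case dead
    with test_reachable[OF M] t(2) neq show ?thesis by (auto simp: enabled_def live_def)
  qed
qed

lemma test_token_reachable:
  "token_reachable test M \<Longrightarrow> M = {#init#} \<or> (\<exists>q. live q \<and> M = {#q, idle#}) \<or> M = {#junk1#} \<or> M = {#junk2#}"
proof (induction rule: token_reachable.induct)
  case initial
  show ?case by simp
next
  case (step M t)
  have sub: "x \<in># M" if "x \<in> pre t" for x
    using step(3) that petri_netD(3)[OF petri_test step(2)] by (metis elem_mset_set mset_subset_eqD)
  from step(2) show ?case
  proof (cases rule: test_transition_cases)
    case (edge q u q')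
    with step sub[of q] edge_live[OF edge(1)] show ?thesis
      by (auto simp: live_def)
  next
    case split
    with step sub[of init] neq show ?thesis by (auto simp: live_def)
  next
    case (junk j)
    with step sub[of init] neq show ?thesis by (auto simp: live_def)
  next
    case dead
    with step sub[of never] sub[of idle] neq show ?thesis by (auto simp: live_def)
  qed
qed

lemma is_test: "is_test test"
proof -
  have "safe test"
    unfolding safe_def
  proof (intro allI impI)
    fix M p assume "token_reachable test M"
    from test_token_reachable[OF this] show "count M p \<le> 1" by (auto simp: live_def)
  qed
  then show ?thesis
    using petri_test test_contact_free finite states by (auto simp: is_test_def finite_safe_net_def)
qed

section \<open>The maximal runs of the test alone\<close>

definition junk_run :: "('a + 'a, nat) net" where
  "junk_run = \<lparr>alphabet = Inl ` B \<union> Inr ` B, places = {0, 1}, transitions = {({0}, None, {1})}, initial = {0}\<rparr>"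

definition junk_map :: "nat \<Rightarrow> nat \<Rightarrow> nat" where
  "junk_map j i = (if i = 0 then init else j)"

lemma junk_run_maximal:
  assumes j: "j \<in> {junk1, junk2}"
  shows "maximal_run test junk_run (junk_map j)"
proof -
  have reach: "M = {0} \<or> M = {1}" if "reachable junk_run M" for M
    using that by (induction rule: reachable.induct) (auto simp: junk_run_def enabled_def fire_def)
  have pre: "place_pre junk_run p = (if p = 1 then {({0}, None, {1})} else {})"
    and post: "place_post junk_run p = (if p = 0 then {({0}, None, {1})} else {})" for p
    by (auto simp: place_pre_def place_post_def junk_run_def)
  have flow: "flow junk_run = {(0, 1)}" by (auto simp: flow_def junk_run_def)
  have causal: "causal_net junk_run"
    unfolding causal_net_def pre post flow
  proof (intro conjI ballI)
    show "petri_net junk_run"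
      using finite by (auto simp: petri_net_def nonempty_finite_subsets_def junk_run_def)
    show "wf {(0, 1 :: nat)}"
      by (rule wf_subset[OF wf_measure[of id]]) auto
  qed (auto simp: junk_run_def)
  have "is_run test junk_run (junk_map j)"
    unfolding is_run_def
  proof (intro conjI allI impI ballI causal)
    show "inj_on (junk_map j) M" if "reachable junk_run M" for M using reach[OF that] by auto
    show "(junk_map j ` pre t, act t, junk_map j ` post t) \<in> transitions test"
      if "t \<in> transitions junk_run" for t
      using that j by (auto simp: junk_run_def junk_map_def test_def)
  qed (use j states in \<open>auto simp: junk_run_def junk_map_def\<close>)
  moreover have "(j, q) \<notin> flow test" for q
    using j neq by (auto simp: flow_def elim!: test_transition_cases dest: edge)
  ultimately show ?thesis
    unfolding maximal_run_def flow by (auto simp: junk_run_def junk_map_def)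
qed

text \<open>\<open>never\<close> is produced only from \<open>never\<close>, so by induction along
  the flow no place of a run is mapped to it. A place mapped to \<open>idle\<close> would have to be
  followed by the transition that also consumes \<open>never\<close>, so there is none either. The
  split is thus excluded, and maximality at \<open>init\<close> leaves only the two junk
  transitions, after which nothing can happen.\<close>

lemma maximal_run_test:
  assumes run: "maximal_run test K f"
  shows "\<exists>j\<in>{junk1, junk2}. run_iso K f junk_run (junk_map j)"
proof -
  have is_run: "is_run test K f" using run by (simp add: maximal_run_def)
  then have K: "causal_net K" and alph: "alphabet K = Inl ` B \<union> Inr ` B" and ini: "f ` initial K = {init}"
    and inj: "\<And>M. reachable K M \<Longrightarrow> inj_on f M"
    and trans: "\<And>t. t \<in> transitions K \<Longrightarrow> (f ` pre t, act t, f ` post t) \<in> transitions test"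
    by (auto simp: is_run_def)
  note P = petri_netD[OF causal_netD(1)[OF K]]
  note I = petri_net_initial[OF causal_netD(1)[OF K]]
  obtain a where a: "a \<in> initial K" "f a = init"
    using ini by (metis imageE insertCI)
  have "x = a" if "x \<in> initial K" for x
    using inj[OF reachable.initial] that a ini by (metis imageI inj_onD singletonD)
  then have initial: "initial K = {a}" using a by blast
  have source: "x = a" if x: "x \<in> places K" "f x = init" for x
  proof (rule ccontr)
    assume "x \<noteq> a"
    with x obtain t where t: "t \<in> transitions K" "x \<in> post t"
      using initial unfolding causal_netD(3)[OF K] place_pre_def by blast
    have fx: "f x \<in> f ` post t" using t(2) by blast
    from trans[OF t(1)] show False
    proof (cases rule: test_transition_cases)
      case (edge q u q')
      with fx x(2) tester.edge[OF tester_axioms edge(1)] show ?thesis by auto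
    qed (use fx x(2) neq in auto)
  qed
  have no_never: "f x \<noteq> never" if "x \<in> places K" for x
    using that
  proof (induction x rule: wf_induct_rule[OF causal_netD(2)[OF K]])
    case (1 x)
    show ?case
    proof (cases "x \<in> initial K")
      case True
      then show ?thesis using initial a neq by auto
    next
      case False
      with 1(2) obtain t where t: "t \<in> transitions K" "x \<in> post t"
        unfolding causal_netD(3)[OF K] place_pre_def by blast
      have "never \<notin> f ` pre t"
        using 1(1) t P(1)[OF t(1)] by (force simp: flow_def)
      moreover have fx: "f x \<in> f ` post t" using t(2) by blast
      ultimately show ?thesis
        using trans[OF t(1)] neq edge_live
        by (elim test_transition_cases) (auto simp: live_def)
    qed
  qed
  have no_idle: "f x \<noteq> idle" if x: "x \<in> places K" for x
  proof
    assume fx: "f x = idle"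
    have "({idle, never}, Some (Inl z), {never}) \<in> transitions test" by (simp add: test_def)
    then have "(f x, never) \<in> flow test" unfolding fx by (force simp: flow_def)
    then obtain y where "(x, y) \<in> flow K" using run x unfolding maximal_run_def by blast
    then obtain t where t: "t \<in> transitions K" "x \<in> pre t" unfolding flow_def by blast
    then have "idle \<in> f ` pre t" using fx by (metis imageI)
    with trans[OF t(1)] have "never \<in> f ` pre t"
    proof (cases rule: test_transition_cases)
      case (edge q u q')
      with \<open>idle \<in> f ` pre t\<close> tester.edge[OF tester_axioms edge(1)] show ?thesis by auto
    qed (use neq in auto)
    with no_never P(1)[OF t(1)] show False by blast
  qed
  have "({init}, None, {junk1}) \<in> transitions test" by (simp add: test_def)
  then have "(init, junk1) \<in> flow test" by (force simp: flow_def)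
  then obtain y where "(a, y) \<in> flow K"
    using run a I(1) unfolding maximal_run_def by blast
  then obtain t where t: "t \<in> transitions K" "a \<in> pre t" unfolding flow_def by blast
  have fa: "init \<in> f ` pre t" using t(2) a(2) by (metis imageI)
  from trans[OF t(1)] obtain j where j: "j \<in> {junk1, junk2}" "f ` pre t = {init}" "act t = None" "f ` post t = {j}"
  proof (cases rule: test_transition_cases)
    case (edge q u q')
    then show ?thesis using fa tester.edge[OF tester_axioms edge(1)] by auto
  next
    case split
    then have "idle \<in> f ` post t" by auto
    then show ?thesis using no_idle P(2)[OF t(1)] by auto
  next
    case (junk j)
    then show ?thesis using that by simp
  next
    case dead
    then show ?thesis using fa neq by auto
  qed
  have "x = a" if "x \<in> pre t" for x
    by (rule source) (use that P(1)[OF t(1)] j(2) in auto)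
  with t(2) have pre: "pre t = {a}" by blast
  have "reachable K (fire t (initial K))"
    by (rule reachable.step[OF reachable.initial t(1)]) (simp add: enabled_def pre initial)
  moreover have "fire t (initial K) = post t" by (simp add: fire_def pre initial)
  ultimately have "inj_on f (post t)" using inj by simp
  with j(4) obtain c where c: "post t = {c}" "f c = j"
  proof -
    obtain c where "c \<in> post t" using P(6)[OF t(1)] by blast
    moreover have "f x = j" if "x \<in> post t" for x using j(4) that by blast
    ultimately have "post t = {c}" "f c = j"
      using \<open>inj_on f (post t)\<close> by (auto simp: inj_on_def)
    with that show thesis .
  qed
  have c_end: "c \<notin> pre s" if "s \<in> transitions K" for s
  proof
    assume "c \<in> pre s"
    then have "j \<in> f ` pre s" using c(2) by blast
    from trans[OF that] this j(1) neq show False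
      by (cases rule: test_transition_cases) (auto dest: edge)
  qed
  have fired: "s = t" if "s \<in> transitions K" "pre s \<inter> {a, c} \<noteq> {}" for s
    using that c_end[OF that(1)] causal_netD(5)[OF K that(1) t(1)] pre by auto
  have places: "x \<in> {a, c}" if "x \<in> places K" for x
    using that
  proof (induction x rule: wf_induct_rule[OF causal_netD(2)[OF K]])
    case (1 x)
    show ?case
    proof (cases "x \<in> initial K")
      case True
      then show ?thesis using initial by auto
    next
      case False
      with 1(2) obtain s where s: "s \<in> transitions K" "x \<in> post s"
        unfolding causal_netD(3)[OF K] place_pre_def by blast
      obtain y where y: "y \<in> pre s" using P(5)[OF s(1)] by blast
      then have "(y, x) \<in> flow K" "y \<in> places K" using s P(1)[OF s(1)] by (auto simp: flow_def)
      then have "y \<in> {a, c}" by (rule 1(1))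
      with y fired[OF s(1)] s(2) c show ?thesis by auto
    qed
  qed
  have places: "places K = {a, c}"
    using places I(1) initial P(2)[OF t(1)] c by blast
  have "s = t" if s: "s \<in> transitions K" for s
    by (rule fired[OF s]) (use P(1,5)[OF s] places in blast)
  with t(1) have "transitions K = {t}" by blast
  moreover have "t = ({a}, None, {c})"
    using pre j(3) c(1) by (cases t) auto
  ultimately have K_trans: "transitions K = {({a}, None, {c})}" by simp
  have dist: "a \<noteq> c" using a c(2) j(1) neq by auto
  let ?h = "\<lambda>x. if x = a then 0 else (1 :: nat)"
  have "run_iso K f junk_run (junk_map j)"
    unfolding run_iso_def
  proof (intro conjI exI[of _ ?h])
    show "bij_betw ?h (places K) (places junk_run)"
      using dist by (auto simp: bij_betw_def inj_on_def places junk_run_def)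
  qed (use dist a c alph in \<open>auto simp: places initial K_trans junk_run_def junk_map_def\<close>)
  with j(1) show ?thesis by blast
qed

lemma two_maximal_runs_test: "two_maximal_runs test"
proof -
  have "\<not> run_iso junk_run (junk_map junk1) junk_run (junk_map junk2)"
  proof
    assume "run_iso junk_run (junk_map junk1) junk_run (junk_map junk2)"
    then obtain h where "\<forall>p\<in>places junk_run. junk_map junk2 (h p) = junk_map junk1 p"
      unfolding run_iso_def by blast
    then have "junk_map junk2 (h 1) = junk1" by (auto simp: junk_run_def junk_map_def)
    then show False using neq by (auto simp: junk_map_def split: if_splits)
  qed
  with junk_run_maximal maximal_run_test show ?thesis
    unfolding two_maximal_runs_def by blast
qed

end

section \<open>Two state machines composed with the test\<close>

text \<open>Every letter on a tape lies in \<open>B - {z}\<close> and must synchronize, so a tape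
  moves only when the test reads it. \<open>A\<close> may be larger than \<open>B\<close>, which
  leaves freedom to choose an alphabet whose code is simple.\<close>

locale composition = tester +
  fixes A :: "'a set" and P P' :: "nat set" and E1 E2 :: "(nat \<times> 'a \<times> nat) set" and p p' :: nat
  assumes A: "finite A" "B \<subseteq> A" and p: "p \<in> P" "p' \<in> P'"
    and E1: "E1 \<subseteq> P \<times> (B - {z}) \<times> P" and E2: "E2 \<subseteq> P' \<times> (B - {z}) \<times> P'"
begin

definition system :: "('a + 'a, (nat + nat) + nat) net" where
  "system = (relabel Inl (state_net A P E1 p) \<parallel> relabel Inr (state_net A P' E2 p')) \<parallel> test"

definition left :: "nat \<Rightarrow> 'a \<Rightarrow> nat \<Rightarrow> nat \<Rightarrow> nat \<Rightarrow> ('a + 'a, (nat + nat) + nat) transition" where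
  "left x a y q q' = ({Inl (Inl x), Inr q}, Some (Inl a), {Inl (Inl y), Inr q'})"

definition right :: "nat \<Rightarrow> 'a \<Rightarrow> nat \<Rightarrow> nat \<Rightarrow> nat \<Rightarrow> ('a + 'a, (nat + nat) + nat) transition" where
  "right x a y q q' = ({Inl (Inr x), Inr q}, Some (Inr a), {Inl (Inr y), Inr q'})"

definition tau :: "nat \<Rightarrow> nat \<Rightarrow> ('a + 'a, (nat + nat) + nat) transition" where
  "tau q q' = ({Inr q}, None, {Inr q'})"

definition junk :: "nat \<Rightarrow> ('a + 'a, (nat + nat) + nat) transition" where
  "junk j = ({Inr init}, None, {Inr j})"

definition split :: "('a + 'a, (nat + nat) + nat) transition" where
  "split = ({Inr init}, None, {Inr start, Inr idle})"

lemmas system_eq = system_def[unfolded par_state_nets]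

lemma system_simps [simp]:
  "alphabet system = Inl ` A \<union> Inr ` A" "places system = (P <+> P') <+> Q"
  "initial system = {Inl (Inl p), Inl (Inr p'), Inr init}"
  unfolding system_eq par_def using A by auto

lemma sync: "(Inl ` A \<union> Inr ` A) \<inter> (Inl ` B \<union> Inr ` B) = Inl ` B \<union> Inr ` B"
  using A by auto

definition tape_steps :: "('a + 'a, nat + nat) transition set" where
  "tape_steps = (\<lambda>(x, a, y). ({Inl x}, Some (Inl a), {Inl y})) ` E1 \<union>
     (\<lambda>(x, a, y). ({Inr x}, Some (Inr a), {Inr y})) ` E2"

lemma system_transitions_eq:
  "transitions system =
    {(Inl ` I, u, Inl ` J) | I u J. (I, u, J) \<in> tape_steps \<and> u \<notin> Some ` alphabet test} \<union>
    {(Inr ` I, u, Inr ` J) | I u J. (I, u, J) \<in> transitions test \<and> u \<notin> Some ` alphabet test} \<union>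
    {(I1 <+> I2, Some a, J1 <+> J2) | I1 I2 a J1 J2. a \<in> alphabet test \<and>
       (I1, Some a, J1) \<in> tape_steps \<and> (I2, Some a, J2) \<in> transitions test}"
  unfolding system_eq par_def tape_steps_def by (simp add: sync)

lemma system_transition_cases:
  assumes "t \<in> transitions system"
  obtains (left) x a y q q' where "(x, a, y) \<in> E1" "(q, Some (Inl a), q') \<in> E" "t = left x a y q q'"
    | (right) x a y q q' where "(x, a, y) \<in> E2" "(q, Some (Inr a), q') \<in> E" "t = right x a y q q'"
    | (tau) q q' where "(q, None, q') \<in> E" "t = tau q q'"
    | (split) "t = split"
    | (junk) j where "j \<in> {junk1, junk2}" "t = junk j"
proof -
  have S: "(\<exists>x a y. (x, a, y) \<in> E1 \<and> a \<in> B - {z} \<and> I = {Inl x} \<and> u = Some (Inl a) \<and> J = {Inl y}) \<or>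
      (\<exists>x a y. (x, a, y) \<in> E2 \<and> a \<in> B - {z} \<and> I = {Inr x} \<and> u = Some (Inr a) \<and> J = {Inr y})"
    if "(I, u, J) \<in> tape_steps" for I u J
    using that E1 E2 by (auto simp: tape_steps_def)
  from assms[unfolded system_transitions_eq Un_iff mem_Collect_eq] show thesis
  proof (elim disjE exE conjE)
    fix I u J assume "(I, u, J) \<in> tape_steps" "u \<notin> Some ` alphabet test"
    then show thesis using S[of I u J] by auto
  next
    fix I u J assume *: "t = (Inr ` I, u, Inr ` J)" "(I, u, J) \<in> transitions test"
      "u \<notin> Some ` alphabet test"
    from *(2) show thesis
    proof (cases rule: test_transition_cases)
      case (edge q v q')
      with * label[of q "the v" q'] have "v = None" by (cases v) auto
      with edge *(1) show thesis by (intro that(3)[of q q']) (auto simp: tau_def)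
    next
      case split
      with *(1) show thesis by (intro that(4)) (auto simp: split_def)
    next
      case (junk j)
      with *(1) show thesis by (intro that(5)[of j]) (auto simp: junk_def)
    next
      case dead
      with *(3) z show thesis by auto
    qed
  next
    fix I1 I2 a J1 J2
    assume *: "t = (I1 <+> I2, Some a, J1 <+> J2)" "(I1, Some a, J1) \<in> tape_steps" "(I2, Some a, J2) \<in> transitions test"
    from *(3) show thesis
    proof (cases rule: test_transition_cases)
      case (edge q v q')
      from S[OF *(2)] show thesis
      proof (elim disjE exE conjE)
        fix x b y assume "(x, b, y) \<in> E1" "I1 = {Inl x}" "Some a = Some (Inl b)" "J1 = {Inl y}"
        with edge *(1) show thesis by (intro that(1)[of x b y q q']) (auto simp: left_def Plus_def)
      next
        fix x b y assume "(x, b, y) \<in> E2" "I1 = {Inr x}" "Some a = Some (Inr b)" "J1 = {Inr y}"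
        with edge *(1) show thesis by (intro that(2)[of x b y q q']) (auto simp: right_def Plus_def)
      qed
    next
      \<comment> \<open>This transition would have to synchronize on \<open>z\<close>, and no tape
        offers it.\<close>
      case dead
      with S[OF *(2)] show thesis by auto
    qed simp_all
  qed
qed

lemma left_transition:
  assumes "(x, a, y) \<in> E1" "(q, Some (Inl a), q') \<in> E"
  shows "left x a y q q' \<in> transitions system"
proof -
  have "({q}, Some (Inl a), {q'}) \<in> transitions test" using assms(2) by (force simp: test_def)
  moreover have "Inl a \<in> alphabet test" using assms(1) E1 by auto
  moreover have "left x a y q q' = ({Inl x} <+> {q}, Some (Inl a), {Inl y} <+> {q'})"
    by (auto simp: left_def Plus_def)
  moreover have "({Inl x}, Some (Inl a), {Inl y}) \<in> tape_steps"
    using assms(1) by (force simp: tape_steps_def)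
  ultimately show ?thesis unfolding system_transitions_eq Un_iff mem_Collect_eq by blast
qed

lemma right_transition:
  assumes "(x, a, y) \<in> E2" "(q, Some (Inr a), q') \<in> E"
  shows "right x a y q q' \<in> transitions system"
proof -
  have "({q}, Some (Inr a), {q'}) \<in> transitions test" using assms(2) by (force simp: test_def)
  moreover have "Inr a \<in> alphabet test" using assms(1) E2 by auto
  moreover have "right x a y q q' = ({Inr x} <+> {q}, Some (Inr a), {Inr y} <+> {q'})"
    by (auto simp: right_def Plus_def)
  moreover have "({Inr x}, Some (Inr a), {Inr y}) \<in> tape_steps"
    using assms(1) by (force simp: tape_steps_def)
  ultimately show ?thesis unfolding system_transitions_eq Un_iff mem_Collect_eq by blast
qed

lemma tau_transition:
  assumes "(q, None, q') \<in> E"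
  shows "tau q q' \<in> transitions system"
proof -
  have "({q}, None, {q'}) \<in> transitions test" using assms by (force simp: test_def)
  moreover have "tau q q' = (Inr ` {q}, None, Inr ` {q'})" by (simp add: tau_def)
  ultimately show ?thesis unfolding system_transitions_eq by blast
qed

lemma split_transition: "split \<in> transitions system"
proof -
  have "({init}, None, {start, idle}) \<in> transitions test" by (simp add: test_def)
  moreover have "split = (Inr ` {init}, None, Inr ` {start, idle})" by (simp add: split_def)
  ultimately show ?thesis unfolding system_transitions_eq by blast
qed

section \<open>Markings of the composed system\<close>

definition mark :: "nat \<Rightarrow> nat \<Rightarrow> nat \<Rightarrow> ((nat + nat) + nat) set" where
  "mark x y q = {Inl (Inl x), Inl (Inr y), Inr q, Inr idle}"

definition single_mark :: "nat \<Rightarrow> nat \<Rightarrow> nat \<Rightarrow> ((nat + nat) + nat) set" where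
  "single_mark x y j = {Inl (Inl x), Inl (Inr y), Inr j}"

lemma mark_step:
  assumes t: "t \<in> transitions system" "enabled t (mark x y q)" and q: "live q"
  obtains (left) a x' q' where "(x, a, x') \<in> E1" "(q, Some (Inl a), q') \<in> E"
      "fire t (mark x y q) = mark x' y q'" "(mark x y q - pre t) \<inter> post t = {}"
    | (right) a y' q' where "(y, a, y') \<in> E2" "(q, Some (Inr a), q') \<in> E"
      "fire t (mark x y q) = mark x y' q'" "(mark x y q - pre t) \<inter> post t = {}"
    | (tau) q' where "(q, None, q') \<in> E" "fire t (mark x y q) = mark x y q'"
      "(mark x y q - pre t) \<inter> post t = {}"
proof -
  have q': "q \<noteq> init" using q by (simp add: live_def)
  from t(1) show thesis
  proof (cases rule: system_transition_cases)
    case (left x1 a y1 q1 q')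
    with t(2) edge_live[OF left(2)] have "x1 = x" "q1 = q" by (auto simp: enabled_def mark_def left_def live_def)
    with left edge_live[OF left(2)] show thesis
      by (intro that(1)[of a y1 q']) (auto simp: fire_def mark_def left_def live_def)
  next
    case (right x1 a y1 q1 q')
    with t(2) edge_live[OF right(2)] have "x1 = y" "q1 = q" by (auto simp: enabled_def mark_def right_def live_def)
    with right edge_live[OF right(2)] show thesis
      by (intro that(2)[of a y1 q']) (auto simp: fire_def mark_def right_def live_def)
  next
    case (tau q1 q')
    with t(2) edge_live[OF tau(1)] have "q1 = q" by (auto simp: enabled_def mark_def tau_def live_def)
    with tau edge_live[OF tau(1)] show thesis
      by (intro that(3)[of q']) (auto simp: fire_def mark_def tau_def live_def)
  qed (use t(2) q' neq in \<open>auto simp: enabled_def mark_def junk_def split_def\<close>)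
qed

lemma init_step:
  assumes t: "t \<in> transitions system" "enabled t (single_mark x y init)"
  obtains (split) "fire t (single_mark x y init) = mark x y start" "(single_mark x y init - pre t) \<inter> post t = {}"
    | (junk) j where "j \<in> {junk1, junk2}" "fire t (single_mark x y init) = single_mark x y j"
      "(single_mark x y init - pre t) \<inter> post t = {}"
  using t(1)
proof (cases rule: system_transition_cases)
  case (left x1 a y1 q1 q')
  with t(2) edge_live[OF left(2)] show thesis by (auto simp: enabled_def single_mark_def left_def live_def)
next
  case (right x1 a y1 q1 q')
  with t(2) edge_live[OF right(2)] show thesis by (auto simp: enabled_def single_mark_def right_def live_def)
next
  case (tau q1 q')
  with t(2) edge_live[OF tau(1)] show thesis by (auto simp: enabled_def single_mark_def tau_def live_def)
next
  case split
  with neq show thesis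
    by (intro that(1)) (auto simp: fire_def mark_def single_mark_def split_def)
next
  case (junk j)
  with neq show thesis
    by (intro that(2)[of j]) (auto simp: fire_def single_mark_def junk_def)
qed

lemma junk_mark_dead:
  assumes "t \<in> transitions system" "j \<in> {junk1, junk2}"
  shows "\<not> enabled t (single_mark x y j)"
  using assms(1)
proof (cases rule: system_transition_cases)
  case (left x a y q q')
  with edge_live[OF left(2)] assms(2) show ?thesis by (auto simp: left_def enabled_def single_mark_def live_def)
next
  case (right x a y q q')
  with edge_live[OF right(2)] assms(2) show ?thesis by (auto simp: right_def enabled_def single_mark_def live_def)
next
  case (tau q q')
  with edge_live[OF tau(1)] assms(2) show ?thesis by (auto simp: tau_def enabled_def single_mark_def live_def)
qed (use assms(2) neq in \<open>auto simp: junk_def split_def enabled_def single_mark_def\<close>)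

lemma system_initial: "initial system = single_mark p p' init"
  by (simp add: single_mark_def)

lemma system_reachable:
  "reachable system M \<Longrightarrow> (\<exists>x y q. live q \<and> M = mark x y q) \<or>
    (\<exists>x y j. j \<in> {init, junk1, junk2} \<and> M = single_mark x y j)"
proof (induction rule: reachable.induct)
  case initial
  show ?case unfolding system_initial by blast
next
  case (step M t)
  from step.IH show ?case
  proof (elim disjE exE conjE)
    fix x y q assume *: "live q" "M = mark x y q"
    from step(2) step(3)[unfolded *(2)] *(1) show ?thesis
      unfolding *(2) by (cases rule: mark_step) (use edge_live in metis)+
  next
    fix x y j assume *: "j \<in> {init, junk1, junk2}" "M = single_mark x y j"
    show ?thesis
    proof (cases "j = init")
      case True
      from step(2) step(3)[unfolded *(2) True] show ?thesis
        unfolding *(2) True by (cases rule: init_step) (use live_simps in blast)+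
    next
      case False
      with * junk_mark_dead[OF step(2)] step(3) show ?thesis by blast
    qed
  qed
qed

lemma system_contact_free: "contact_free system"
  unfolding contact_free_def
proof (intro allI impI)
  fix M t assume M: "reachable system M" and t: "t \<in> transitions system" "enabled t M"
  from system_reachable[OF M] show "(M - pre t) \<inter> post t = {}"
  proof (elim disjE exE conjE)
    fix x y q assume *: "live q" "M = mark x y q"
    from t(1) t(2)[unfolded *(2)] *(1) show ?thesis
      unfolding *(2) by (cases rule: mark_step)
  next
    fix x y j assume *: "j \<in> {init, junk1, junk2}" "M = single_mark x y j"
    show ?thesis
    proof (cases "j = init")
      case True
      from t(1) t(2)[unfolded *(2) True] show ?thesis
        unfolding *(2) True by (cases rule: init_step)
    next
      case False
      with * junk_mark_dead[OF t(1)] t(2) show ?thesis by blast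
    qed
  qed
qed

lemma system_petri: "petri_net system"
  unfolding petri_net_def
proof (intro conjI subsetI)
  fix t assume "t \<in> transitions system"
  then show "t \<in> nonempty_finite_subsets (places system) \<times> insert None (Some ` alphabet system) \<times>
      nonempty_finite_subsets (places system)"
  proof (cases rule: system_transition_cases)
    case (left x a y q q')
    moreover have "x \<in> P" "y \<in> P" "a \<in> A" "q \<in> Q" "q' \<in> Q"
      using left(1) E1 A(2) edge[OF left(2)] by auto
    ultimately show ?thesis by (auto simp: left_def nonempty_finite_subsets_def)
  next
    case (right x a y q q')
    moreover have "x \<in> P'" "y \<in> P'" "a \<in> A" "q \<in> Q" "q' \<in> Q"
      using right(1) E2 A(2) edge[OF right(2)] by auto
    ultimately show ?thesis by (auto simp: right_def nonempty_finite_subsets_def)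
  next
    case (tau q q')
    with edge[OF tau(1)] show ?thesis by (auto simp: tau_def nonempty_finite_subsets_def)
  qed (use states in \<open>auto simp: junk_def split_def nonempty_finite_subsets_def\<close>)
next
  show "initial system \<in> nonempty_finite_subsets (places system)"
    using states p by (auto simp: nonempty_finite_subsets_def)
qed (use A in simp)

lemma system_no_flow:
  "dead_end E1 x \<Longrightarrow> (Inl (Inl x), y) \<notin> flow system"
  "dead_end E2 x \<Longrightarrow> (Inl (Inr x), y) \<notin> flow system"
  "(Inr fin, y) \<notin> flow system" "(Inr idle, y) \<notin> flow system"
proof -
  have "(Inl (Inl x), y) \<notin> flow system" if "dead_end E1 x"
  proof
    assume "(Inl (Inl x), y) \<in> flow system"
    then obtain t where t: "t \<in> transitions system" "Inl (Inl x) \<in> pre t" unfolding flow_def by blast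
    then show False using that
      by (cases rule: system_transition_cases) (auto simp: left_def right_def tau_def split_def junk_def dead_end_def)
  qed
  then show "dead_end E1 x \<Longrightarrow> (Inl (Inl x), y) \<notin> flow system" .
  have "(Inl (Inr x), y) \<notin> flow system" if "dead_end E2 x"
  proof
    assume "(Inl (Inr x), y) \<in> flow system"
    then obtain t where t: "t \<in> transitions system" "Inl (Inr x) \<in> pre t" unfolding flow_def by blast
    then show False using that
      by (cases rule: system_transition_cases) (auto simp: left_def right_def tau_def split_def junk_def dead_end_def)
  qed
  then show "dead_end E2 x \<Longrightarrow> (Inl (Inr x), y) \<notin> flow system" .
  have "(Inr q, y) \<notin> flow system" if q: "q \<in> {fin, idle}" for q
  proof
    assume "(Inr q, y) \<in> flow system"
    then obtain t where t: "t \<in> transitions system" "Inr q \<in> pre t" unfolding flow_def by blast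
    then show False
    proof (cases rule: system_transition_cases)
      case (left x a y q1 q')
      with t(2) q edge[OF left(2)] show ?thesis by (auto simp: left_def)
    next
      case (right x a y q1 q')
      with t(2) q edge[OF right(2)] show ?thesis by (auto simp: right_def)
    next
      case (tau q1 q')
      with t(2) q edge[OF tau(1)] show ?thesis by (auto simp: tau_def)
    qed (use t(2) q neq in \<open>auto simp: split_def junk_def\<close>)
  qed
  then show "(Inr fin, y) \<notin> flow system" "(Inr idle, y) \<notin> flow system" by simp_all
qed

section \<open>Firing rules and schedules\<close>

lemma firing_left:
  assumes "(x, a, x') \<in> E1" "(q, Some (Inl a), q') \<in> E"
  shows "firing_step system (mark x y q) (Some (left x a x' q q')) (mark x' y q')"
  using left_transition[OF assms] edge_live[OF assms(2)]
  by (auto simp: enabled_def fire_def mark_def left_def live_def)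

lemma firing_right:
  assumes "(y, a, y') \<in> E2" "(q, Some (Inr a), q') \<in> E"
  shows "firing_step system (mark x y q) (Some (right y a y' q q')) (mark x y' q')"
  using right_transition[OF assms] edge_live[OF assms(2)]
  by (auto simp: enabled_def fire_def mark_def right_def live_def)

lemma firing_tau:
  assumes "(q, None, q') \<in> E"
  shows "firing_step system (mark x y q) (Some (tau q q')) (mark x y q')"
  using tau_transition[OF assms] edge_live[OF assms]
  by (auto simp: enabled_def fire_def mark_def tau_def live_def)

lemma firing_split: "firing_step system (single_mark x y init) (Some split) (mark x y start)"
  using split_transition neq by (auto simp: enabled_def fire_def mark_def single_mark_def split_def)

text \<open>A finite firing sequence from \<open>M0\<close> to \<open>F\<close>, padded with pauses
  to fit \<open>firing_sequence\<close>.\<close>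

definition schedule :: "((nat + nat) + nat) set \<Rightarrow> ((nat + nat) + nat) set \<Rightarrow> bool" where
  "schedule M0 F \<longleftrightarrow> (\<exists>M ts N. M 0 = M0 \<and> (\<forall>k. firing_step system (M k) (ts k) (M (Suc k))) \<and>
     (\<forall>k\<ge>N. ts k = None \<and> M k = F))"

lemma schedule_refl: "schedule F F"
  unfolding schedule_def by (intro exI[of _ "\<lambda>_. F"] exI[of _ "\<lambda>_. None"] exI[of _ 0]) simp

lemma schedule_step:
  assumes "firing_step system M0 (Some t) M1" "schedule M1 F"
  shows "schedule M0 F"
proof -
  obtain M ts N where M: "M 0 = M1" "\<And>k. firing_step system (M k) (ts k) (M (Suc k))"
    "\<And>k. N \<le> k \<Longrightarrow> ts k = None \<and> M k = F"
    using assms(2) unfolding schedule_def by metis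
  have "firing_step system (case_nat M0 M k) (case_nat (Some t) ts k) (case_nat M0 M (Suc k))" for k
    using assms(1) M(1,2) by (cases k) auto
  moreover have "case_nat (Some t) ts k = None \<and> case_nat M0 M k = F" if "Suc N \<le> k" for k
    using M(3)[of "k - 1"] that by (cases k) auto
  ultimately show ?thesis
    unfolding schedule_def
    by (intro exI[of _ "case_nat M0 M"] exI[of _ "case_nat (Some t) ts"] exI[of _ "Suc N"]) auto
qed

end

section \<open>Universal may testing as language inclusion\<close>

context composition
begin

text \<open>In the last marking no place has a successor in the flow of the system, since both tapes
  are at dead ends and nothing leaves \<open>fin\<close> or \<open>idle\<close>. Every token with a
  successor has thus been consumed before, and the test places that remain are the successful
  ones.\<close>

lemma schedule_passes:
  assumes sched: "schedule (initial system) (mark x y fin)" and dead: "dead_end E1 x" "dead_end E2 y"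
  shows "\<exists>(K :: ('a + 'a, nat) net) f. maximal_run system K f \<and> terminates_successfully test K f"
proof -
  obtain M ts N where M: "M 0 = initial system" "\<And>k. firing_step system (M k) (ts k) (M (Suc k))"
    "\<And>k. N \<le> k \<Longrightarrow> ts k = None \<and> M k = mark x y fin"
    using sched unfolding schedule_def by metis
  interpret firing_sequence system M ts
    by unfold_locales (use system_petri system_contact_free M in auto)
  have "maximal_run system process place_of"
  proof (rule process_maximal, rule ccontr)
    fix k r s assume r: "r \<in> M k" "(r, s) \<in> flow system"
      and "\<not> (\<exists>l\<ge>k. \<exists>t. ts l = Some t \<and> r \<in> pre t)"
    then have "r \<in> M (max k N)" by (intro persist[OF r(1)]) auto
    then have "r \<in> mark x y fin" using M(3) by simp
    with r(2) system_no_flow dead show False by (auto simp: mark_def)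
  qed
  moreover have "terminates_successfully test process place_of"
    unfolding terminates_successfully_def
  proof (intro conjI ballI allI impI)
    show "finite (places process)" by (rule process_finite[of N]) (use M in blast)
    fix r q assume r: "r \<in> places process" "place_of r = Inr q" "\<nexists>r'. (r, r') \<in> flow process"
    from process_end[OF r(1,3)] obtain k where "\<forall>l\<ge>k. place_of r \<in> M l" by blast
    then have "place_of r \<in> M (max k N)" by simp
    with M(3)[of "max k N"] r(2) show "q \<in> success test" by (auto simp: mark_def)
  qed
  ultimately show ?thesis by blast
qed

end

section \<open>Finite and infinite tapes that pass\<close>

definition cap :: "nat option \<Rightarrow> nat \<Rightarrow> nat" where
  "cap n i = (case n of None \<Rightarrow> i | Some m \<Rightarrow> min i m)"

lemma cap_simps:
  "within n i \<Longrightarrow> cap n i = i" "within n i \<Longrightarrow> cap n (Suc i) = Suc i"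
  "\<not> within n i \<Longrightarrow> cap n (Suc i) = cap n i" "\<not> within n i \<Longrightarrow> n = Some (cap n i)" "cap n 0 = 0"
  by (cases n; auto simp: cap_def min_def)+

locale chains = composition +
  fixes n n' :: "nat option" and e e' :: "nat \<Rightarrow> nat" and a a' :: "nat \<Rightarrow> 'a"
  assumes E1_chain: "E1 = chain n e a" and E2_chain: "E2 = chain n' e' a'"
    and p_start: "p = e 0" "p' = e' 0"
    and chain_end: "\<And>m. n = Some m \<Longrightarrow> dead_end E1 (e m)" "\<And>m. n' = Some m \<Longrightarrow> dead_end E2 (e' m)"
begin

lemma chain_step:
  "within n i \<Longrightarrow> (e i, a i, e (Suc i)) \<in> E1" "within n' i \<Longrightarrow> (e' i, a' i, e' (Suc i)) \<in> E2"
  by (auto simp: E1_chain E2_chain chain_def)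

lemma accepts_schedule:
  assumes "n = Some m" "n' = Some m'"
    and "accepts E fin q w w'" "w = map a [i..<m]" "w' = map a' [j..<m']" "i \<le> m" "j \<le> m'"
  shows "schedule (mark (e i) (e' j) q) (mark (e m) (e' m') fin)"
  using assms(3-)
proof (induction arbitrary: i j rule: accepts.induct)
  case accepts_fin
  then have "i = m" "j = m'" by auto
  then show ?case by (simp add: schedule_refl)
next
  case (accepts_tau q q' w w')
  then show ?case by (blast intro: schedule_step[OF firing_tau])
next
  case (accepts_left q b q' w w')
  then have i: "i < m" using upt_rec[of i m] by (cases "i < m") auto
  then have "b = a i" "w = map a [Suc i..<m]" using accepts_left.prems(1) by (auto simp: upt_conv_Cons)
  with i assms(1) accepts_left show ?case
    using schedule_step[OF firing_left[OF chain_step(1)[of i]], of q q' "e' j"] by auto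
next
  case (accepts_right q b q' w w')
  then have j: "j < m'" using upt_rec[of j m'] by (cases "j < m'") auto
  then have "b = a' j" "w' = map a' [Suc j..<m']" using accepts_right.prems(2) by (auto simp: upt_conv_Cons)
  with j assms(2) accepts_right show ?case
    using schedule_step[OF firing_right[OF chain_step(2)[of j]], of q q' "e i"] by auto
qed

theorem finite_pass:
  assumes "n = Some m" "n' = Some m'" "accepts E fin start (map a [0..<m]) (map a' [0..<m'])"
  shows "\<exists>(K :: ('a + 'a, nat) net) f. maximal_run system K f \<and> terminates_successfully test K f"
proof (rule schedule_passes)
  show "schedule (initial system) (mark (e m) (e' m') fin)"
    unfolding system_initial
  proof (rule schedule_step[OF firing_split])
    have "mark (e 0) (e' 0) start = mark p p' start" by (simp only: p_start)
    with accepts_schedule[OF assms, of 0 0] show "schedule (mark p p' start) (mark (e m) (e' m') fin)" by simp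
  qed
qed (use assms chain_end in auto)

text \<open>The tapes take turns, the left one at even and the right one at odd times, and a tape at
  its end pauses. Before step \<open>k\<close> the left tape has had \<open>Suc k div 2\<close>
  turns and the right one \<open>k div 2\<close>.\<close>

definition loop_mark :: "nat \<Rightarrow> ((nat + nat) + nat) set" where
  "loop_mark k = mark (e (cap n (Suc k div 2))) (e' (cap n' (k div 2))) loop"

definition loop_step :: "nat \<Rightarrow> ('a + 'a, (nat + nat) + nat) transition option" where
  "loop_step k = (let i = k div 2 in
     if even k then if within n i then Some (left (e i) (a i) (e (Suc i)) loop loop) else None
     else if within n' i then Some (right (e' i) (a' i) (e' (Suc i)) loop loop) else None)"

lemma loop_step_simps:
  "within n i \<Longrightarrow> loop_step (2 * i) = Some (left (e i) (a i) (e (Suc i)) loop loop)"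
  "within n' i \<Longrightarrow> loop_step (Suc (2 * i)) = Some (right (e' i) (a' i) (e' (Suc i)) loop loop)"
  by (simp_all add: loop_step_def)

lemma chain_label: "(x, b, y) \<in> E1 \<Longrightarrow> b \<in> B - {z}" "(x, b, y) \<in> E2 \<Longrightarrow> b \<in> B - {z}"
  using E1 E2 by auto

lemma loop_firing: "firing_step system (loop_mark k) (loop_step k) (loop_mark (Suc k))"
proof (cases "even k")
  case True
  then obtain i where k: "k = 2 * i" by blast
  show ?thesis
  proof (cases "within n i")
    case True
    have st: "(e i, a i, e (Suc i)) \<in> E1" by (rule chain_step(1)[OF True])
    from firing_left[OF st conjunct1[OF loop[OF chain_label(1)[OF st]]]] show ?thesis
      using True by (simp add: loop_mark_def loop_step_def k cap_simps)
  next
    case False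
    then show ?thesis by (simp add: loop_mark_def loop_step_def k cap_simps)
  qed
next
  case False
  then obtain i where k: "k = Suc (2 * i)" by (metis oddE Suc_eq_plus1)
  show ?thesis
  proof (cases "within n' i")
    case True
    have st: "(e' i, a' i, e' (Suc i)) \<in> E2" by (rule chain_step(2)[OF True])
    from firing_right[OF st conjunct2[OF loop[OF chain_label(2)[OF st]]]] show ?thesis
      using True by (simp add: loop_mark_def loop_step_def k cap_simps)
  next
    case False
    then show ?thesis by (simp add: loop_mark_def loop_step_def k cap_simps)
  qed
qed

lemma loop_steps_unbounded:
  assumes "n = None \<or> n' = None"
  shows "\<exists>l\<ge>k. \<exists>t. loop_step l = Some t \<and> Inr loop \<in> pre t"
  using assms
proof
  assume "n = None"
  then have "within n k" by simp
  from loop_step_simps(1)[OF this] show ?thesis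
    by (intro exI[of _ "2 * k"] conjI exI) (auto simp: left_def)
next
  assume "n' = None"
  then have "within n' k" by simp
  from loop_step_simps(2)[OF this] show ?thesis
    by (intro exI[of _ "Suc (2 * k)"] conjI exI) (auto simp: right_def)
qed

lemma loop_progress:
  assumes inf: "n = None \<or> n' = None" and r: "r \<in> loop_mark k" "(r, s) \<in> flow system"
  shows "\<exists>l\<ge>k. \<exists>t. loop_step l = Some t \<and> r \<in> pre t"
proof -
  from r(1) consider "r = Inl (Inl (e (cap n (Suc k div 2))))" | "r = Inl (Inr (e' (cap n' (k div 2))))"
    | "r = Inr loop" | "r = Inr idle"
    by (auto simp: loop_mark_def mark_def)
  then show ?thesis
  proof cases
    case 1
    have w: "within n (Suc k div 2)"
      using system_no_flow(1)[OF chain_end(1)] cap_simps(4) r(2) 1 by blast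
    \<comment> \<open>The next turn of the left tape is the least even time from \<open>k\<close>
      on; in the next case it is the least odd time.\<close>
    from loop_step_simps(1)[OF w] 1 show ?thesis
      by (intro exI[of _ "2 * (Suc k div 2)"] conjI exI) (auto simp: left_def cap_simps w)
  next
    case 2
    have w: "within n' (k div 2)"
      using system_no_flow(2)[OF chain_end(2)] cap_simps(4) r(2) 2 by blast
    from loop_step_simps(2)[OF w] 2 show ?thesis
      by (intro exI[of _ "Suc (2 * (k div 2))"] conjI exI) (auto simp: right_def cap_simps w)
  next
    case 3
    with loop_steps_unbounded[OF inf] show ?thesis by blast
  next
    case 4
    with r(2) system_no_flow(4) show ?thesis by blast
  qed
qed

text \<open>If one tape is infinite, maximality still demands that the other one be read to its end.
  Alternating turns achieve this, and \<open>loop\<close> never refuses a letter. The split and the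
  move from \<open>start\<close> to \<open>loop\<close> come first, which shifts the schedule by
  two.\<close>

theorem infinite_pass:
  assumes inf: "n = None \<or> n' = None"
  shows "\<exists>(K :: ('a + 'a, nat) net) f. maximal_run system K f \<and> deadlock_free K"
proof -
  define M where "M = case_nat (initial system) (case_nat (mark p p' start) loop_mark)"
  define ts where "ts = case_nat (Some split) (case_nat (Some (tau start loop)) loop_step)"
  have M_simps: "M 0 = initial system" "M (Suc 0) = mark p p' start" "\<And>k. M (Suc (Suc k)) = loop_mark k"
    and ts_simps: "ts 0 = Some split" "ts (Suc 0) = Some (tau start loop)" "\<And>k. ts (Suc (Suc k)) = loop_step k"
    by (simp_all add: M_def ts_def)
  have loop0: "loop_mark 0 = mark p p' loop" by (simp add: loop_mark_def cap_simps p_start)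
  have step: "firing_step system (M k) (ts k) (M (Suc k))" for k
  proof (cases k)
    case 0
    show ?thesis unfolding 0 M_simps ts_simps system_initial by (rule firing_split)
  next
    case (Suc l)
    show ?thesis
    proof (cases l)
      case 0
      show ?thesis unfolding Suc 0 M_simps ts_simps loop0 by (intro firing_tau start_loop)
    next
      case (Suc m)
      show ?thesis unfolding \<open>k = Suc l\<close> Suc M_simps ts_simps by (intro loop_firing)
    qed
  qed
  interpret firing_sequence system M ts
    by unfold_locales (use system_petri system_contact_free M_simps(1) step in auto)
  have "maximal_run system process place_of"
  proof (rule process_maximal)
    fix k r s assume r: "r \<in> M k" "(r, s) \<in> flow system"
    have later: "\<exists>l\<ge>k. \<exists>t. ts l = Some t \<and> r \<in> pre t" if m: "r \<in> loop_mark m" "k \<le> Suc (Suc m)" for m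
    proof -
      obtain l t where "m \<le> l" "loop_step l = Some t" "r \<in> pre t" using loop_progress[OF inf m(1) r(2)] by blast
      with m(2) ts_simps(3) show ?thesis by (intro exI[of _ "Suc (Suc l)"]) auto
    qed
    consider "k = 0" | "k = Suc 0" | m where "k = Suc (Suc m)" by (metis not0_implies_Suc)
    then show "\<exists>l\<ge>k. \<exists>t. ts l = Some t \<and> r \<in> pre t"
    proof cases
      case 1
      then show ?thesis
        using r(1) later[of 0] ts_simps(1) unfolding 1 M_simps system_initial loop0
        by (auto simp: single_mark_def mark_def split_def)
    next
      case 2
      have "r = Inr start \<or> r \<in> loop_mark 0"
        using r(1) unfolding 2 M_simps loop0 by (auto simp: mark_def)
      then show ?thesis
      proof
        assume "r = Inr start"
        then show ?thesis using 2 ts_simps(2) by (intro exI[of _ "Suc 0"]) (auto simp: tau_def)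
      next
        assume "r \<in> loop_mark 0"
        then show ?thesis using later[of 0] 2 by simp
      qed
    next
      case 3
      then show ?thesis using later[of m] r(1) M_simps(3) by simp
    qed
  qed
  moreover have "infinite (places process)"
  proof (rule process_infinite)
    fix k
    obtain l t where "k \<le> l" "loop_step l = Some t" using loop_steps_unbounded[OF inf] by blast
    then show "\<exists>l\<ge>k. ts l \<noteq> None" using ts_simps(3) by (intro exI[of _ "Suc (Suc l)"]) auto
  qed
  ultimately show ?thesis unfolding deadlock_free_def by blast
qed

end

section \<open>Passing on two words requires acceptance\<close>

context composition
begin

text \<open>Suppose the words are not accepted and fire transitions of \<open>K\<close> for as long
  as possible. After the split, the rest of the tapes is never accepted from the current state of
  the test, and the number of unread letters plus the rank decreases, so a dead marking is reached.
  By \<open>causal_deadlock\<close> the run is then finite, so it would have to terminate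
  successfully. That leaves the state \<open>fin\<close> with both tapes read, where the empty rest
  is accepted. Junk runs are not successful.\<close>

theorem word_pass_accepts:
  fixes K :: "('a + 'a, nat) net"
  assumes E: "E1 = word_edges w" "E2 = word_edges w'" "p = 0" "p' = 0"
    and run: "maximal_run system K g" and pass: "deadlock_free K \<or> terminates_successfully test K g"
  shows "accepts E fin start w w'"
proof (rule ccontr)
  assume na: "\<not> accepts E fin start w w'"
  have is_run: "is_run system K g" using run by (simp add: maximal_run_def)
  then have K: "causal_net K" and inj: "\<And>M. reachable K M \<Longrightarrow> inj_on g M"
    and trans: "\<And>t. t \<in> transitions K \<Longrightarrow> (g ` pre t, act t, g ` post t) \<in> transitions system"
    and ini: "g ` initial K = initial system"
    by (auto simp: is_run_def)
  define final where "final M \<longleftrightarrow> reachable K M \<and> (\<forall>t\<in>transitions K. \<not> enabled t M) \<and>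
      ((\<exists>i j q. i \<le> length w \<and> j \<le> length w' \<and> g ` M = mark i j q \<and> \<not> accepts E fin q (drop i w) (drop j w')) \<or>
       (\<exists>i j q. q \<in> {junk1, junk2} \<and> g ` M = single_mark i j q))" for M
  have image_step: "\<exists>t'. t' \<in> transitions system \<and> enabled t' (g ` M) \<and> g ` fire t M = fire t' (g ` M)"
    if M: "reachable K M" and t: "t \<in> transitions K" "enabled t M" for M t
  proof (intro exI conjI)
    show "(g ` pre t, act t, g ` post t) \<in> transitions system" by (rule trans[OF t(1)])
    show "enabled (g ` pre t, act t, g ` post t) (g ` M)" using t(2) by (auto simp: enabled_def)
    show "g ` fire t M = fire (g ` pre t, act t, g ` post t) (g ` M)"
      by (rule fire_image[OF inj[OF M]]) (use t(2) in \<open>simp add: enabled_def\<close>)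
  qed
  have junk_final: "final M" if "reachable K M" "q \<in> {junk1, junk2}" "g ` M = single_mark i j q" for M i j q
    unfolding final_def using that image_step junk_mark_dead by metis
  have descend: "\<exists>M'. final M'"
    if "reachable K M" "g ` M = mark i j q" "live q" "i \<le> length w" "j \<le> length w'"
      "\<not> accepts E fin q (drop i w) (drop j w')" for M i j q
    using that
  proof (induction "(length w - i) + (length w' - j) + rank q" arbitrary: M i j q rule: less_induct)
    case less
    show ?case
    proof (cases "\<forall>t\<in>transitions K. \<not> enabled t M")
      case True
      then have "final M" unfolding final_def using less.prems by blast
      then show ?thesis by blast
    next
      case False
      then obtain t where t: "t \<in> transitions K" "enabled t M" by blast
      obtain t' where t': "t' \<in> transitions system" "enabled t' (mark i j q)" "g ` fire t M = fire t' (mark i j q)"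
        using image_step[OF less.prems(1) t] less.prems(2) by auto
      have reach: "reachable K (fire t M)" by (rule reachable.step[OF less.prems(1) t])
      from t'(1,2) less.prems(3) show ?thesis
      proof (cases rule: mark_step)
        case (left b i' q')
        then have i: "i' = Suc i" "i < length w" "b = w ! i" by (auto simp: E)
        have "drop i w = b # drop (Suc i) w" using i by (simp add: Cons_nth_drop_Suc)
        with less.prems(6) left(2) have "\<not> accepts E fin q' (drop (Suc i) w) (drop j w')"
          by (auto intro: accepts_left)
        then show ?thesis
          by (intro less.hyps[of "Suc i" j q' "fire t M"])
            (use i rank_label[OF left(2)] reach t'(3) left(3) edge_live[OF left(2)] less.prems in auto)
      next
        case (right b j' q')
        then have j: "j' = Suc j" "j < length w'" "b = w' ! j" by (auto simp: E)
        have "drop j w' = b # drop (Suc j) w'" using j by (simp add: Cons_nth_drop_Suc)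
        with less.prems(6) right(2) have "\<not> accepts E fin q' (drop i w) (drop (Suc j) w')"
          by (auto intro: accepts_right)
        then show ?thesis
          by (intro less.hyps[of i "Suc j" q' "fire t M"])
            (use j rank_label[OF right(2)] reach t'(3) right(3) edge_live[OF right(2)] less.prems in auto)
      next
        case (tau q')
        with less.prems(6) have "\<not> accepts E fin q' (drop i w) (drop j w')"
          by (auto intro: accepts_tau)
        then show ?thesis
          by (intro less.hyps[of i j q' "fire t M"])
            (use rank_tau[OF tau(1)] reach t'(3) tau(2) edge_live[OF tau(1)] less.prems in auto)
      qed
    qed
  qed
  have init: "g ` initial K = single_mark 0 0 init" using ini system_initial E by simp
  have "\<exists>M. final M"
  proof (cases "\<forall>t\<in>transitions K. \<not> enabled t (initial K)")
    \<comment> \<open>The token on \<open>init\<close> cannot stay, because the flow of the system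
      leads on from there.\<close>
    case True
    have "x \<in> initial K \<Longrightarrow> (x, y) \<notin> flow K" for x y
      using causal_deadlock(2)[OF K reachable.initial] True by blast
    moreover have "Inr init \<in> g ` initial K" using init by (simp add: single_mark_def)
    then obtain x where x: "x \<in> initial K" "g x = Inr init" by auto
    moreover have "x \<in> places K" using x(1) petri_net_initial[OF causal_netD(1)[OF K]] by blast
    moreover have "(Inr init, Inr start) \<in> flow system"
      using split_transition by (force simp: flow_def split_def)
    ultimately show ?thesis using run unfolding maximal_run_def by metis
  next
    case False
    then obtain t where t: "t \<in> transitions K" "enabled t (initial K)" by blast
    obtain t' where t': "t' \<in> transitions system" "enabled t' (single_mark 0 0 init)"
      "g ` fire t (initial K) = fire t' (single_mark 0 0 init)"
      using image_step[OF reachable.initial t] init by auto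
    have reach: "reachable K (fire t (initial K))" by (rule reachable.step[OF reachable.initial t])
    from t'(1,2) show ?thesis
    proof (cases rule: init_step)
      case split
      then show ?thesis using descend[OF reach, of 0 0 start] t'(3) na by simp
    next
      case (junk j)
      with junk_final[OF reach, of j 0 0] t'(3) show ?thesis by auto
    qed
  qed
  then obtain M where M: "final M" by blast
  then have reach: "reachable K M" and dead: "\<And>t. t \<in> transitions K \<Longrightarrow> \<not> enabled t M" by (auto simp: final_def)
  have fin: "finite (places K)" and ends: "\<And>x y. x \<in> M \<Longrightarrow> (x, y) \<notin> flow K"
    using causal_deadlock[OF K reach dead] by auto
  have MK: "M \<subseteq> places K"
    using reach
  proof (induction rule: reachable.induct)
    case initial
    then show ?case using petri_net_initial(1)[OF causal_netD(1)[OF K]] .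
  next
    case (step M t)
    then show ?case using petri_netD(2)[OF causal_netD(1)[OF K] step(2)] by (auto simp: fire_def)
  qed
  from fin pass have succ: "terminates_successfully test K g" by (auto simp: deadlock_free_def)
  have succ': "q \<in> {fin, idle}" if "Inr q \<in> g ` M" for q
  proof -
    from that obtain x where "x \<in> M" "g x = Inr q" by auto
    with succ ends MK have "q \<in> success test" unfolding terminates_successfully_def by blast
    then show ?thesis by simp
  qed
  have stuck: "(r, s) \<notin> flow system" if r: "r \<in> g ` M" for r s
  proof
    assume "(r, s) \<in> flow system"
    moreover from r obtain x where "x \<in> M" "g x = r" by blast
    ultimately show False using run ends MK unfolding maximal_run_def by blast
  qed
  from M have "(\<exists>i j q. i \<le> length w \<and> j \<le> length w' \<and> g ` M = mark i j q \<and>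
        \<not> accepts E fin q (drop i w) (drop j w')) \<or>
      (\<exists>i j q. q \<in> {junk1, junk2} \<and> g ` M = single_mark i j q)"
    unfolding final_def by (elim conjE)
  then consider (mark) i j q where "i \<le> length w" "j \<le> length w'" "g ` M = mark i j q"
      "\<not> accepts E fin q (drop i w) (drop j w')"
    | (junk) i j q where "q \<in> {junk1, junk2}" "g ` M = single_mark i j q" by metis
  then show False
  proof cases
    case mark
    \<comment> \<open>Maximality asks for a successor in the flow of the net, whether or not the
      present state of the test can read the letter. The edges at \<open>loop\<close> provide such a
      successor for every letter, so an unread letter contradicts maximality.\<close>
    have i: "i = length w"
    proof (rule ccontr)
      assume "i \<noteq> length w"
      with mark(1) have st: "(i, w ! i, Suc i) \<in> E1" by (auto simp: E)
      have lb: "w ! i \<in> B - {z}" using st E1 by auto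
      from left_transition[OF st conjunct1[OF loop[OF lb]]]
      have "(Inl (Inl i), Inr loop) \<in> flow system" by (force simp: flow_def left_def)
      with stuck mark(3) show False by (auto simp: mark_def)
    qed
    have j: "j = length w'"
    proof (rule ccontr)
      assume "j \<noteq> length w'"
      with mark(2) have st: "(j, w' ! j, Suc j) \<in> E2" by (auto simp: E)
      have lb: "w' ! j \<in> B - {z}" using st E2 by auto
      from right_transition[OF st conjunct2[OF loop[OF lb]]]
      have "(Inl (Inr j), Inr loop) \<in> flow system" by (force simp: flow_def right_def)
      with stuck mark(3) show False by (auto simp: mark_def)
    qed
    have "q = fin \<or> q = idle" using succ'[of q] mark(3) by (auto simp: mark_def)
    moreover have "q \<noteq> idle"
    proof
      assume "q = idle"
      from system_reachable[OF run_reachable[OF is_run reach]] mark(3) \<open>q = idle\<close> neq show False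
        by (auto simp: mark_def single_mark_def live_def doubleton_eq_iff set_eq_iff)
    qed
    ultimately show False using mark(4) i j by (auto intro: accepts_fin)
  next
    case junk
    then show False using succ'[of q] neq by (auto simp: single_mark_def)
  qed
qed

end

context tester
begin

definition language :: "(nat \<times> 'a \<times> nat) set \<Rightarrow> nat \<Rightarrow> 'a list set" where
  "language EN p = {w. \<exists>x. path EN p w x \<and> dead_end EN x}"

text \<open>A word of the language gives a finite maximal run, and a pair of these passes only by
  acceptance. In the other direction every maximal run is a chain: a finite one spells a word of the
  language, and infinite ones impose no condition, as they pass at \<open>loop\<close>.\<close>

theorem universal_may_iff:
  assumes A: "finite A" "B \<subseteq> A" and EN: "EN \<subseteq> P \<times> (B - {z}) \<times> P" and p: "p \<in> P"
  shows "universal_may (state_net A P EN p) test \<longleftrightarrow>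
    (\<forall>w\<in>language EN p. \<forall>w'\<in>language EN p. accepts E fin start w w')"
proof
  let ?N = "state_net A P EN p"
  assume um: "universal_may ?N test"
  show "\<forall>w\<in>language EN p. \<forall>w'\<in>language EN p. accepts E fin start w w'"
  proof (intro ballI)
    fix w w' assume w: "w \<in> language EN p" "w' \<in> language EN p"
    have EA: "EN \<subseteq> P \<times> A \<times> P" using EN A by auto
    have run: "\<exists>f. maximal_run ?N (word_net A v) f" if "v \<in> language EN p" for v
      using word_net_maximal_run[OF A(1) EA p] that unfolding language_def by blast
    have lab: "set v \<subseteq> B - {z}" if "v \<in> language EN p" for v
    proof -
      from that obtain x where "path EN p v x" by (auto simp: language_def)
      then show ?thesis by (induction rule: path.induct) (use EN in auto)
    qed
    interpret composition B Q E init start idle never junk1 junk2 fin loop z rank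
      A "{..length w}" "{..length w'}" "word_edges w" "word_edges w'" 0 0
      by unfold_locales (use A lab[OF w(1)] lab[OF w(2)] in \<open>auto simp: subset_iff\<close>)
    obtain f f' where "maximal_run ?N (word_net A w) f" "maximal_run ?N (word_net A w') f'"
      using run w by blast
    with um have "may_pass (relabel Inl (word_net A w) \<parallel> relabel Inr (word_net A w')) test"
      unfolding universal_may_def by blast
    then obtain K :: "('a + 'a, nat) net" and g where "maximal_run system K g"
        "deadlock_free K \<or> terminates_successfully test K g"
      unfolding may_pass_def system_def by blast
    then show "accepts E fin start w w'" by (intro word_pass_accepts) auto
  qed
next
  let ?N = "state_net A P EN p"
  assume acc: "\<forall>w\<in>language EN p. \<forall>w'\<in>language EN p. accepts E fin start w w'"
  show "universal_may ?N test"
    unfolding universal_may_def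
  proof (intro allI impI)
    fix K :: "('a, nat) net" and f :: "nat \<Rightarrow> nat" and K' :: "('a, nat) net" and f' :: "nat \<Rightarrow> nat"
    assume run: "maximal_run ?N K f" and run': "maximal_run ?N K' f'"
    from maximal_run_chain[OF run] obtain n e a where
      K: "K = state_net A (places K) (chain n e a) (e 0)" "f (e 0) = p"
        "\<And>i. within n i \<Longrightarrow> (f (e i), a i, f (e (Suc i))) \<in> EN" "\<And>m. n = Some m \<Longrightarrow> dead_end EN (f (e m))"
      by blast
    from maximal_run_chain[OF run'] obtain n' e' a' where
      K': "K' = state_net A (places K') (chain n' e' a') (e' 0)" "f' (e' 0) = p"
        "\<And>i. within n' i \<Longrightarrow> (f' (e' i), a' i, f' (e' (Suc i))) \<in> EN" "\<And>m. n' = Some m \<Longrightarrow> dead_end EN (f' (e' m))"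
      by blast
    have sub: "chain n e a \<subseteq> places L \<times> (B - {z}) \<times> places L" "e 0 \<in> places L"
      "\<And>m. n = Some m \<Longrightarrow> dead_end (chain n e a) (e m)"
      if run: "maximal_run ?N L f" and L: "L = state_net A (places L) (chain n e a) (e 0)"
        and edges: "\<And>i. within n i \<Longrightarrow> (f (e i), a i, f (e (Suc i))) \<in> EN"
        and ends: "\<And>m. n = Some m \<Longrightarrow> dead_end EN (f (e m))" for L :: "('a, nat) net" and f n e a
    proof -
      have petri: "petri_net (state_net A (places L) (chain n e a) (e 0))"
        by (subst L[symmetric]) (use run in \<open>simp add: maximal_run_def is_run_def causal_net_def\<close>)
      from petri_net_initial(1)[OF petri] show "e 0 \<in> places L" by simp
      show "chain n e a \<subseteq> places L \<times> (B - {z}) \<times> places L"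
      proof
        fix s assume "s \<in> chain n e a"
        then obtain i where s: "s = (e i, a i, e (Suc i))" and i: "within n i" by (auto simp: chain_def)
        have t: "({e i}, Some (a i), {e (Suc i)}) \<in> transitions (state_net A (places L) (chain n e a) (e 0))"
          using i by (force simp: chain_def)
        from petri_netD(1,2)[OF petri t] edges[OF i] EN show "s \<in> places L \<times> (B - {z}) \<times> places L"
          unfolding s by auto
      qed
      show "dead_end (chain n e a) (e m)" if "n = Some m" for m
        unfolding dead_end_def
      proof (intro allI notI)
        \<comment> \<open>The source \<open>e i\<close> of a chain edge is mapped to the source of
          an edge of \<open>EN\<close>, while \<open>f (e m)\<close> is a dead end, so the two
          places differ.\<close>
        fix b y assume "(e m, b, y) \<in> chain n e a"
        then obtain i where "e m = e i" "within n i" by (auto simp: chain_def)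
        with edges[of i] ends[OF that] show False unfolding dead_end_def by metis
      qed
    qed
    note S = sub[OF run K(1,3,4)] and S' = sub[OF run' K'(1,3,4)]
    interpret chains B Q E init start idle never junk1 junk2 fin loop z rank
      A "places K" "places K'" "chain n e a" "chain n' e' a'" "e 0" "e' 0" n n' e e' a a'
      by unfold_locales (use A S S' in auto)
    have sys: "(relabel Inl K \<parallel> relabel Inr K') \<parallel> test = system"
      unfolding system_def
      using arg_cong[OF K(1), of "relabel (Inl :: 'a \<Rightarrow> 'a + 'a)"]
        arg_cong[OF K'(1), of "relabel (Inr :: 'a \<Rightarrow> 'a + 'a)"] by (simp only:)
    have "\<exists>(L :: ('a + 'a, nat) net) g. maximal_run system L g \<and> (deadlock_free L \<or> terminates_successfully test L g)"
    proof (cases "n = None \<or> n' = None")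
      case True
      then show ?thesis using infinite_pass by blast
    next
      case False
      then obtain m m' where m: "n = Some m" "n' = Some m'" by auto
      have "map a [0..<m] \<in> language EN p" "map a' [0..<m'] \<in> language EN p"
        using states_path[of m "\<lambda>i. f (e i)" a EN] states_path[of m' "\<lambda>i. f' (e' i)" a' EN] K K' m
        unfolding language_def by auto
      with finite_pass[OF m] acc show ?thesis by blast
    qed
    then show "may_pass (relabel Inl K \<parallel> relabel Inr K') test"
      unfolding may_pass_def sys .
  qed
qed

end

section \<open>Recursive functions and the concrete test\<close>

definition recursive :: "nat \<Rightarrow> (nat list \<Rightarrow> nat) \<Rightarrow> bool" where
  "recursive n F \<longleftrightarrow> (\<exists>g. \<forall>xs. length xs = n \<longrightarrow> computes g xs (F xs))"

lemma recursive_cong: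
  "recursive n F \<Longrightarrow> (\<And>xs. length xs = n \<Longrightarrow> F xs = G xs) \<Longrightarrow> recursive n G"
  unfolding recursive_def by metis

lemma recursive_comp:
  assumes "recursive (length Fs) H" "\<forall>F\<in>set Fs. recursive n F"
  shows "recursive n (\<lambda>xs. H (map (\<lambda>F. F xs) Fs))"
proof -
  obtain h where h: "\<And>xs. length xs = length Fs \<Longrightarrow> computes h xs (H xs)"
    using assms(1) unfolding recursive_def by blast
  obtain c where c: "\<And>F xs. F \<in> set Fs \<Longrightarrow> length xs = n \<Longrightarrow> computes (c F) xs (F xs)"
    using assms(2) unfolding recursive_def by metis
  have "computes (Comp h (map c Fs)) xs (H (map (\<lambda>F. F xs) Fs))" if "length xs = n" for xs
    by (rule computes.Comp[where ys = "map (\<lambda>F. F xs) Fs"])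
      (use h c that in \<open>auto simp: list_all2_conv_all_nth\<close>)
  then show ?thesis unfolding recursive_def by blast
qed

lemma recursive_proj: "i < n \<Longrightarrow> recursive n (\<lambda>xs. xs ! i)"
  unfolding recursive_def by (rule exI[of _ "Proj i"]) (auto intro: computes.Proj)

lemma recursive_Suc:
  assumes "recursive n F"
  shows "recursive n (\<lambda>xs. Suc (F xs))"
proof -
  have "recursive (length [F]) (\<lambda>xs. Suc (hd xs))"
    unfolding recursive_def by (rule exI[of _ Succ]) (auto intro: computes.Succ simp: length_Suc_conv)
  from recursive_comp[OF this, of n] assms show ?thesis by simp
qed

lemma recursive_const: "recursive n (\<lambda>_. c)"
proof (induction c)
  case 0
  show ?case unfolding recursive_def by (rule exI[of _ Zero]) (auto intro: computes.Zero)
next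
  case (Suc c)
  from recursive_Suc[OF this] show ?case .
qed

lemma recursive_rec:
  assumes "recursive n F" "recursive (Suc (Suc n)) G" "recursive n K"
  shows "recursive n (\<lambda>xs. rec_nat (F xs) (\<lambda>i y. G (i # y # xs)) (K xs))"
proof -
  obtain f g where f: "\<And>xs. length xs = n \<Longrightarrow> computes f xs (F xs)"
    and g: "\<And>xs. length xs = Suc (Suc n) \<Longrightarrow> computes g xs (G xs)"
    using assms(1,2) unfolding recursive_def by blast
  have "computes (PrimRec f g) (m # xs) (rec_nat (F xs) (\<lambda>i y. G (i # y # xs)) m)" if "length xs = n" for m xs
    by (induction m) (use f g that in \<open>auto intro: computes.intros\<close>)
  then have "recursive (Suc n) (\<lambda>zs. rec_nat (F (tl zs)) (\<lambda>i y. G (i # y # tl zs)) (hd zs))"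
    unfolding recursive_def by (intro exI[of _ "PrimRec f g"]) (auto simp: length_Suc_conv)
  then have "recursive (length (K # map (\<lambda>i xs. xs ! i) [0..<n]))
      (\<lambda>zs. rec_nat (F (tl zs)) (\<lambda>i y. G (i # y # tl zs)) (hd zs))" by simp
  from recursive_comp[OF this, of n] show ?thesis
    by (rule recursive_cong) (use assms(3) recursive_proj in \<open>auto simp: comp_def map_nth\<close>)
qed

lemma recursive_add:
  assumes "recursive n F" "recursive n G"
  shows "recursive n (\<lambda>xs. F xs + G xs)"
proof (rule recursive_cong)
  show "recursive n (\<lambda>xs. rec_nat (F xs) (\<lambda>i y. Suc ((i # y # xs) ! 1)) (G xs))"
    by (rule recursive_rec[where G = "\<lambda>zs. Suc (zs ! 1)"])
      (use assms in \<open>auto intro: recursive_Suc recursive_proj\<close>)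
  have "rec_nat m (\<lambda>i y. Suc ((i # y # xs) ! 1)) k = m + k" for m k :: nat and xs
    by (induction k) auto
  then show "rec_nat (F xs) (\<lambda>i y. Suc ((i # y # xs) ! 1)) (G xs) = F xs + G xs" for xs .
qed

lemma recursive_power2:
  assumes "recursive n F"
  shows "recursive n (\<lambda>xs. 2 ^ F xs)"
proof (rule recursive_cong)
  show "recursive n (\<lambda>xs. rec_nat 1 (\<lambda>i y. (i # y # xs) ! 1 + (i # y # xs) ! 1) (F xs))"
    by (rule recursive_rec[where G = "\<lambda>zs. zs ! 1 + zs ! 1"])
      (use assms in \<open>auto intro: recursive_add recursive_proj recursive_const\<close>)
  have "rec_nat 1 (\<lambda>i y. (i # y # xs) ! 1 + (i # y # xs) ! 1) k = 2 ^ k" for k :: nat and xs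
    by (induction k) auto
  then show "rec_nat 1 (\<lambda>i y. (i # y # xs) ! 1 + (i # y # xs) ! 1) (F xs) = 2 ^ F xs" for xs .
qed

lemma recursive_triangle:
  assumes "recursive n F"
  shows "recursive n (\<lambda>xs. triangle (F xs))"
proof (rule recursive_cong)
  have "recursive (Suc (Suc n)) (\<lambda>zs. zs ! 1 + Suc (zs ! 0))"
    by (intro recursive_add recursive_Suc recursive_proj) auto
  from recursive_rec[OF recursive_const this assms]
  show "recursive n (\<lambda>xs. rec_nat 0 (\<lambda>i y. (i # y # xs) ! 1 + Suc ((i # y # xs) ! 0)) (F xs))" .
  have "rec_nat 0 (\<lambda>i y. (i # y # xs) ! 1 + Suc ((i # y # xs) ! 0)) k = triangle k" for k :: nat and xs
    by (induction k) auto
  then show "rec_nat 0 (\<lambda>i y. (i # y # xs) ! 1 + Suc ((i # y # xs) ! 0)) (F xs) = triangle (F xs)" for xs .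
qed

lemma recursive_prod_encode:
  "recursive n F \<Longrightarrow> recursive n G \<Longrightarrow> recursive n (\<lambda>xs. prod_encode (F xs, G xs))"
  unfolding prod_encode_def by (simp add: recursive_add recursive_triangle)

lemma recursive_sum:
  assumes "recursive (Suc n) H" "recursive n K"
  shows "recursive n (\<lambda>xs. \<Sum>i<K xs. H (i # xs))"
proof (rule recursive_cong)
  \<comment> \<open>In the recursion the argument list consists of the index, the accumulated sum
    and the parameters. \<open>H\<close> must not see the sum, so position 1 is left out.\<close>
  let ?Fs = "map (\<lambda>i (zs :: nat list). zs ! i) (0 # [2..<Suc (Suc n)])"
  have "recursive (length ?Fs) H" using assms(1) by (simp del: upt_Suc)
  then have "recursive (Suc (Suc n)) (\<lambda>zs. H (map (\<lambda>F. F zs) ?Fs))"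
    by (rule recursive_comp) (auto intro: recursive_proj)
  then have H: "recursive (Suc (Suc n)) (\<lambda>zs. H (zs ! 0 # drop 2 zs))"
  proof (rule recursive_cong)
    fix zs :: "nat list" assume "length zs = Suc (Suc n)"
    then have "map (\<lambda>i. zs ! i) [2..<Suc (Suc n)] = drop 2 zs"
      by (intro nth_equalityI) (auto simp del: upt_Suc)
    then show "H (map (\<lambda>F. F zs) ?Fs) = H (zs ! 0 # drop 2 zs)" by (simp add: comp_def del: upt_Suc)
  qed
  show "recursive n (\<lambda>xs. rec_nat 0 (\<lambda>i y. (i # y # xs) ! 1 + H ((i # y # xs) ! 0 # drop 2 (i # y # xs))) (K xs))"
    by (rule recursive_rec[where G = "\<lambda>zs. zs ! 1 + H (zs ! 0 # drop 2 zs)"])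
      (use assms H in \<open>auto intro: recursive_add recursive_proj recursive_const\<close>)
  have "rec_nat 0 (\<lambda>i y. (i # y # xs) ! 1 + H ((i # y # xs) ! 0 # drop 2 (i # y # xs))) k = (\<Sum>i<k. H (i # xs))"
    for k xs by (induction k) auto
  then show "rec_nat 0 (\<lambda>i y. (i # y # xs) ! 1 + H ((i # y # xs) ! 0 # drop 2 (i # y # xs))) (K xs) =
      (\<Sum>i<K xs. H (i # xs))" for xs .
qed

text \<open>The powers of two are \<open>set_encode\<close> of the singleton pre- and postset, and
  \<open>Suc a\<close> is the code of the action \<open>Some a\<close>.\<close>

definition edge_code :: "nat \<Rightarrow> nat \<Rightarrow> nat \<Rightarrow> nat" where
  "edge_code p a q = prod_encode (2 ^ p, prod_encode (Suc a, 2 ^ q))"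

lemma recursive_edge_code:
  "recursive n F \<Longrightarrow> recursive n G \<Longrightarrow> recursive n (\<lambda>xs. edge_code (F xs) a (G xs))"
  unfolding edge_code_def
  by (intro recursive_prod_encode recursive_power2 recursive_const)

lemma encode_edge: "encode_transition id ({p}, Some a, {q}) = edge_code p a q"
  by (simp add: edge_code_def set_encode_def)

abbreviation lab :: "letter \<Rightarrow> nat" where "lab \<equiv> to_nat"
abbreviation st :: "state \<Rightarrow> nat" where "st \<equiv> to_nat"
abbreviation nd :: "node \<Rightarrow> nat" where "nd \<equiv> to_nat"

text \<open>
  The instance built from the code \<open>x\<close> of the transitions of a program and the code \<open>y\<close> of a test:
  a chain of places loads \<open>x\<close> and \<open>y\<close> into the first two registers before the program starts.
\<close>

definition instance_code :: "nat \<Rightarrow> nat \<Rightarrow> nat" where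
  "instance_code x y = prod_encode (prod_encode (\<Sum>i<x + y. 2 ^ i, prod_encode (\<Sum>i<Suc (x + x + y). 2 ^ i,
     prod_encode (x + (\<Sum>i<x. 2 ^ edge_code (x + i) (lab (Inc 0)) (Suc (x + i))) +
       (\<Sum>i<y. 2 ^ edge_code (x + x + i) (lab (Inc 1)) (Suc (x + x + i))) +
       2 ^ edge_code (x + x + y) (lab Eps) (nd In), 2 ^ x))), y)"

lemma recursive_instance_code: "recursive 2 (\<lambda>xs. instance_code (xs ! 0) (xs ! 1))"
proof -
  have x: "recursive 2 (\<lambda>xs. xs ! 0)" and y: "recursive 2 (\<lambda>xs. xs ! 1)" by (auto intro: recursive_proj)
  have i': "recursive 3 (\<lambda>xs. xs ! 0)" and x': "recursive 3 (\<lambda>xs. xs ! 1)" by (auto intro: recursive_proj)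
  have s1: "recursive 2 (\<lambda>xs. \<Sum>i<F xs. 2 ^ i)" if "recursive 2 F" for F
    using recursive_sum[of 2 "\<lambda>zs. 2 ^ (zs ! 0)" F] that i' by (simp add: recursive_power2)
  have s2: "recursive 2 (\<lambda>xs. \<Sum>i<xs ! 0. 2 ^ edge_code (xs ! 0 + i) a (Suc (xs ! 0 + i)))" for a
    using recursive_sum[of 2 "\<lambda>zs. 2 ^ edge_code (zs ! 1 + zs ! 0) a (Suc (zs ! 1 + zs ! 0))", OF _ x] i' x'
    by (simp add: recursive_power2 recursive_edge_code recursive_add recursive_Suc)
  have s3: "recursive 2 (\<lambda>xs. \<Sum>i<xs ! 1. 2 ^ edge_code (xs ! 0 + xs ! 0 + i) a (Suc (xs ! 0 + xs ! 0 + i)))" for a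
    using recursive_sum[of 2 "\<lambda>zs. 2 ^ edge_code (zs ! 1 + zs ! 1 + zs ! 0) a (Suc (zs ! 1 + zs ! 1 + zs ! 0))", OF _ y] i' x'
    by (simp add: recursive_power2 recursive_edge_code recursive_add recursive_Suc)
  show ?thesis
    unfolding instance_code_def
    by (intro recursive_prod_encode recursive_add recursive_power2 recursive_edge_code recursive_Suc
        recursive_const s1 s2 s3 x y)
qed

section \<open>The concrete test\<close>

lemma finite_letters: "finite (letters k)"
  by (auto simp: letters_def)

text \<open>Internal edges lead from \<open>Start\<close> to \<open>Loop\<close> or a check, and
  from \<open>Flush\<close> to \<open>Fin\<close>. Letters move only between checks and
  \<open>Flush\<close> or stay at \<open>Loop\<close>, so three levels are enough.\<close>

definition rank :: "nat \<Rightarrow> nat" where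
  "rank x = (case from_nat x of Start \<Rightarrow> 2 | Loop \<Rightarrow> 0 | Fin \<Rightarrow> 0 | _ \<Rightarrow> 1)"

definition test_states :: "nat \<Rightarrow> state set" where
  "test_states k = {Init, Start, Idle, Never, Junk1, Junk2, Fin, Loop, Flush} \<union> Cmp ` checks k \<union>
     (\<lambda>(c, s). Pend c s) ` (checks k \<times> letters k)"

definition test_edges_nat :: "nat \<Rightarrow> (nat \<times> (nat + nat) option \<times> nat) set" where
  "test_edges_nat k = (\<lambda>(q, u, q'). (st q, map_option (map_sum lab lab) u, st q')) ` test_edges k"

lemma test_edges_cases:
  assumes "(q, u, q') \<in> test_edges k"
  obtains (start) "q = Start" "u = None" "q' \<in> {Loop, Cmp None}"
    | (queue) r where "q = Start" "u = None" "r < k" "q' = Pend (Some r) (Rot r)"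
    | (finish) "q = Flush" "u = None" "q' = Fin"
    | (loop) a where "q \<in> {Loop, Flush}" "q' = q" "a \<in> letters k" "u = Some (Inl a) \<or> u = Some (Inr a)"
    | (cmp) c a where "c \<in> checks k" "a \<in> letters k" "q = Cmp c" "u = Some (Inl a)"
        "q' = Cmp c \<or> (\<exists>s. push c a = Some s \<and> q' = Pend c s)"
    | (pend) c s a where "c \<in> checks k" "s \<in> letters k" "a \<in> letters k" "q = Pend c s" "u = Some (Inr a)"
        "q' \<in> {Pend c s, Cmp c, Flush}"
proof -
  from assms show thesis
    unfolding test_edges_def
  proof (elim UnE)
    assume "(q, u, q') \<in> (\<lambda>(c, a). (Cmp c, Some (Inl a), case push c a of None \<Rightarrow> Cmp c | Some s \<Rightarrow> Pend c s)) `
       (checks k \<times> letters k)"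
    then obtain c a where "c \<in> checks k" "a \<in> letters k" "q = Cmp c" "u = Some (Inl a)"
      "q' = (case push c a of None \<Rightarrow> Cmp c | Some s \<Rightarrow> Pend c s)" by auto
    then show thesis by (intro cmp[of c a]) (auto split: option.splits)
  next
    assume "(q, u, q') \<in> (\<lambda>(c, s, a). (Pend c s, Some (Inr a),
        case pop c a of None \<Rightarrow> Pend c s | Some s' \<Rightarrow> if s' = s then Cmp c else Flush)) `
       (checks k \<times> letters k \<times> letters k)"
    then obtain c s a where "c \<in> checks k" "s \<in> letters k" "a \<in> letters k" "q = Pend c s" "u = Some (Inr a)"
      "q' = (case pop c a of None \<Rightarrow> Pend c s | Some s' \<Rightarrow> if s' = s then Cmp c else Flush)" by auto
    then show thesis by (intro pend[of c s a]) (auto split: option.splits)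
  qed (use start queue finish loop in auto)
qed

lemma test_edges_states:
  assumes "(q, u, q') \<in> test_edges k"
  shows "q \<in> test_states k" "q' \<in> test_states k" "q \<notin> {Init, Idle, Never, Junk1, Junk2, Fin}"
    "q' \<notin> {Init, Idle, Never, Junk1, Junk2}"
    "u = None \<Longrightarrow> rank (st q') < rank (st q)" "rank (st q') \<le> rank (st q)"
    "u \<in> insert None (Some ` (Inl ` letters k \<union> Inr ` letters k))"
proof -
  have mem: "Cmp c \<in> test_states k" "s \<in> letters k \<Longrightarrow> Pend c s \<in> test_states k" if "c \<in> checks k" for c s
    using that by (auto simp: test_states_def)
  have mem': "{Start, Fin, Loop, Flush} \<subseteq> test_states k" by (auto simp: test_states_def)
  have queue: "None \<in> checks k" "r < k \<Longrightarrow> Some r \<in> checks k \<and> Rot r \<in> letters k" for r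
    by (auto simp: checks_def letters_def)
  have "q \<in> test_states k \<and> q' \<in> test_states k \<and> q \<notin> {Init, Idle, Never, Junk1, Junk2, Fin} \<and>
    q' \<notin> {Init, Idle, Never, Junk1, Junk2} \<and> (u = None \<longrightarrow> rank (st q') < rank (st q)) \<and>
    rank (st q') \<le> rank (st q) \<and> u \<in> insert None (Some ` (Inl ` letters k \<union> Inr ` letters k))"
    using assms
  proof (cases rule: test_edges_cases)
    case start
    with mem(1)[OF queue(1)] mem' show ?thesis by (auto simp: rank_def)
  next
    case (queue r)
    with mem(2)[of "Some r" "Rot r"] \<open>\<And>r. r < k \<Longrightarrow> Some r \<in> checks k \<and> Rot r \<in> letters k\<close> mem'
    show ?thesis by (auto simp: rank_def)
  next
    case finish
    with mem' show ?thesis by (auto simp: rank_def)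
  next
    case (loop a)
    with mem' show ?thesis by (auto simp: rank_def)
  next
    case (cmp c a)
    with mem[OF cmp(1)] push_letters[of c a _ k] show ?thesis by (auto simp: rank_def)
  next
    case (pend c s a)
    with mem[OF pend(1)] mem' show ?thesis by (auto simp: rank_def)
  qed
  then show "q \<in> test_states k" "q' \<in> test_states k" "q \<notin> {Init, Idle, Never, Junk1, Junk2, Fin}"
    "q' \<notin> {Init, Idle, Never, Junk1, Junk2}"
    "u = None \<Longrightarrow> rank (st q') < rank (st q)" "rank (st q') \<le> rank (st q)"
    "u \<in> insert None (Some ` (Inl ` letters k \<union> Inr ` letters k))" by blast+
qed

lemma loop_edges:
  "a \<in> letters k \<Longrightarrow> (Loop, Some (Inl a), Loop) \<in> test_edges k \<and> (Loop, Some (Inr a), Loop) \<in> test_edges k"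
  by (auto simp: test_edges_def)

lemma start_edge: "(Start, None, Loop) \<in> test_edges k"
  by (simp add: test_edges_def)

interpretation tst: tester "lab ` insert Dead (letters k)" "st ` test_states k" "test_edges_nat k"
  "st Init" "st Start" "st Idle" "st Never" "st Junk1" "st Junk2" "st Fin" "st Loop" "lab Dead" rank for k
proof
  fix q u q' assume "(q, u, q') \<in> test_edges_nat k"
  then obtain s v s' where s: "(s, v, s') \<in> test_edges k" "q = st s" "q' = st s'"
    by (auto simp: test_edges_nat_def)
  from test_edges_states[OF s(1)]
  show "q \<in> st ` test_states k \<and> q' \<in> st ` test_states k \<and>
      q \<notin> {st Init, st Idle, st Never, st Junk1, st Junk2, st Fin} \<and>
      q' \<notin> {st Init, st Idle, st Never, st Junk1, st Junk2}"
    unfolding s(2,3) by auto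
next
  fix q u q' assume "(q, Some u, q') \<in> test_edges_nat k"
  then obtain s v s' where s: "(s, v, s') \<in> test_edges k" "q = st s" "q' = st s'" "Some u = map_option (map_sum lab lab) v"
    by (auto simp: test_edges_nat_def)
  from test_edges_states(6)[OF s(1)] show "rank q' \<le> rank q" unfolding s(2,3) .
  from test_edges_states(7)[OF s(1)] s(4)
  show "u \<in> Inl ` (lab ` insert Dead (letters k) - {lab Dead}) \<union> Inr ` (lab ` insert Dead (letters k) - {lab Dead})"
    by (auto simp: letters_def)
next
  fix q q' assume "(q, None, q') \<in> test_edges_nat k"
  then obtain s v s' where s: "(s, v, s') \<in> test_edges k" "q = st s" "q' = st s'" "v = None"
    by (auto simp: test_edges_nat_def)
  from test_edges_states(5)[OF s(1,4)] show "rank q' < rank q" unfolding s(2,3) .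
next
  fix a assume "a \<in> lab ` insert Dead (letters k) - {lab Dead}"
  then obtain b where "a = lab b" "b \<in> letters k" by auto
  then show "(st Loop, Some (Inl a), st Loop) \<in> test_edges_nat k \<and> (st Loop, Some (Inr a), st Loop) \<in> test_edges_nat k"
    using loop_edges[of b k] unfolding test_edges_nat_def by (force intro: rev_image_eqI)
next
  show "(st Start, None, st Loop) \<in> test_edges_nat k"
    using start_edge[of k] unfolding test_edges_nat_def by (force intro: rev_image_eqI)
qed (auto simp: finite_letters test_states_def checks_def)

lemma accepts_nat:
  "accepts (test_edges_nat k) (st Fin) (st Start) (map lab w) (map lab w') \<longleftrightarrow>
    accepts (test_edges k) Fin Start w w'"
  unfolding test_edges_nat_def by (rule accepts_image) auto

section \<open>The instances and the diagonal argument\<close>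

definition prog_edges :: "letter cmd \<Rightarrow> (nat \<times> nat \<times> nat) set" where
  "prog_edges c = (\<lambda>(u, a, v). (nd u, lab a, nd v)) ` graph c"

definition load_edges :: "nat \<Rightarrow> nat \<Rightarrow> (nat \<times> nat \<times> nat) set" where
  "load_edges x y = (\<lambda>i. (x + i, lab (Inc 0), Suc (x + i))) ` {..<x} \<union>
     (\<lambda>i. (x + x + i, lab (Inc 1), Suc (x + x + i))) ` {..<y} \<union> {(x + x + y, lab Eps, nd In)}"

definition load_word :: "nat \<Rightarrow> nat \<Rightarrow> letter list" where
  "load_word x y = replicate x (Inc 0) @ replicate y (Inc 1) @ [Eps]"

lemma runs_replicate_Inc: "runs qstep (replicate n (Inc r)) Q Q' \<longleftrightarrow> Q' = Q(r := Q r @ replicate n True)"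
  by (induction n arbitrary: Q) (auto simp: fun_upd_def)

lemma runs_load_word:
  "runs qstep (load_word x y) (\<lambda>_. [False]) Q \<longleftrightarrow>
    Q = (\<lambda>_. [False])(0 := False # replicate x True, 1 := False # replicate y True)"
  by (auto simp: load_word_def runs_append runs_replicate_Inc)

text \<open>Loading appends ones to initial queues that hold just the marker. The result, with the
  marker in front, represents the store on which the acceptor starts.\<close>

lemma runs_program:
  "(\<exists>w Q. path (graph (to_queue (acceptor f))) In w Out \<and> runs qstep (load_word x y @ w) (\<lambda>_. [False]) Q) \<longleftrightarrow>
    computes f [x, y] 1"
proof -
  let ?c = "to_queue (acceptor f)"
  let ?Q = "(\<lambda>_. [False])(0 := False # replicate x True, 1 := False # replicate y True) :: nat \<Rightarrow> bool list"
  let ?s = "(\<lambda>_. 0)(0 := x, 1 := y) :: nat \<Rightarrow> nat"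
  have rep: "represents ?Q ?s"
    unfolding represents_def
  proof
    fix r show "\<exists>i j. ?Q r = replicate i True @ False # replicate j True \<and> ?s r = i + j"
      by (intro exI[of _ 0] exI[of _ "?s r"]) auto
  qed
  have "(\<exists>w Q. path (graph ?c) In w Out \<and> runs qstep (load_word x y @ w) (\<lambda>_. [False]) Q) \<longleftrightarrow> (\<exists>Q. qexec ?c ?Q Q)"
    unfolding runs_append runs_load_word graph_correct by blast
  also have "\<dots> \<longleftrightarrow> (\<exists>s'. cexec (acceptor f) ?s s')"
    using to_queue_sound[OF _ rep] to_queue_complete[OF _ rep] by blast
  finally show ?thesis unfolding exec_acceptor .
qed

lemma path_hd:
  assumes "path E u w v" "dead_end E v" "(u, a, u') \<in> E" "\<And>b z. (u, b, z) \<in> E \<Longrightarrow> b = a \<and> z = u'"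
  shows "\<exists>w'. w = a # w' \<and> path E u' w' v"
  using assms(1)
proof cases
  case path_Nil
  with assms(2,3) show ?thesis by (auto simp: dead_end_def)
next
  case (path_Cons b z w')
  with assms(4) show ?thesis by blast
qed

text \<open>The number \<open>x\<close> has two roles: it is loaded into the first register, and it
  bounds the codes of the program nodes. The loading chain can therefore start at place
  \<open>x\<close> without meeting the program.\<close>

locale loader =
  fixes c :: "letter cmd" and x y :: nat
  assumes nodes: "\<And>u a v. (u, a, v) \<in> graph c \<Longrightarrow> nd u < x \<and> nd v < x"
begin

definition edges :: "(nat \<times> nat \<times> nat) set" where
  "edges = prog_edges c \<union> load_edges x y"

lemma In_bound: "nd In < x"
  using graph_In_progress[of c] nodes by blast

lemma edges_load:
  "i < x \<Longrightarrow> (x + i, b, q) \<in> edges \<longleftrightarrow> b = lab (Inc 0) \<and> q = Suc (x + i)"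
  "i < y \<Longrightarrow> (x + x + i, b, q) \<in> edges \<longleftrightarrow> b = lab (Inc 1) \<and> q = Suc (x + x + i)"
  "(x + x + y, b, q) \<in> edges \<longleftrightarrow> b = lab Eps \<and> q = nd In"
  using nodes by (fastforce simp: edges_def prog_edges_def load_edges_def)+

text \<open>The two loading segments, seen from their ends: \<open>path\<close> grows at its front,
  so the inductions below run over the number of letters that are still to be read in a
  segment.\<close>

lemma edges_load_diff:
  "Suc i \<le> x \<Longrightarrow> (x + (x - Suc i), b, q) \<in> edges \<longleftrightarrow> b = lab (Inc 0) \<and> q = x + (x - i)"
  "Suc i \<le> y \<Longrightarrow> (x + x + (y - Suc i), b, q) \<in> edges \<longleftrightarrow> b = lab (Inc 1) \<and> q = x + x + (y - i)"
  using edges_load(1)[of "x - Suc i" b q] edges_load(2)[of "y - Suc i" b q]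
  by (simp_all only: Suc_diff_Suc Suc_le_lessD add_Suc_right[symmetric] diff_Suc_less zero_less_Suc
      less_le_trans[of 0 "Suc i"] simp_thms)

lemma edges_prog: "nd u < x \<Longrightarrow> (nd u, b, q) \<in> edges \<longleftrightarrow> (\<exists>a v. (u, a, v) \<in> graph c \<and> b = lab a \<and> q = nd v)"
  by (force simp: edges_def prog_edges_def load_edges_def)

lemma prog_path:
  "path edges q w v \<Longrightarrow> q = nd u \<Longrightarrow> nd u < x \<Longrightarrow> \<exists>w0 v0. w = map lab w0 \<and> v = nd v0 \<and> nd v0 < x \<and> path (graph c) u w0 v0"
proof (induction arbitrary: u rule: path.induct)
  case (path_Nil q)
  then show ?case by (intro exI[of _ "[]"] exI[of _ u]) (auto intro: path.path_Nil)
next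
  case (path_Cons q b q' w v)
  then obtain a u' where a: "(u, a, u') \<in> graph c" "b = lab a" "q' = nd u'" using edges_prog by blast
  from path_Cons.IH[OF a(3)] nodes[OF a(1)] obtain w0 v0 where
    "w = map lab w0" "v = nd v0" "nd v0 < x" "path (graph c) u' w0 v0" by blast
  with a show ?case by (intro exI[of _ "a # w0"] exI[of _ v0]) (auto intro: path.path_Cons)
qed

lemma path_prog: "path (graph c) u w v \<Longrightarrow> path edges (nd u) (map lab w) (nd v)"
proof (induction rule: path.induct)
  case (path_Cons u a v w x)
  then have "(nd u, lab a, nd v) \<in> edges" by (force simp: edges_def prog_edges_def)
  with path_Cons show ?case by (auto intro: path.path_Cons)
qed (auto intro: path.path_Nil)

text \<open>The induction remembers that the current node is \<open>In\<close> or the target of an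
  edge; for these nodes \<open>graph_In_progress\<close> and \<open>graph_progress\<close> exclude a
  premature end.\<close>

lemma path_end_Out:
  "path (graph c) u w v \<Longrightarrow> dead_end edges (nd v) \<Longrightarrow> nd v < x \<Longrightarrow>
    (\<exists>a u'. (u', a, u) \<in> graph c) \<or> u = In \<Longrightarrow> v = Out"
proof (induction rule: path.induct)
  case (path_Nil u)
  then have "\<not> (\<exists>b z. (u, b, z) \<in> graph c)" using edges_prog[of u] by (auto simp: dead_end_def)
  with path_Nil graph_progress graph_In_progress show ?case by metis
next
  case (path_Cons u a v w x')
  then show ?case by blast
qed

lemma dead_end_Out: "nd Out < x \<Longrightarrow> dead_end edges (nd Out)"
  using edges_prog[of Out] graph_Out by (auto simp: dead_end_def)

lemma path_load:
  "path edges x (map lab (load_word x y)) (nd In)"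
proof -
  have 1: "path edges (x + (x - i)) (replicate i (lab (Inc 0))) (x + x)" if "i \<le> x" for i
    using that
  proof (induction i)
    case 0
    then show ?case by (simp add: path.path_Nil)
  next
    case (Suc i)
    then have "(x + (x - Suc i), lab (Inc 0), x + (x - i)) \<in> edges"
      by (simp only: edges_load_diff simp_thms)
    with Suc show ?case by (auto intro: path.path_Cons)
  qed
  have 2: "path edges (x + x + (y - i)) (replicate i (lab (Inc 1))) (x + x + y)" if "i \<le> y" for i
    using that
  proof (induction i)
    case 0
    then show ?case by (simp add: path.path_Nil)
  next
    case (Suc i)
    then have "(x + x + (y - Suc i), lab (Inc 1), x + x + (y - i)) \<in> edges"
      by (simp only: edges_load_diff simp_thms)
    with Suc show ?case by (auto intro: path.path_Cons)
  qed
  have 3: "path edges (x + x + y) [lab Eps] (nd In)"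
    by (rule path_single) (simp add: edges_load)
  show ?thesis
    using path_append[OF 1[OF order_refl], of "replicate y (lab (Inc 1)) @ [lab Eps]" "nd In"]
      path_append[OF 2[OF order_refl] 3] by (simp add: load_word_def)
qed

lemma load_path:
  assumes "path edges x w v" "dead_end edges v"
  shows "\<exists>w'. w = map lab (load_word x y) @ w' \<and> path edges (nd In) w' v"
proof -
  have 3: "\<exists>w'. w = lab Eps # w' \<and> path edges (nd In) w' v" if "path edges (x + x + y) w v" for w
    by (rule path_hd[OF that assms(2)]) (simp_all add: edges_load)
  have 2: "\<exists>w'. w = replicate i (lab (Inc 1)) @ lab Eps # w' \<and> path edges (nd In) w' v"
    if "path edges (x + x + (y - i)) w v" "i \<le> y" for w i
    using that
  proof (induction i arbitrary: w)
    case 0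
    then show ?case using 3 by simp
  next
    case (Suc i)
    then have "\<exists>w'. w = lab (Inc 1) # w' \<and> path edges (x + x + (y - i)) w' v"
      by (intro path_hd[OF Suc.prems(1) assms(2)]) (simp_all only: edges_load_diff simp_thms)
    with Suc show ?case by auto
  qed
  have 1: "\<exists>w'. w = replicate i (lab (Inc 0)) @ replicate y (lab (Inc 1)) @ lab Eps # w' \<and> path edges (nd In) w' v"
    if "path edges (x + (x - i)) w v" "i \<le> x" for w i
    using that
  proof (induction i arbitrary: w)
    case 0
    then show ?case using 2[of y w] by simp
  next
    case (Suc i)
    then have "\<exists>w'. w = lab (Inc 0) # w' \<and> path edges (x + (x - i)) w' v"
      by (intro path_hd[OF Suc.prems(1) assms(2)]) (simp_all only: edges_load_diff simp_thms)
    with Suc show ?case by auto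
  qed
  from 1[of x w] assms(1) show ?thesis by (auto simp: load_word_def)
qed

theorem language_edges:
  "tst.language edges x = map lab ` {load_word x y @ w | w. path (graph c) In w Out}"
proof (intro equalityI subsetI)
  fix w assume "w \<in> tst.language edges x"
  then obtain v where v: "path edges x w v" "dead_end edges v" by (auto simp: tst.language_def)
  from load_path[OF v] obtain w' where w': "w = map lab (load_word x y) @ w'" "path edges (nd In) w' v" by blast
  from prog_path[OF w'(2) refl In_bound] obtain w0 v0 where
    w0: "w' = map lab w0" "v = nd v0" "nd v0 < x" "path (graph c) In w0 v0" by blast
  have "v0 = Out" using path_end_Out[OF w0(4)] v(2) w0 by blast
  with w' w0 show "w \<in> map lab ` {load_word x y @ w | w. path (graph c) In w Out}"
    by (intro image_eqI[of _ _ "load_word x y @ w0"]) auto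
next
  fix w assume "w \<in> map lab ` {load_word x y @ w | w. path (graph c) In w Out}"
  then obtain w0 where w0: "w = map lab (load_word x y) @ map lab w0" "path (graph c) In w0 Out" by auto
  have p: "path edges x w (nd Out)" unfolding w0(1) by (rule path_append[OF path_load path_prog[OF w0(2)]])
  have "nd Out < x" using prog_path[OF path_prog[OF w0(2)] refl In_bound] by auto
  with p dead_end_Out show "w \<in> tst.language edges x" unfolding tst.language_def by blast
qed

end

section \<open>Codes of sets of transitions\<close>

lemma set_encode_ge: "finite A \<Longrightarrow> a \<in> A \<Longrightarrow> a < set_encode A"
proof -
  assume A: "finite A" "a \<in> A"
  have "a < 2 ^ a" by simp
  also have "2 ^ a \<le> set_encode A" unfolding set_encode_def using A by (intro member_le_sum) auto
  finally show ?thesis .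
qed

lemma edge_code_gt: "p < edge_code p a q" "a < edge_code p a q" "q < edge_code p a q"
proof -
  have "p < 2 ^ p" "2 ^ p \<le> edge_code p a q" unfolding edge_code_def by (simp, rule le_prod_encode_1)
  then show "p < edge_code p a q" by linarith
  have *: "prod_encode (Suc a, 2 ^ q) \<le> edge_code p a q" unfolding edge_code_def by (rule le_prod_encode_2)
  with le_prod_encode_1[of "Suc a" "2 ^ q"] show "a < edge_code p a q" by linarith
  have "q < 2 ^ q" by simp
  with * le_prod_encode_2[of "2 ^ q" "Suc a"] show "q < edge_code p a q" by linarith
qed

lemma edge_code_inject: "edge_code p a q = edge_code p' a' q' \<longleftrightarrow> p = p' \<and> a = a' \<and> q = q'"
  by (auto simp: edge_code_def prod_encode_eq)

definition edges_code :: "(nat \<times> nat \<times> nat) set \<Rightarrow> nat" where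
  "edges_code E = set_encode ((\<lambda>(p, a, q). edge_code p a q) ` E)"

lemma edges_code_sum: "edges_code E = (\<Sum>(p, a, q)\<in>E. 2 ^ edge_code p a q)"
proof -
  have "inj_on (\<lambda>(p, a, q). edge_code p a q) E" by (auto intro!: inj_onI simp: edge_code_inject)
  then show ?thesis unfolding edges_code_def set_encode_def by (simp add: sum.reindex case_prod_unfold comp_def)
qed

text \<open>Additivity lets the transitions of the program enter the code of the net as the plain
  summand \<open>x\<close>, so nothing about the program has to be decoded.\<close>

lemma edges_code_Un:
  "finite E \<Longrightarrow> finite F \<Longrightarrow> E \<inter> F = {} \<Longrightarrow> edges_code (E \<union> F) = edges_code E + edges_code F"
  unfolding edges_code_sum by (rule sum.union_disjoint)

text \<open>The code of a set of transitions exceeds every number that occurs in them. This is what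
  makes the places from \<open>x\<close> on fresh.\<close>

lemma edges_code_bound:
  assumes "finite E" "(p, a, q) \<in> E"
  shows "p < edges_code E" "a < edges_code E" "q < edges_code E"
proof -
  have "edge_code p a q < edges_code E"
    unfolding edges_code_def by (rule set_encode_ge) (use assms in force)+
  then show "p < edges_code E" "a < edges_code E" "q < edges_code E"
    using edge_code_gt[of p a q] edge_code_gt(2)[of a p q] edge_code_gt(3)[of q p a] by linarith+
qed

lemma edges_code_load_edges:
  "edges_code (load_edges x y) = (\<Sum>i<x. 2 ^ edge_code (x + i) (lab (Inc 0)) (Suc (x + i))) +
    (\<Sum>i<y. 2 ^ edge_code (x + x + i) (lab (Inc 1)) (Suc (x + x + i))) + 2 ^ edge_code (x + x + y) (lab Eps) (nd In)"
proof -
  let ?A = "(\<lambda>i. (x + i, lab (Inc 0), Suc (x + i))) ` {..<x}"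
  let ?B = "(\<lambda>i. (x + x + i, lab (Inc 1), Suc (x + x + i))) ` {..<y}"
  let ?f = "\<lambda>(p, a, q). 2 ^ edge_code p a q :: nat"
  have "sum ?f (?A \<union> ?B \<union> {(x + x + y, lab Eps, nd In)}) = sum ?f (?A \<union> ?B) + sum ?f {(x + x + y, lab Eps, nd In)}"
    by (rule sum.union_disjoint) auto
  also have "sum ?f (?A \<union> ?B) = sum ?f ?A + sum ?f ?B" by (rule sum.union_disjoint) auto
  also have "sum ?f ?A = (\<Sum>i<x. 2 ^ edge_code (x + i) (lab (Inc 0)) (Suc (x + i)))"
    by (subst sum.reindex) (auto simp: inj_on_def)
  also have "sum ?f ?B = (\<Sum>i<y. 2 ^ edge_code (x + x + i) (lab (Inc 1)) (Suc (x + x + i)))"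
    by (subst sum.reindex) (auto simp: inj_on_def)
  finally show ?thesis unfolding edges_code_sum load_edges_def by simp
qed

lemma encode_state_net:
  assumes "finite E"
  shows "encode_net id (state_net A P E p) =
    prod_encode (set_encode A, prod_encode (set_encode P, prod_encode (edges_code E, 2 ^ p)))"
proof -
  have "encode_transition id ` (\<lambda>(x, a, y). ({x}, Some a, {y})) ` E = (\<lambda>(p, a, q). edge_code p a q) ` E"
    unfolding image_image by (rule image_cong) (auto simp: encode_edge simp del: encode_transition.simps)
  then show ?thesis by (simp add: encode_net_def edges_code_def set_encode_def)
qed

text \<open>The self-reference is not circular. The program depends only on \<open>f\<close>, the
  test only on a bound for the registers of the program, and \<open>x\<close> and \<open>y\<close>
  are defined from these two. The numbers themselves appear in the net only as the lengths of the
  loading segments and as bounds, and adding the loader changes neither the program nor the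
  test.\<close>

theorem instance_exists:
  "\<exists>N T x y. (N, T) \<in> testing_instances \<and> two_maximal_runs T \<and>
    encode_instance (N, T) = instance_code x y \<and> (universal_may N T \<longleftrightarrow> \<not> computes f [x, y] 1)"
proof -
  define c where "c = to_queue (acceptor f)"
  define regs where "regs a = (case a of Inc r \<Rightarrow> r | Dec r \<Rightarrow> r | Rot r \<Rightarrow> r | _ \<Rightarrow> 0)" for a
  \<comment> \<open>At least two registers are provided for, because the loader increments registers
    0 and 1 whatever the program uses.\<close>
  obtain k where k: "2 \<le> k" "\<And>a. a \<in> set_cmd c \<Longrightarrow> regs a < k"
  proof -
    have "finite (regs ` set_cmd c)" by simp
    then obtain m where "\<forall>n\<in>regs ` set_cmd c. n \<le> m" using finite_nat_set_iff_bounded_le by blast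
    then show thesis by (intro that[of "m + 2"]) auto
  qed
  have Dead: "Dead \<notin> set_cmd (to_queue d)" for d by (induction d rule: to_queue.induct) auto
  have letters: "a \<in> letters k" if "(u, a, v) \<in> graph c" for u a v
  proof -
    have "a = Eps \<or> a \<in> set_cmd c" using graph_letters that by blast
    then show ?thesis using k(2)[of a] Dead[of "acceptor f"] by (cases a) (auto simp: letters_def regs_def c_def)
  qed
  define T where "T = tst.test k"
  define x where "x = edges_code (prog_edges c)"
  define y where "y = prod_encode (encode_net sum_encode T, set_encode (success T))"
  have fin: "finite (prog_edges c)" by (simp add: prog_edges_def finite_graph)
  have bound: "p < x" "a < x" "q < x" if "(p, a, q) \<in> prog_edges c" for p a q
    using edges_code_bound[OF fin that] by (simp_all add: x_def)
  interpret loader c x y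
  proof
    fix u a v assume "(u, a, v) \<in> graph c"
    then have "(nd u, lab a, nd v) \<in> prog_edges c" by (force simp: prog_edges_def)
    from bound[OF this] show "nd u < x \<and> nd v < x" by simp
  qed
  \<comment> \<open>Intervals replace the sets of letters and places that actually occur, since the
    codes of intervals are recursive in \<open>x\<close> and \<open>y\<close>. They are large
    enough: every letter of the test is below \<open>y\<close>, as its code enters the code of the
    test, and every node of the program is below \<open>x\<close>.\<close>
  define A where "A = {..<x + y}"
  define P where "P = {..<Suc (x + x + y)}"
  define N where "N = state_net A P edges x"
  let ?B = "lab ` insert Dead (letters k)"
  have BA: "?B \<subseteq> A"
  proof
    fix b assume b: "b \<in> ?B"
    have alph: "alphabet T = Inl ` ?B \<union> Inr ` ?B" unfolding T_def by (rule tst.test_simps)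
    have "finite (sum_encode ` alphabet T)" unfolding alph by (simp add: finite_letters)
    moreover have "sum_encode (Inl b) \<in> sum_encode ` alphabet T" unfolding alph using b by blast
    ultimately have "sum_encode (Inl b) < set_encode (sum_encode ` alphabet T)" by (rule set_encode_ge)
    also have "\<dots> \<le> encode_net sum_encode T" unfolding encode_net_def by (rule le_prod_encode_1)
    also have "\<dots> \<le> y" unfolding y_def by (rule le_prod_encode_1)
    finally show "b \<in> A" by (simp add: sum_encode_def A_def)
  qed
  have labB: "lab l \<in> ?B - {lab Dead}" if "l \<in> letters k" for l
    using that by (auto simp: letters_def)
  have eb: "edges \<subseteq> P \<times> (?B - {lab Dead}) \<times> P"
  proof -
    have "prog_edges c \<subseteq> P \<times> (?B - {lab Dead}) \<times> P"
    proof (clarify, goal_cases)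
      case (1 p a q)
      from 1 obtain u l v where "(u, l, v) \<in> graph c" "a = lab l" by (auto simp: prog_edges_def)
      with labB[OF letters] bound[OF 1] show ?case by (simp add: P_def)
    qed
    moreover have "load_edges x y \<subseteq> P \<times> (?B - {lab Dead}) \<times> P"
    proof -
      have "Inc 0 \<in> letters k" "Inc 1 \<in> letters k" "Eps \<in> letters k" using k(1) by (auto simp: letters_def)
      from this[THEN labB] In_bound show ?thesis unfolding load_edges_def P_def by auto
    qed
    ultimately show ?thesis unfolding edges_def by blast
  qed
  have xP: "x \<in> P" by (simp add: P_def)
  have finA: "finite A" "finite P" by (simp_all add: A_def P_def)
  have "finite_safe_net N"
    unfolding N_def by (rule safe_state_net) (use finA xP eb BA in auto)
  then have inst: "(N, T) \<in> testing_instances"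
    using tst.is_test[of k] unfolding testing_instances_def T_def by simp
  have finL: "finite (load_edges x y)" by (simp add: load_edges_def)
  have finE: "finite edges" using fin finL by (simp add: edges_def)
  have disj: "prog_edges c \<inter> load_edges x y = {}"
    using bound by (fastforce simp: load_edges_def)
  have code: "edges_code edges = x + edges_code (load_edges x y)"
    using edges_code_Un[OF fin finL disj] unfolding edges_def[symmetric] x_def[symmetric] .
  have "encode_instance (N, T) = prod_encode (encode_net id N, y)" by (simp add: y_def)
  also have "\<dots> = instance_code x y"
    unfolding N_def encode_state_net[OF finE] code edges_code_load_edges instance_code_def
    by (simp add: A_def P_def set_encode_def add.assoc)
  finally have enc: "encode_instance (N, T) = instance_code x y" .
  define L where "L = {load_word x y @ w | w. path (graph c) In w Out}"
  have wL: "set w \<subseteq> letters k" if "path (graph c) u w v" for u w v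
    using that by (induction rule: path.induct) (auto intro: letters)
  have L: "L \<subseteq> lists (letters k)"
  proof -
    have "set (load_word x y) \<subseteq> letters k" using k(1) by (auto simp: load_word_def letters_def)
    with wL show ?thesis unfolding L_def by fastforce
  qed
  have "universal_may N T \<longleftrightarrow> (\<forall>w\<in>tst.language edges x. \<forall>w'\<in>tst.language edges x.
      accepts (test_edges_nat k) (st Fin) (st Start) w w')"
    unfolding N_def T_def by (rule tst.universal_may_iff[OF finA(1) BA eb xP])
  also have "\<dots> \<longleftrightarrow> (\<forall>w\<in>L. \<forall>w'\<in>L. accepts (test_edges k) Fin Start w w')"
    unfolding language_edges L_def[symmetric] by (simp add: accepts_nat)
  also have "\<dots> \<longleftrightarrow> \<not> (\<exists>v\<in>L. \<exists>Q. runs qstep v (\<lambda>_. [False]) Q)" by (rule all_accepted_iff[OF L])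
  also have "(\<exists>v\<in>L. \<exists>Q. runs qstep v (\<lambda>_. [False]) Q) \<longleftrightarrow> computes f [x, y] 1"
    unfolding runs_program[symmetric] L_def c_def by blast
  finally have "universal_may N T \<longleftrightarrow> \<not> computes f [x, y] 1" .
  moreover have "two_maximal_runs T" unfolding T_def by (rule tst.two_maximal_runs_test)
  ultimately show ?thesis using inst enc by blast
qed

theorem mainTheorem1:
  shows "\<not> decidable_on encode_instance testing_instances
            (\<lambda>(N\<^sub>0, T). universal_may N\<^sub>0 T) \<and>
         \<not> decidable_on encode_instance {(N\<^sub>0, T) \<in> testing_instances. two_maximal_runs T}
            (\<lambda>(N\<^sub>0, T). universal_may N\<^sub>0 T)"
proof -
  have "\<not> decidable_on encode_instance {(N\<^sub>0, T) \<in> testing_instances. two_maximal_runs T}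
            (\<lambda>(N\<^sub>0, T). universal_may N\<^sub>0 T)"
  proof
    assume "decidable_on encode_instance {(N\<^sub>0, T) \<in> testing_instances. two_maximal_runs T}
            (\<lambda>(N\<^sub>0, T). universal_may N\<^sub>0 T)"
    then obtain d where d: "\<And>N T. (N, T) \<in> testing_instances \<Longrightarrow> two_maximal_runs T \<Longrightarrow>
        computes d [encode_instance (N, T)] (if universal_may N T then 1 else 0)"
      unfolding decidable_on_def by fastforce
    obtain g where "\<And>xs. length xs = 2 \<Longrightarrow> computes g xs (instance_code (xs ! 0) (xs ! 1))"
      using recursive_instance_code unfolding recursive_def by blast
    from this[of "[_, _]"] have g: "computes g [x, y] (instance_code x y)" for x y by simp
    \<comment> \<open>The program asks \<open>d\<close> about the instance it is part of, and this
      instance is positive iff the program does not answer 1.\<close>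
    obtain N T x y where NT: "(N, T) \<in> testing_instances" "two_maximal_runs T"
        "encode_instance (N, T) = instance_code x y" "universal_may N T \<longleftrightarrow> \<not> computes (Comp d [g]) [x, y] 1"
      using instance_exists by metis
    have "computes (Comp d [g]) [x, y] v \<longleftrightarrow> computes d [instance_code x y] v" for v
      using g[of x y] computes_deterministic[of g "[x, y]"] by (auto simp: computes_iff list_all2_Cons1)
    with NT(4) have "universal_may N T \<longleftrightarrow> \<not> computes d [instance_code x y] 1" by simp
    with d[OF NT(1,2)] NT(3) computes_deterministic[of d "[instance_code x y]" 0 1] show False
      by (auto split: if_splits)
  qed
  \<comment> \<open>A procedure that is right on all instances is right on the restricted
    ones.\<close>
  moreover from this have "\<not> decidable_on encode_instance testing_instances (\<lambda>(N\<^sub>0, T). universal_may N\<^sub>0 T)"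
    unfolding decidable_on_def by blast
  ultimately show ?thesis by blast
qed

end
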